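(* Let $\mathbb{L}$ be an $F$-finite field of prime characteristic $p>0$, let $R=\mathbb{L}[x_1,\dots,x_n]$ with $n\ge 1$, let $\mathfrak{m}=(x_1,\dots,x_n)$, and let $S=R_{\mathfrak{m}}$. Let $f\in R$ be such that $\sqrt{\operatorname{Jac}(f)}=\mathfrak{m}$. Set $\ell=\operatorname{length}_R\bigl(R/\operatorname{Jac}(f)\bigr)$ and $N=p^{2\ell+1}(\ell+1)\dim(R)$ (so $\dim(R)=n$). Then \[\tau(S,f^{\lambda})=\tau(S,(f+h)^{\lambda})\quad\text{for every } h\in\mathfrak{m}^{N}\text{ and every real } 0\le\lambda<1.\]
   Context: A field $\mathbb{L}$ of characteristic $p>0$ is $F$-finite if $[\mathbb{L}:\mathbb{L}^p]<\infty$. For $f\in R=\mathbb{L}[x_1,\dots,x_n]$, $\operatorname{Jac}(f)$ denotes the ideal of $R$ generated by $f$ and all of its partial derivatives $\partial f/\partial x_i$. Let $A$ be an $F$-finite regular ring of characteristic $p$ (here $A=S$) and $g\in A$. For an ideal $\mathfrak{b}$ and $e\ge 0$, $\mathfrak{b}^{[p^e]}$ is the ideal generated by the $p^e$-th powers of elements of $\mathfrak{b}$. For $g\in A$ and $e\ge 1$, $(g)^{[1/p^e]}$ is the smallest ideal $\mathfrak{b}$ of $A$ with $g\in\mathfrak{b}^{[p^e]}$ (it exists because $A$ is regular and $F$-finite). For a real $\lambda\ge 0$, the test ideal is $\tau(A,g^{\lambda})=\bigcup_{e\ge1}\bigl(g^{\lceil p^e\lambda\rceil}\bigr)^{[1/p^e]}$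 (an ascending union, which stabilizes). Elements of $R$ are regarded as elements of $S$ via localization. *)

theory Defs
  imports "HOL-Algebra.Algebra" "HOL-Library.Extended_Nat" "HOL-Computational_Algebra.Primes"
    Complex_Main
begin

section \<open>Fields of prime characteristic\<close>

text \<open>\<open>ord\<close> is \<open>0\<close> for elements of infinite order.\<close>

definition ring_char :: "('a, 'b) ring_scheme \<Rightarrow> nat"
  where "ring_char A = group.ord (add_monoid A) \<one>\<^bsub>A\<^esub>"

definition F_finite_field :: "nat \<Rightarrow> ('a, 'b) ring_scheme \<Rightarrow> bool"
  where "F_finite_field p L \<longleftrightarrow>
    ring.finite_dimension L ((\<lambda>x. x [^]\<^bsub>L\<^esub> p) ` carrier L) (carrier L)"


section \<open>Polynomial rings\<close>

text \<open>As in \<^theory>\<open>HOL-Algebra.Indexed_Polynomials\<close>, a monomial is a multiset of indices and a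
  polynomial is its coefficient function; that theory provides the underlying set and the addition,
  but no product of two polynomials.\<close>

definition mpoly_mult ::
    "('a, 'b) ring_scheme \<Rightarrow> ('c multiset \<Rightarrow> 'a) \<Rightarrow> ('c multiset \<Rightarrow> 'a) \<Rightarrow> ('c multiset \<Rightarrow> 'a)"
  where "mpoly_mult L P Q =
    (\<lambda>m. \<Oplus>\<^bsub>L\<^esub>ab \<in> {(a, b). a + b = m}. P (fst ab) \<otimes>\<^bsub>L\<^esub> Q (snd ab))"

definition mpoly_ring :: "('a, 'b) ring_scheme \<Rightarrow> 'c set \<Rightarrow> ('c multiset \<Rightarrow> 'a) ring"
  where "mpoly_ring L I =
    \<lparr>carrier = ring.indexed_pset L I (carrier L),
     monoid.mult = mpoly_mult L,
     one = ring.indexed_const L \<one>\<^bsub>L\<^esub>,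
     ring.zero = ring.indexed_const L \<zero>\<^bsub>L\<^esub>,
     add = ring.indexed_padd L\<rparr>"

definition mpoly_pderiv ::
    "('a, 'b) ring_scheme \<Rightarrow> 'c \<Rightarrow> ('c multiset \<Rightarrow> 'a) \<Rightarrow> ('c multiset \<Rightarrow> 'a)"
  where "mpoly_pderiv L i P = (\<lambda>m. [Suc (count m i)] \<cdot>\<^bsub>L\<^esub> P (add_mset i m))"

definition Jac :: "('a, 'b) ring_scheme \<Rightarrow> 'c set \<Rightarrow> ('c multiset \<Rightarrow> 'a) \<Rightarrow> ('c multiset \<Rightarrow> 'a) set"
  where "Jac L I f = Idl\<^bsub>mpoly_ring L I\<^esub> ({f} \<union> (\<lambda>i. mpoly_pderiv L i f) ` I)"


section \<open>Radicals, dimension, length\<close>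

definition radical :: "('a, 'b) ring_scheme \<Rightarrow> 'a set \<Rightarrow> 'a set"
  where "radical A J = {a \<in> carrier A. \<exists>k::nat. a [^]\<^bsub>A\<^esub> k \<in> J}"

definition krull_dim :: "('a, 'b) ring_scheme \<Rightarrow> enat"
  where "krull_dim A = Sup {enat k | k. \<exists>P :: nat \<Rightarrow> 'a set.
    (\<forall>i\<le>k. primeideal (P i) A) \<and> (\<forall>i<k. P i \<subset> P (Suc i))}"

text \<open>\<open>A Quot J\<close> as an \<open>A\<close>-module, with \<open>a\<close> acting as multiplication by its coset.\<close>

definition quot_module :: "('a, 'b) ring_scheme \<Rightarrow> 'a set \<Rightarrow> ('a, 'a set) module"
  where "quot_module A J = ring.extend (A Quot J)
    (module.fields (\<lambda>a C. rcoset_mult A J (J +>\<^bsub>A\<^esub> a) C))"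

definition module_length :: "('a, 'b) ring_scheme \<Rightarrow> ('a, 'c, 'd) module_scheme \<Rightarrow> enat"
  where "module_length A M = Sup {enat k | k. \<exists>N :: nat \<Rightarrow> 'c set.
    (\<forall>i\<le>k. submodule (N i) A M) \<and> (\<forall>i<k. N i \<subset> N (Suc i))}"


section \<open>Localization\<close>

text \<open>The ring of fractions with denominators in a multiplicative set \<open>U\<close>; the pair \<open>(a, s)\<close>
  stands for \<open>a / s\<close>.\<close>

definition loc_rel :: "('a, 'b) ring_scheme \<Rightarrow> 'a set \<Rightarrow> (('a \<times> 'a) \<times> ('a \<times> 'a)) set"
  where "loc_rel A U = {((a, s), (b, t)). a \<in> carrier A \<and> b \<in> carrier A \<and> s \<in> U \<and> t \<in> U \<and>
    (\<exists>u\<in>U. u \<otimes>\<^bsub>A\<^esub> (t \<otimes>\<^bsub>A\<^esub> a) = u \<otimes>\<^bsub>A\<^esub> (s \<otimes>\<^bsub>A\<^esub> b))}"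

definition frac_class :: "('a, 'b) ring_scheme \<Rightarrow> 'a set \<Rightarrow> 'a \<Rightarrow> 'a \<Rightarrow> ('a \<times> 'a) set"
  where "frac_class A U a s = loc_rel A U `` {(a, s)}"

definition loc_ring :: "('a, 'b) ring_scheme \<Rightarrow> 'a set \<Rightarrow> (('a \<times> 'a) set) ring"
  where "loc_ring A U =
    \<lparr>carrier = (carrier A \<times> U) // loc_rel A U,
     monoid.mult = (\<lambda>C D. \<Union>(a, s)\<in>C. \<Union>(b, t)\<in>D. frac_class A U (a \<otimes>\<^bsub>A\<^esub> b) (s \<otimes>\<^bsub>A\<^esub> t)),
     one = frac_class A U \<one>\<^bsub>A\<^esub> \<one>\<^bsub>A\<^esub>,
     ring.zero = frac_class A U \<zero>\<^bsub>A\<^esub> \<one>\<^bsub>A\<^esub>,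
     add = (\<lambda>C D. \<Union>(a, s)\<in>C. \<Union>(b, t)\<in>D.
       frac_class A U (a \<otimes>\<^bsub>A\<^esub> t \<oplus>\<^bsub>A\<^esub> b \<otimes>\<^bsub>A\<^esub> s) (s \<otimes>\<^bsub>A\<^esub> t))\<rparr>"

definition loc_at :: "('a, 'b) ring_scheme \<Rightarrow> 'a set \<Rightarrow> (('a \<times> 'a) set) ring"
  where "loc_at A P = loc_ring A (carrier A - P)"

definition loc_at_map :: "('a, 'b) ring_scheme \<Rightarrow> 'a set \<Rightarrow> 'a \<Rightarrow> ('a \<times> 'a) set"
  where "loc_at_map A P a = frac_class A (carrier A - P) a \<one>\<^bsub>A\<^esub>"


section \<open>Test ideals of principal ideals\<close>

definition frob_power :: "('a, 'b) ring_scheme \<Rightarrow> nat \<Rightarrow> nat \<Rightarrow> 'a set \<Rightarrow> 'a set"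
  where "frob_power A p e J = Idl\<^bsub>A\<^esub> ((\<lambda>a. a [^]\<^bsub>A\<^esub> (p ^ e)) ` J)"

text \<open>\<open>frob_root A p e g\<close> is the ideal usually written \<open>(g)^[1/p^e]\<close>. The least such ideal exists
  when \<open>A\<close> is regular and \<open>F\<close>-finite of characteristic \<open>p\<close>; the definition is meant for such
  \<open>A\<close> only, and \<open>test_ideal\<close> for \<open>lam \<ge> 0\<close> only.\<close>

definition frob_root :: "('a, 'b) ring_scheme \<Rightarrow> nat \<Rightarrow> nat \<Rightarrow> 'a \<Rightarrow> 'a set"
  where "frob_root A p e g = (LEAST J. ideal J A \<and> g \<in> frob_power A p e J)"

definition test_ideal :: "('a, 'b) ring_scheme \<Rightarrow> nat \<Rightarrow> 'a \<Rightarrow> real \<Rightarrow> 'a set"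
  where "test_ideal A p g lam =
    (\<Union>e\<in>{1..}. frob_root A p e (g [^]\<^bsub>A\<^esub> nat \<lceil>real (p ^ e) * lam\<rceil>))"

end

theory Submission
  imports Defs "HOL-Library.Multiset_Order"
begin

text \<open>Put \<open>q = p ^ e\<close>. The ideals \<open>(f ^ a)^[1/q]\<close> of \<open>S\<close> with \<open>a < q\<close> decrease in \<open>a\<close>, and all of them
  contain the Jacobian ideal \<open>J\<close> of \<open>f\<close>, because a Cartier map sends \<open>f ^ (p - 1) * f'\<close> to \<open>f'\<close> for
  every partial derivative \<open>f'\<close> of \<open>f\<close>. Hence they take at most \<open>l + 1\<close> values. The places where the value
  jumps, written with \<open>e\<close> digits in base \<open>p\<close>, form a language that is closed under deleting the first or
  the last digit and has at most \<open>l + 1\<close> words of each length. So from length \<open>l\<close> on, every word has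
  exactly one extension to the right, and the ideals of level \<open>l + 1\<close> determine those of all higher levels.

  By Nakayama's lemma the ideals of level \<open>e\<close> do not change if \<open>f\<close> is replaced by \<open>f + h\<close>
  with \<open>h\<close> in the Frobenius power \<open>(\<mm> J)^[q]\<close>. The length of \<open>R / J\<close> bounds the chain of the ideals
  \<open>J + \<mm> ^ i\<close>, which gives \<open>\<mm> ^ l \<subseteq> J\<close>, and a pigeonhole argument on the exponents of monomials
  puts \<open>\<mm> ^ N\<close> into \<open>(\<mm> J)^[q]\<close> for \<open>e = l + 1\<close>. Finally \<open>\<lambda> < 1\<close> makes the exponents that occur in
  the test ideal smaller than \<open>q\<close> once \<open>e\<close> is large.

  Ideals of \<open>S\<close> are represented by their contractions to \<open>R\<close>, so that Cartier maps are only needed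
  on \<open>R\<close>.\<close>

section \<open>Jumps\<close>

text \<open>Frobenius roots are defined as least ideals, and their existence rests on Frobenius
  powers commuting with intersections, which is opaque for ideals given by generators. Describing
  \<open>J^[p]\<close> as the set of elements that every Cartier map sends into \<open>J\<close>
  makes it immediate, and likewise the rule \<open>(J^[q] : y^q) = (J : y)^[q]\<close>. That rule is
  behind the deletion of the first digit: \<open>f^(i q + a)\<close> lies in
  \<open>(J^[p])^[q]\<close> iff \<open>(f^a)^[1/q]\<close> lies in \<open>(J^[p] : f^i)\<close>, so
  the digit \<open>i\<close> sees only the root of \<open>f^a\<close>. Deletion of the last digit
  comes from \<open>(f^(p a))^[1/(p q)] = (f^a)^[1/q]\<close>.

  The index \<open>q\<close> stays outside the comparison: there the root is the principal ideal of
  \<open>f\<close>, which need not contain the Jacobian ideal and may change with \<open>f\<close>.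
  This is why the last index is a jump by convention. The Jacobian ideal of \<open>f + h\<close> is
  never examined; \<open>f + h\<close> inherits its jumps from \<open>f\<close> at level
  \<open>l + 1\<close>. Unique extension sets in at level \<open>l\<close> because otherwise the
  number of jumps would grow \<open>l + 1\<close> times, starting from one.\<close>

text \<open>The last index \<open>p ^ e - 1\<close> always counts as a jump.\<close>

definition jumps :: "nat \<Rightarrow> (nat \<Rightarrow> nat \<Rightarrow> 'x set) \<Rightarrow> nat \<Rightarrow> nat set"
  where "jumps p T e = {a. a < p ^ e \<and> (Suc a = p ^ e \<or> T e a \<noteq> T e (Suc a))}"

lemma finite_jumps [simp]: "finite (jumps p T e)"
  unfolding jumps_def by (rule finite_subset[of _ "{..<p ^ e}"]) auto

text \<open>\<open>T e a\<close> stands for the root of level \<open>e\<close> of the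
  \<open>a\<close>-th power of a fixed element. In base \<open>p\<close>, passing from
  \<open>a\<close> to \<open>p * a\<close> appends the digit 0 and passing to
  \<open>i * p ^ e + a\<close> prepends the digit \<open>i\<close>; so \<open>refine\<close> governs
  deletion of the last digit of a jump and \<open>self_similar\<close> deletion of the
  first.\<close>

locale frobenius_tower =
  fixes p :: nat and T :: "nat \<Rightarrow> nat \<Rightarrow> 'x set"
  assumes p_gt_1: "1 < p"
    and antimono: "a \<le> b \<Longrightarrow> T e b \<subseteq> T e a"
    and refine: "T (Suc e) (p * a) = T e a"
    and self_similar: "T e a = T e (Suc a) \<Longrightarrow>
      T (Suc e) (i * p ^ e + a) = T (Suc e) (Suc (i * p ^ e + a))"
begin

text \<open>If \<open>a\<close> is not a jump, \<open>refine\<close> gives equal values at both ends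
  of the block from \<open>p * a\<close> to \<open>p * Suc a\<close>, and antitonicity squeezes
  everything in between.\<close>

lemma jumps_div:
  assumes "c \<in> jumps p T (Suc e)"
  shows "c div p \<in> jumps p T e"
proof -
  define a where "a = c div p"
  have c: "c < p * p ^ e" using assms by (simp add: jumps_def)
  have a: "a < p ^ e" using c p_gt_1 unfolding a_def
    by (simp add: less_mult_imp_div_less mult.commute)
  show ?thesis
  proof (cases "Suc a = p ^ e \<or> T e a \<noteq> T e (Suc a)")
    case True
    then show ?thesis using a by (auto simp: jumps_def a_def)
  next
    case False
    then have eq: "T (Suc e) (p * a) = T (Suc e) (p * Suc a)" unfolding refine by blast
    have 1: "p * a \<le> c" by (simp add: a_def)
    have 2: "Suc c \<le> p * Suc a" using p_gt_1 unfolding a_def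
      using dividend_less_times_div[of p c] by (simp add: Suc_leI)
    have "T (Suc e) c = T (Suc e) (Suc c)"
      using antimono[OF 1, of "Suc e"] antimono[OF 2, of "Suc e"] antimono[of c "Suc c" "Suc e"] eq
      by auto
    \<comment> \<open>The last index of level \<open>Suc e\<close> lies over the last index of level
      \<open>e\<close>, which the case assumption excludes.\<close>
    moreover have "Suc c \<noteq> p ^ Suc e"
    proof
      assume "Suc c = p ^ Suc e"
      then have "p * p ^ e \<le> p * Suc a" using 2 by simp
      then have "p ^ e \<le> Suc a" using p_gt_1 unfolding mult_le_cancel1 by linarith
      then show False using False a by simp
    qed
    ultimately show ?thesis using assms by (auto simp: jumps_def)
  qed
qed

lemma jumps_mod:
  assumes "c \<in> jumps p T (Suc e)"
  shows "c mod p ^ e \<in> jumps p T e"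
proof (rule ccontr)
  define a i where "a = c mod p ^ e" and "i = c div p ^ e"
  have c: "c = i * p ^ e + a" unfolding a_def i_def by (rule div_mult_mod_eq[symmetric])
  have pos: "0 < p ^ e" using p_gt_1 by simp
  have a: "a < p ^ e" using pos by (simp add: a_def)
  assume "c mod p ^ e \<notin> jumps p T e"
  then have na: "Suc a \<noteq> p ^ e" "T e a = T e (Suc a)" using a by (auto simp: jumps_def a_def)
  have "T (Suc e) c = T (Suc e) (Suc c)" unfolding c by (rule self_similar[OF na(2)])
  \<comment> \<open>Without a change of value, \<open>c\<close> can be a jump only as the last
    index. Then \<open>p ^ e\<close> divides \<open>Suc c\<close>, although the residue
    \<open>Suc a\<close> lies strictly between 0 and \<open>p ^ e\<close>.\<close>
  then have "Suc c = p * p ^ e" using assms by (auto simp: jumps_def)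
  then have "Suc c mod p ^ e = 0" by simp
  moreover have "Suc c mod p ^ e = Suc a" using na(1) a
    by (metis Suc_lessI a_def mod_Suc)
  ultimately show False by simp
qed

text \<open>The last index is extended by the digit \<open>p - 1\<close>. For any other jump the
  values at the two ends of the block differ by \<open>refine\<close>, so the value changes
  somewhere inside the block.\<close>

lemma jumps_child:
  assumes "a \<in> jumps p T e"
  obtains c where "c \<in> jumps p T (Suc e)" "c div p = a"
proof (cases "Suc a = p ^ e")
  case True
  define c where "c = p * a + (p - 1)"
  have Sc: "Suc c = p ^ Suc e" using p_gt_1 unfolding c_def power_Suc True[symmetric] by simp
  then have "c \<in> jumps p T (Suc e)" by (auto simp: jumps_def)
  moreover have "c div p = a" unfolding c_def by (rule div_nat_eqI) (use p_gt_1 in auto)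
  ultimately show ?thesis using that by blast
next
  case False
  then have ne: "T e a \<noteq> T e (Suc a)" and a: "a < p ^ e" using assms by (auto simp: jumps_def)
  have "\<exists>r<p. T (Suc e) (p * a + r) \<noteq> T (Suc e) (Suc (p * a + r))"
  proof (rule ccontr)
    assume *: "\<not> ?thesis"
    have "r \<le> p \<Longrightarrow> T (Suc e) (p * a + r) = T (Suc e) (p * a)" for r
      by (induction r) (use * in \<open>auto simp: Suc_le_eq\<close>)
    from this[of p] have "T (Suc e) (p * Suc a) = T (Suc e) (p * a)" by (simp add: add.commute)
    then show False using ne unfolding refine by simp
  qed
  then obtain r where r: "r < p" "T (Suc e) (p * a + r) \<noteq> T (Suc e) (Suc (p * a + r))" by blast
  have "p * a + r < p * Suc a" using r(1) by simp
  also have "\<dots> \<le> p * p ^ e" using a by (intro mult_le_mono2) simp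
  finally have "p * a + r \<in> jumps p T (Suc e)" using r(2) by (auto simp: jumps_def)
  moreover have "(p * a + r) div p = a" using r(1) by simp
  ultimately show ?thesis using that by blast
qed

lemma jumps_image_div: "(\<lambda>c. c div p) ` jumps p T (Suc e) = jumps p T e"
proof (intro equalityI subsetI)
  fix a assume "a \<in> jumps p T e"
  then obtain c where "c \<in> jumps p T (Suc e)" "c div p = a" by (rule jumps_child)
  then show "a \<in> (\<lambda>c. c div p) ` jumps p T (Suc e)" by blast
qed (auto intro: jumps_div)

text \<open>By \<open>jumps_image_div\<close> every jump of level \<open>e\<close> has a child, so
  injectivity means exactly one child each.\<close>

definition unique_children :: "nat \<Rightarrow> bool"
  where "unique_children e \<longleftrightarrow> inj_on (\<lambda>c. c div p) (jumps p T (Suc e))"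

text \<open>Write \<open>a < p ^ e\<close> as a word of length \<open>e\<close> in base \<open>p\<close>. The jumps form a language that is
  closed under deleting the last or the first letter, so a word inherits the uniqueness of its
  right extension from its suffixes.\<close>

lemma eq_by_suffix:
  assumes "unique_children e" and "c mod p ^ Suc e \<in> jumps p T (Suc e)"
    and "d mod p ^ Suc e \<in> jumps p T (Suc e)" and "c div p = d div p"
  shows "c = d"
proof -
  have div_mod: "(x mod p ^ Suc e) div p = (x div p) mod p ^ e" for x :: nat
  proof -
    have "x mod p ^ Suc e = p * ((x div p) mod p ^ e) + x mod p"
      unfolding power_Suc by (rule mod_mult2_eq)
    moreover have "x mod p < p" using p_gt_1 by simp
    ultimately show ?thesis by (intro div_nat_eqI) auto
  qed
  have "c mod p ^ Suc e = d mod p ^ Suc e"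
    by (rule inj_onD[OF assms(1)[unfolded unique_children_def] _ assms(2,3)])
      (simp only: div_mod assms(4))
  then have "c mod p = d mod p"
    using mod_mod_cancel[of p "p ^ Suc e" c] mod_mod_cancel[of p "p ^ Suc e" d] by simp
  then show ?thesis using assms(4) by (metis div_mult_mod_eq)
qed

lemma unique_children_Suc:
  assumes "unique_children e"
  shows "unique_children (Suc e)"
  unfolding unique_children_def
  by (rule inj_onI) (rule eq_by_suffix[OF assms jumps_mod jumps_mod])

lemma unique_children_mono:
  assumes "unique_children e" and "e \<le> e'"
  shows "unique_children e'"
  using assms(2)
proof (induction e' rule: dec_induct)
  case base
  show ?case by (rule assms(1))
next
  case (step n)
  show ?case by (rule unique_children_Suc) (rule step.IH)
qed

text \<open>A jump below another jump is not the last index; the value therefore drops strictly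
  after it and never recovers. Distinct jumps thus carry distinct values.\<close>

lemma card_jumps_le: "card (jumps p T e) \<le> card (T e ` {..<p ^ e})"
proof (rule card_inj_on_le)
  have "T e a \<noteq> T e b" if "a \<in> jumps p T e" "b \<in> jumps p T e" "a < b" for a b
    using that antimono[of "Suc a" b e] antimono[of a "Suc a" e] by (auto simp: jumps_def)
  then show "inj_on (T e) (jumps p T e)"
    by (intro linorder_inj_onI) auto
qed (auto simp: jumps_def)

text \<open>The number of jumps is at least one at level 0, never decreases, and increases strictly
  as long as children are not unique. If uniqueness failed at level \<open>l\<close>, it would fail
  at all earlier levels too, and level \<open>Suc l\<close> would have \<open>l + 2\<close>
  jumps.\<close>

lemma unique_children_of_bound:
  assumes "\<And>e. card (T e ` {..<p ^ e}) \<le> Suc l"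
  shows "unique_children l"
proof (rule ccontr)
  assume *: "\<not> unique_children l"
  have "e \<le> Suc l \<Longrightarrow> Suc e \<le> card (jumps p T e)" for e
  proof (induction e)
    case 0
    have "0 \<in> jumps p T 0" by (simp add: jumps_def)
    then show ?case using card_gt_0_iff[of "jumps p T 0"] finite_jumps[of p T 0] by fastforce
  next
    case (Suc e)
    have "\<not> unique_children e" using * unique_children_mono[of e l] Suc.prems by auto
    then have "card (jumps p T e) \<noteq> card (jumps p T (Suc e))"
      unfolding unique_children_def using jumps_image_div[of e]
      by (metis eq_card_imp_inj_on finite_jumps)
    moreover have "card (jumps p T e) \<le> card (jumps p T (Suc e))"
      using card_image_le[of "jumps p T (Suc e)" "\<lambda>c. c div p"] jumps_image_div[of e] by simp
    ultimately show ?case using Suc by simp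
  qed
  from this[of "Suc l"] assms[of "Suc l"] card_jumps_le[of "Suc l"] show False by simp
qed

lemma const_without_jumps:
  assumes "a \<le> b" "b < p ^ e" and "\<And>d. a \<le> d \<Longrightarrow> d < b \<Longrightarrow> d \<notin> jumps p T e"
  shows "T e b = T e a"
  using assms(1-3)
proof (induction b rule: dec_induct)
  case (step b)
  have "b \<notin> jumps p T e" using step by auto
  then have "T e b = T e (Suc b)" using step by (auto simp: jumps_def)
  moreover have "T e b = T e a" using step by auto
  ultimately show ?case by simp
qed simp

text \<open>A block with at most one jump takes at most two values, which \<open>refine\<close>
  identifies with those of the parent and of its successor. The second claim keeps the recursion
  inside the range below \<open>p ^ e\<close>, where two towers will be compared.\<close>

lemma value_from_parent:
  assumes "unique_children e" and "c < p ^ Suc e"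
  shows "T (Suc e) c =
    (if \<exists>d\<in>jumps p T (Suc e). d div p = c div p \<and> d < c then T e (Suc (c div p)) else T e (c div p))"
    and "(\<exists>d\<in>jumps p T (Suc e). d div p = c div p \<and> d < c) \<Longrightarrow> Suc (c div p) < p ^ e"
proof -
  define a where "a = c div p"
  have pa: "p * a \<le> c" by (simp add: a_def)
  have ap: "c < p * Suc a" using p_gt_1 unfolding a_def
    using dividend_less_times_div[of p c] by simp
  have a: "a < p ^ e" using assms(2) unfolding a_def
    by (simp add: less_mult_imp_div_less mult.commute)
  have div_eq: "d div p = a" if "p * a \<le> d" "d < p * Suc a" for d
    using that p_gt_1 by (metis div_nat_eqI)
  have small: "Suc a < p ^ e \<and> T (Suc e) c = T e (Suc a)"
    if d: "d \<in> jumps p T (Suc e)" "d div p = a" "d < c" for d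
  proof -
    have uniq: "d' = d" if "d' \<in> jumps p T (Suc e)" "d' div p = a" for d'
      using assms(1) d that unfolding unique_children_def inj_on_def by auto
    \<comment> \<open>In the last block the only jump is the last index itself, and no admissible
      \<open>c\<close> lies beyond it.\<close>
    have sa: "Suc a < p ^ e"
    proof (rule ccontr)
      assume "\<not> Suc a < p ^ e"
      then have sa: "Suc a = p ^ e" using a by simp
      define t where "t = p * a + (p - 1)"
      have t: "Suc t = p ^ Suc e" using p_gt_1 unfolding t_def power_Suc sa[symmetric] by simp
      then have "t \<in> jumps p T (Suc e)" by (auto simp: jumps_def)
      moreover have "t div p = a" unfolding t_def by (rule div_nat_eqI) (use p_gt_1 in auto)
      ultimately have "t = d" by (rule uniq)
      then show False using d(3) assms(2) t by simp
    qed
    have "p * Suc a < p ^ Suc e" unfolding power_Suc using sa p_gt_1 by (intro mult_strict_left_mono) auto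
    then have "T (Suc e) (p * Suc a) = T (Suc e) c"
    proof (intro const_without_jumps)
      fix d' assume d': "c \<le> d'" "d' < p * Suc a"
      then have "d' div p = a" using pa by (intro div_eq) auto
      then show "d' \<notin> jumps p T (Suc e)" using uniq[of d'] d' d(3) by auto
    qed (use ap in auto)
    then show ?thesis using sa unfolding refine by simp
  qed
  have other: "T (Suc e) c = T e a"
    if "\<not> (\<exists>d\<in>jumps p T (Suc e). d div p = a \<and> d < c)"
  proof -
    have "T (Suc e) c = T (Suc e) (p * a)"
    proof (rule const_without_jumps[OF pa assms(2)])
      fix d assume "p * a \<le> d" "d < c"
      then show "d \<notin> jumps p T (Suc e)" using that div_eq[of d] ap by auto
    qed
    then show ?thesis by (simp add: refine)
  qed
  show "T (Suc e) c =
    (if \<exists>d\<in>jumps p T (Suc e). d div p = c div p \<and> d < c then T e (Suc (c div p)) else T e (c div p))"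
    using small other unfolding a_def by auto
  show "(\<exists>d\<in>jumps p T (Suc e). d div p = c div p \<and> d < c) \<Longrightarrow> Suc (c div p) < p ^ e"
    using small unfolding a_def by auto
qed

end

text \<open>The value at \<open>p ^ e\<close> does not enter, since the last index is a jump by
  convention.\<close>

lemma jumps_cong:
  assumes "\<And>a. a < p ^ e \<Longrightarrow> T e a = T' e a"
  shows "jumps p T e = jumps p T' e"
proof -
  have "Suc a = p ^ e \<or> (T e a \<noteq> T e (Suc a)) = (T' e a \<noteq> T' e (Suc a))" if "a < p ^ e" for a
    using assms[of a] assms[of "Suc a"] that by (cases "Suc a = p ^ e") auto
  then show ?thesis unfolding jumps_def by blast
qed

text \<open>A jump \<open>c\<close> of \<open>T\<close> at level \<open>Suc e\<close> and a child
  \<open>d\<close> under \<open>T'\<close> of the same parent have all proper prefixes in common,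
  and their suffixes of length \<open>e\<close> are jumps of the common language at level
  \<open>e\<close>. Uniqueness one level lower forces \<open>c = d\<close>. Once the jumps agree,
  \<open>value_from_parent\<close> transports the values.\<close>

lemma frobenius_tower_eqI:
  assumes T: "frobenius_tower p T" and T': "frobenius_tower p T'"
    and bound: "\<And>e. card (T e ` {..<p ^ e}) \<le> Suc l"
    and eq: "\<And>a. a < p ^ Suc l \<Longrightarrow> T (Suc l) a = T' (Suc l) a"
    and "Suc l \<le> e" and "a < p ^ e"
  shows "T e a = T' e a"
proof -
  interpret T: frobenius_tower p T by fact
  interpret T': frobenius_tower p T' by fact
  have u: "T.unique_children k" if "l \<le> k" for k
    using T.unique_children_mono[OF T.unique_children_of_bound[OF bound] that] .
  \<comment> \<open>Uniqueness at level \<open>l\<close> speaks only of the jumps of level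
    \<open>Suc l\<close>, where both towers agree. So no bound on the values of \<open>T'\<close> is
    required.\<close>
  have "T'.unique_children l"
    using u[of l] jumps_cong[of p "Suc l" T T', OF eq]
    unfolding T.unique_children_def T'.unique_children_def by simp
  then have u': "T'.unique_children k" if "l \<le> k" for k
    using T'.unique_children_mono that by blast
  have "\<forall>a<p ^ e. T e a = T' e a"
    using \<open>Suc l \<le> e\<close>
  proof (induction e rule: dec_induct)
    case base
    then show ?case using eq by blast
  next
    case (step e)
    \<comment> \<open>Words of length \<open>Suc e\<close> are compared through suffixes of length
      \<open>e = Suc k\<close>, which uses unique children at level \<open>k\<close>. Hence the
      induction has to start at \<open>Suc l\<close>.\<close>
    then obtain k where k: "e = Suc k" "l \<le> k" by (metis Suc_le_D Suc_le_mono)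
    have J: "jumps p T e = jumps p T' e" by (rule jumps_cong) (use step in blast)
    have sub: "c \<in> jumps p T' (Suc e)" if c: "c \<in> jumps p T (Suc e)" for c
    proof -
      obtain d where d: "d \<in> jumps p T' (Suc e)" "d div p = c div p"
        using T'.jumps_child T.jumps_div[OF c] J by metis
      have "c = d"
        using T.eq_by_suffix[OF u[OF k(2)], of c d] T.jumps_mod[OF c] T'.jumps_mod[OF d(1)] J d(2)
        unfolding k(1) by simp
      then show ?thesis using d by simp
    qed
    have sub': "c \<in> jumps p T (Suc e)" if c: "c \<in> jumps p T' (Suc e)" for c
    proof -
      obtain d where d: "d \<in> jumps p T (Suc e)" "d div p = c div p"
        using T.jumps_child T'.jumps_div[OF c] J by metis
      have "c = d"
        using T.eq_by_suffix[OF u[OF k(2)], of c d] T'.jumps_mod[OF c] T.jumps_mod[OF d(1)] J d(2)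
        unfolding k(1) by simp
      then show ?thesis using d by simp
    qed
    have JS: "jumps p T (Suc e) = jumps p T' (Suc e)" using sub sub' by blast
    show ?case
    proof (intro allI impI)
      fix c assume c: "c < p ^ Suc e"
      have le: "l \<le> e" using step by simp
      have cd: "c div p < p ^ e" using c by (simp add: less_mult_imp_div_less mult.commute)
      show "T (Suc e) c = T' (Suc e) c"
        unfolding T.value_from_parent(1)[OF u[OF le] c] T'.value_from_parent(1)[OF u'[OF le] c] JS
        using T'.value_from_parent(2)[OF u'[OF le] c] step.IH cd by auto
    qed
  qed
  then show ?thesis using assms(6) by blast
qed

section \<open>Criteria for ideals of commutative rings\<close>

lemma (in cring) ideal_intro:
  assumes "K \<subseteq> carrier R" and "\<zero> \<in> K"
    and "\<And>x y. x \<in> K \<Longrightarrow> y \<in> K \<Longrightarrow> x \<oplus> y \<in> K"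
    and "\<And>a x. a \<in> carrier R \<Longrightarrow> x \<in> K \<Longrightarrow> a \<otimes> x \<in> K"
  shows "ideal K R"
proof (rule idealI[OF ring_axioms])
  have "\<ominus> x \<in> K" if "x \<in> K" for x
    using assms(4)[of "\<ominus> \<one>" x] assms(1) that by (simp add: l_minus subset_iff)
  then show "subgroup K (add_monoid R)"
    using assms(1-3) by (intro add.subgroupI) (auto simp: a_inv_def[symmetric])
next
  fix a x assume "a \<in> K" "x \<in> carrier R"
  then show "x \<otimes> a \<in> K" "a \<otimes> x \<in> K" using assms(1) assms(4)[of x a] by (auto simp: m_comm)
qed

lemma (in ring)
  assumes "ideal J R"
  shows ideal_zero: "\<zero> \<in> J" and ideal_add: "x \<in> J \<Longrightarrow> y \<in> J \<Longrightarrow> x \<oplus> y \<in> J"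
  using additive_subgroup.zero_closed[OF ideal.axioms(1)[OF assms]]
    additive_subgroup.a_closed[OF ideal.axioms(1)[OF assms]] by auto

section \<open>The binomial theorem\<close>

lemma (in cring) binomial:
  assumes x: "x \<in> carrier R" and y: "y \<in> carrier R"
  shows "(x \<oplus> y) [^] n = (\<Oplus>k\<in>{..n}. add_pow R (n choose k) (x [^] k \<otimes> y [^] (n - k)))"
proof (induction n)
  case 0
  then show ?case using x y by simp
next
  case (Suc n)
  define t where "t = (\<lambda>n k. add_pow R (n choose k) (x [^] k \<otimes> y [^] (n - k)))"
  have t: "t n k \<in> carrier R" for n k using x y by (simp add: t_def)
  have rec: "t (Suc n) (Suc k) = x \<otimes> t n k \<oplus> y \<otimes> t n (Suc k)" if "k \<le> n" for k
  proof -
    have 1: "x \<otimes> t n k = add_pow R (n choose k) (x [^] Suc k \<otimes> y [^] (n - k))"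
      using x y by (simp add: t_def add_pow_rdistr m_ac)
    have 2: "y \<otimes> t n (Suc k) = add_pow R (n choose Suc k) (x [^] Suc k \<otimes> y [^] (n - k))"
    proof (cases "k < n")
      case True
      then have "n - k = Suc (n - Suc k)" by simp
      then have "y [^] (n - k) = y [^] (n - Suc k) \<otimes> y" by simp
      then show ?thesis using x y unfolding t_def by (simp add: add_pow_rdistr m_ac del: nat_pow_Suc)
    next
      \<comment> \<open>Here \<open>k = n\<close> and the exponent \<open>n - Suc k\<close> is
        truncated; the vanishing binomial coefficient makes this harmless.\<close>
      case False
      then have "n choose Suc k = 0" using that by simp
      then show ?thesis unfolding t_def \<open>n choose Suc k = 0\<close> using x y by simp
    qed
    show ?thesis unfolding 1 2 unfolding t_def using x y by (simp add: add.nat_pow_mult del: nat_pow_Suc)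
  qed
  have S: "(x \<oplus> y) [^] n = finsum R (t n) {..n}" using Suc by (simp add: t_def)
  have "finsum R (t (Suc n)) {..Suc n} = (\<Oplus>k\<in>{..n}. t (Suc n) (Suc k)) \<oplus> t (Suc n) 0"
    by (rule add.finprod_Suc2) (use t in auto)
  also have "(\<Oplus>k\<in>{..n}. t (Suc n) (Suc k)) = (\<Oplus>k\<in>{..n}. x \<otimes> t n k \<oplus> y \<otimes> t n (Suc k))"
    by (rule add.finprod_cong') (use t x y rec in auto)
  also have "\<dots> = x \<otimes> finsum R (t n) {..n} \<oplus> y \<otimes> (\<Oplus>k\<in>{..n}. t n (Suc k))"
    using t x y by (simp add: finsum_addf finsum_rdistr)
  also have "t (Suc n) 0 = y \<otimes> t n 0" using x y by (simp add: t_def m_ac)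
  also have "x \<otimes> finsum R (t n) {..n} \<oplus> y \<otimes> (\<Oplus>k\<in>{..n}. t n (Suc k)) \<oplus> y \<otimes> t n 0
    = x \<otimes> finsum R (t n) {..n} \<oplus> y \<otimes> ((\<Oplus>k\<in>{..n}. t n (Suc k)) \<oplus> t n 0)"
    using t x y by (simp add: r_distr a_assoc)
  also have "(\<Oplus>k\<in>{..n}. t n (Suc k)) \<oplus> t n 0 = finsum R (t n) {..Suc n}"
    by (rule add.finprod_Suc2[symmetric]) (use t in auto)
  also have "\<dots> = finsum R (t n) {..n}"
  proof -
    have "n choose Suc n = 0" by simp
    then have "t n (Suc n) = \<zero>" unfolding t_def \<open>n choose Suc n = 0\<close> using x y by simp
    then show ?thesis using t by simp
  qed
  also have "x \<otimes> finsum R (t n) {..n} \<oplus> y \<otimes> finsum R (t n) {..n} = (x \<oplus> y) [^] Suc n"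
    using t x y S by (simp add: l_distr m_comm)
  finally show ?case by (simp add: t_def)
qed

lemma (in cring) frobenius_add:
  assumes "Factorial_Ring.prime (p :: nat)" and "add_pow R p \<one> = \<zero>" and x: "x \<in> carrier R" and y: "y \<in> carrier R"
  shows "(x \<oplus> y) [^] p = x [^] p \<oplus> y [^] p"
proof -
  obtain q where q: "p = Suc (Suc q)"
    using prime_ge_2_nat[OF assms(1)] by (metis add_2_eq_Suc le_Suc_ex)
  have zero: "add_pow R (m * p) z = \<zero>" if "z \<in> carrier R" for m z
  proof -
    have "add_pow R (p * m) z = add_pow R p \<one> \<otimes> (add_pow R m z)"
      using that by (simp add: add_pow_ldistr add_pow_rdistr add.nat_pow_pow mult.commute)
    then show ?thesis using that assms(2) by (simp add: mult.commute)
  qed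
  have 1: "add_pow R (p choose Suc k) z = \<zero>" if "z \<in> carrier R" "k \<le> q" for k z
  proof -
    have "p dvd (p choose Suc k)" using assms(1) that q by (intro dvd_choose_prime) auto
    then show ?thesis using zero[OF that(1)] by (metis dvd_def mult.commute)
  qed
  have "(x \<oplus> y) [^] p = (\<Oplus>k\<in>{..Suc (Suc q)}. add_pow R (p choose k) (x [^] k \<otimes> y [^] (p - k)))"
    using binomial[OF x y, of p] q by simp
  also have "\<dots> = x [^] p \<oplus> (\<Oplus>k\<in>{..Suc q}. add_pow R (p choose k) (x [^] k \<otimes> y [^] (p - k)))"
    using x y by (subst add.finprod_Suc) (auto simp: q simp del: nat_pow_Suc)
  also have "(\<Oplus>k\<in>{..Suc q}. add_pow R (p choose k) (x [^] k \<otimes> y [^] (p - k)))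
    = (\<Oplus>k\<in>{..q}. add_pow R (p choose Suc k) (x [^] Suc k \<otimes> y [^] (p - Suc k))) \<oplus> y [^] p"
    using x y by (subst add.finprod_Suc2) auto
  also have "(\<Oplus>k\<in>{..q}. add_pow R (p choose Suc k) (x [^] Suc k \<otimes> y [^] (p - Suc k))) = \<zero>"
    by (rule add.finprod_one_eqI) (use 1 x y in auto)
  finally show ?thesis using x y by simp
qed

section \<open>Derivations and the failure of additivity of \<open>x^(p-1) D x\<close>\<close>

definition derivation :: "('a, 'b) ring_scheme \<Rightarrow> ('a \<Rightarrow> 'a) \<Rightarrow> bool"
  where "derivation R D \<longleftrightarrow> D \<in> carrier R \<rightarrow> carrier R \<and>
    (\<forall>x\<in>carrier R. \<forall>y\<in>carrier R. D (x \<oplus>\<^bsub>R\<^esub> y) = D x \<oplus>\<^bsub>R\<^esub> D y \<and>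
      D (x \<otimes>\<^bsub>R\<^esub> y) = x \<otimes>\<^bsub>R\<^esub> D y \<oplus>\<^bsub>R\<^esub> D x \<otimes>\<^bsub>R\<^esub> y)"

context cring
begin

context
  fixes D assumes D: "derivation R D"
begin

lemma derivation_closed [simp]: "x \<in> carrier R \<Longrightarrow> D x \<in> carrier R"
  and derivation_add: "x \<in> carrier R \<Longrightarrow> y \<in> carrier R \<Longrightarrow> D (x \<oplus> y) = D x \<oplus> D y"
  and derivation_mult: "x \<in> carrier R \<Longrightarrow> y \<in> carrier R \<Longrightarrow> D (x \<otimes> y) = x \<otimes> D y \<oplus> D x \<otimes> y"
  using D by (auto simp: derivation_def)

lemma derivation_zero: "D \<zero> = \<zero>"
  using derivation_add[of \<zero> \<zero>] by (metis a_comm add.r_cancel_one derivation_closed r_zero zero_closed)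

lemma derivation_add_pow:
  assumes "x \<in> carrier R" shows "D (add_pow R (n::nat) x) = add_pow R n (D x)"
  using assms by (induction n) (auto simp: derivation_zero derivation_add)

lemma derivation_pow:
  assumes "x \<in> carrier R" shows "D (x [^] Suc n) = add_pow R (Suc n) (x [^] n \<otimes> D x)"
proof (induction n)
  case 0
  then show ?case using assms by simp
next
  case (Suc n)
  have "D (x [^] Suc (Suc n)) = x [^] Suc n \<otimes> D x \<oplus> D (x [^] Suc n) \<otimes> x"
    using assms derivation_mult[of "x [^] Suc n" x] by simp
  also have "D (x [^] Suc n) \<otimes> x = add_pow R (Suc n) (x [^] Suc n \<otimes> D x)"
    unfolding Suc using assms
    by (simp add: add_pow_ldistr add_pow_rdistr m_ac del: add.nat_pow_Suc)
  finally show ?case using assms by (simp add: a_comm)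
qed

lemma derivation_finsum:
  assumes "finite A" "g \<in> A \<rightarrow> carrier R"
  shows "D (finsum R g A) = (\<Oplus>k\<in>A. D (g k))"
  using assms
proof (induction A rule: finite_induct)
  case (insert a A)
  then show ?case by (simp add: derivation_add Pi_def)
qed (simp add: derivation_zero)

text \<open>The element \<open>u\<close> is \<open>((f + g) ^ p - f ^ p - g ^ p) / p\<close>.\<close>

lemma derivation_frobenius_defect:
  assumes "Factorial_Ring.prime (p :: nat)" and f: "f \<in> carrier R" and g: "g \<in> carrier R"
  obtains u where "u \<in> carrier R"
    and "(f \<oplus> g) [^] (p - 1) \<otimes> D (f \<oplus> g) =
      f [^] (p - 1) \<otimes> D f \<oplus> g [^] (p - 1) \<otimes> D g \<oplus> D u"
proof -
  obtain r where r: "p = Suc (Suc r)"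
    using prime_ge_2_nat[OF assms(1)] by (metis add_2_eq_Suc le_Suc_ex)
  define c where "c k = (p choose Suc k) div p" for k
  have pc: "p * c k = (p choose Suc k)" if "k \<le> r" for k
    unfolding c_def using assms(1) that r by (intro dvd_mult_div_cancel dvd_choose_prime) auto
  \<comment> \<open>Differentiating the term \<open>t k\<close> below produces the factors
    \<open>Suc k\<close> and \<open>Suc r - k\<close>. They turn the binomial coefficients divided
    by \<open>p\<close> into the coefficients of \<open>(f + g)^(p - 1)\<close>, where
    \<open>p - 1 = Suc r\<close>.\<close>
  have c1: "c k * Suc k = (Suc r choose k)" if "k \<le> r" for k
  proof -
    have "p * (c k * Suc k) = p * (Suc r choose k)"
      using pc[OF that] Suc_times_binomial[of k "Suc r"] unfolding r
      by (metis mult.assoc mult.commute)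
    then show ?thesis unfolding mult_cancel1 using r by linarith
  qed
  have c2: "c k * (Suc r - k) = (Suc r choose Suc k)" if "k \<le> r" for k
  proof -
    have "p * (c k * (Suc r - k)) = (p choose Suc k) * (Suc r - k)"
      using pc[OF that] by (metis mult.assoc)
    also have "\<dots> = p * (Suc r choose Suc k)"
      using binomial_absorb_comp[of p "Suc k"] r by (simp add: mult.commute)
    finally show ?thesis unfolding mult_cancel1 using r by linarith
  qed
  define t where "t = (\<lambda>k. add_pow R (c k) (f [^] Suc k \<otimes> g [^] (Suc r - k)))"
  define a where "a = (\<lambda>k. add_pow R (Suc r choose k) (f [^] k \<otimes> g [^] (Suc r - k)))"
  have t: "t k \<in> carrier R" and a: "a k \<in> carrier R" for k using f g by (auto simp: t_def a_def)
  have Dt: "D (t k) = D f \<otimes> a k \<oplus> D g \<otimes> a (Suc k)" if k: "k \<le> r" for k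
  proof -
    have e: "Suc r - k = Suc (r - k)" using k by simp
    have "D (t k) = add_pow R (c k) (f [^] Suc k \<otimes> (add_pow R (Suc r - k) (g [^] (r - k) \<otimes> D g)) \<oplus>
      (add_pow R (Suc k) (f [^] k \<otimes> D f)) \<otimes> g [^] (Suc r - k))"
    proof -
      have "D (t k) = add_pow R (c k) (D (f [^] Suc k \<otimes> g [^] Suc (r - k)))"
        unfolding t_def e by (rule derivation_add_pow) (use f g in auto)
      also have "D (f [^] Suc k \<otimes> g [^] Suc (r - k)) =
          f [^] Suc k \<otimes> D (g [^] Suc (r - k)) \<oplus> D (f [^] Suc k) \<otimes> g [^] Suc (r - k)"
        by (rule derivation_mult) (use f g in auto)
      finally show ?thesis unfolding derivation_pow[OF f] derivation_pow[OF g] e .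
    qed
    also have "\<dots> = add_pow R (c k * Suc k) (f [^] k \<otimes> D f \<otimes> g [^] (Suc r - k)) \<oplus>
      add_pow R (c k * (Suc r - k)) (f [^] Suc k \<otimes> (g [^] (r - k) \<otimes> D g))"
      using f g by (simp add: add_pow_ldistr add_pow_rdistr add.nat_pow_pow add.nat_pow_distrib a_comm
          mult.commute del: nat_pow_Suc add.nat_pow_Suc)
    also have "\<dots> = D f \<otimes> a k \<oplus> D g \<otimes> a (Suc k)"
      unfolding c1[OF k] c2[OF k] a_def using f g k
      by (simp add: add_pow_rdistr m_ac del: nat_pow_Suc add.nat_pow_Suc)
    finally show ?thesis .
  qed
  \<comment> \<open>\<open>A\<close> is the expansion of \<open>(f + g)^(p - 1)\<close> without the
    term \<open>f^(p - 1)\<close>, and \<open>B\<close> is the same expansion without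
    \<open>g^(p - 1)\<close>.\<close>
  define u A B where "u = finsum R t {..r}" and "A = finsum R a {..r}"
    and "B = (\<Oplus>k\<in>{..r}. a (Suc k))"
  have cl: "u \<in> carrier R" "A \<in> carrier R" "B \<in> carrier R"
    using t a by (auto simp: u_def A_def B_def)
  have Du: "D u = D f \<otimes> A \<oplus> D g \<otimes> B"
  proof -
    have "D u = (\<Oplus>k\<in>{..r}. D (t k))" unfolding u_def by (rule derivation_finsum) (use t in auto)
    also have "\<dots> = (\<Oplus>k\<in>{..r}. D f \<otimes> a k \<oplus> D g \<otimes> a (Suc k))"
      by (rule add.finprod_cong') (use Dt a f g in auto)
    also have "\<dots> = D f \<otimes> A \<oplus> D g \<otimes> B"
      unfolding A_def B_def using a f g by (simp add: finsum_addf finsum_rdistr)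
    finally show ?thesis .
  qed
  have b: "(f \<oplus> g) [^] Suc r = finsum R a {..Suc r}" unfolding a_def by (rule binomial[OF f g])
  have bA: "(f \<oplus> g) [^] Suc r = f [^] Suc r \<oplus> A"
    unfolding b A_def using a f g by (subst add.finprod_Suc) (auto simp: a_def)
  have bB: "(f \<oplus> g) [^] Suc r = B \<oplus> g [^] Suc r"
    unfolding b B_def using a f g by (subst add.finprod_Suc2) (auto simp: a_def)
  have "(f \<oplus> g) [^] Suc r \<otimes> D (f \<oplus> g) = (f \<oplus> g) [^] Suc r \<otimes> D f \<oplus> (f \<oplus> g) [^] Suc r \<otimes> D g"
    using f g by (simp add: derivation_add r_distr del: nat_pow_Suc)
  also have "(f \<oplus> g) [^] Suc r \<otimes> D f = f [^] Suc r \<otimes> D f \<oplus> D f \<otimes> A"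
    unfolding bA using f g cl by (simp add: l_distr m_comm[of A "D f"] del: nat_pow_Suc)
  also have "(f \<oplus> g) [^] Suc r \<otimes> D g = g [^] Suc r \<otimes> D g \<oplus> D g \<otimes> B"
    unfolding bB using f g cl by (simp add: l_distr m_comm[of B "D g"] a_comm[of "B \<otimes> D g"]
        a_comm[of "D g \<otimes> B"] del: nat_pow_Suc)
  finally have "(f \<oplus> g) [^] Suc r \<otimes> D (f \<oplus> g) =
      f [^] Suc r \<otimes> D f \<oplus> g [^] Suc r \<otimes> D g \<oplus> D u"
    unfolding Du using f g cl by (simp add: a_ac del: nat_pow_Suc)
  then show ?thesis using that cl(1) r by simp
qed

end

end

section \<open>Cartier maps and Frobenius powers\<close>

text \<open>These are the additive maps that are linear over the inverse of Frobenius, that is, the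
  \<open>R\<close>-linear maps from the Frobenius pushforward of \<open>R\<close> to
  \<open>R\<close>.\<close>

definition cartier_maps :: "('a, 'b) ring_scheme \<Rightarrow> nat \<Rightarrow> ('a \<Rightarrow> 'a) set"
  where "cartier_maps R p = {\<psi> \<in> carrier R \<rightarrow> carrier R. \<forall>x\<in>carrier R. \<forall>y\<in>carrier R.
    \<psi> (x \<oplus>\<^bsub>R\<^esub> y) = \<psi> x \<oplus>\<^bsub>R\<^esub> \<psi> y \<and> \<psi> (y [^]\<^bsub>R\<^esub> p \<otimes>\<^bsub>R\<^esub> x) = y \<otimes>\<^bsub>R\<^esub> \<psi> x}"

lemma (in ring) cartier_maps_zero:
  assumes "\<phi> \<in> cartier_maps R p" shows "\<phi> \<zero> = \<zero>"
proof -
  have "\<phi> (\<zero> \<oplus> \<zero>) = \<phi> \<zero> \<oplus> \<phi> \<zero>" "\<phi> \<zero> \<in> carrier R"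
    using assms zero_closed unfolding cartier_maps_def by blast+
  then show ?thesis by (metis add.r_cancel_one l_zero zero_closed)
qed

definition colon :: "('a, 'b) ring_scheme \<Rightarrow> 'a set \<Rightarrow> 'a \<Rightarrow> 'a set"
  where "colon R K y = {x \<in> carrier R. y \<otimes>\<^bsub>R\<^esub> x \<in> K}"

text \<open>Ideals that are contracted from the localization at \<open>M\<close>.\<close>

definition sat_ideal :: "('a, 'b) ring_scheme \<Rightarrow> 'a set \<Rightarrow> 'a set \<Rightarrow> bool"
  where "sat_ideal R M K \<longleftrightarrow> ideal K R \<and>
    (\<forall>s\<in>carrier R - M. \<forall>x\<in>carrier R. s \<otimes>\<^bsub>R\<^esub> x \<in> K \<longrightarrow> x \<in> K)"

text \<open>For an ideal \<open>J\<close>, this is another description of the Frobenius power \<open>J^[p^e]\<close>.\<close>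

primrec frob_pow :: "('a, 'b) ring_scheme \<Rightarrow> nat \<Rightarrow> nat \<Rightarrow> 'a set \<Rightarrow> 'a set"
  where "frob_pow R p 0 J = J"
  | "frob_pow R p (Suc e) J = {x \<in> carrier R. \<forall>\<psi>\<in>cartier_maps R p. \<psi> x \<in> frob_pow R p e J}"

text \<open>The contraction to \<open>R\<close> of the ideal \<open>(x)^[1/p^e]\<close> of the localization at \<open>M\<close>.\<close>

definition frob_root_at :: "('a, 'b) ring_scheme \<Rightarrow> 'a set \<Rightarrow> nat \<Rightarrow> nat \<Rightarrow> 'a \<Rightarrow> 'a set"
  where "frob_root_at R M p e x = \<Inter> {J. sat_ideal R M J \<and> x \<in> frob_pow R p e J}"

text \<open>What is retained of regularity and F-finiteness. \<open>cartier_reg\<close> follows from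
  an expansion of \<open>x\<close> in a basis over the \<open>p\<close>-th powers, with coordinates
  \<open>\<psi> x [^] p\<close>; it lets Cartier maps detect Frobenius powers.
  \<open>cartier_one\<close> is a splitting of Frobenius. Saturation with respect to
  \<open>M\<close> replaces passing to the localization.\<close>

locale frobenius_split = cring R for R (structure) +
  fixes p :: nat and M :: "'a set"
  assumes p_prime: "Factorial_Ring.prime p"
    and char: "add_pow R p \<one> = \<zero>"
    and M: "primeideal M R"
    and cartier_reg: "x \<in> carrier R \<Longrightarrow> x \<in> Idl ((\<lambda>\<psi>. \<psi> x [^] p) ` cartier_maps R p)"
    and cartier_one: "\<exists>\<psi>\<in>cartier_maps R p. \<psi> \<one> = \<one>"
begin

lemma p_pos: "0 < p" using p_prime prime_gt_0_nat by blast

lemma pow_p_pred: "y \<in> carrier R \<Longrightarrow> y [^] (p - 1) \<otimes> y = y [^] p"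
  using p_pos by (metis Suc_pred' nat_pow_Suc)

lemma M_subset: "M \<subseteq> carrier R"
proof -
  interpret M: primeideal M R by (rule M)
  show ?thesis using M.Icarr by blast
qed

lemma one_notin_M: "\<one> \<notin> M"
proof -
  interpret M: primeideal M R by (rule M)
  show ?thesis using M.I_notcarr M.one_imp_carrier by blast
qed

lemma notin_M_mult: "s \<in> carrier R - M \<Longrightarrow> t \<in> carrier R - M \<Longrightarrow> s \<otimes> t \<in> carrier R - M"
  using primeideal.I_prime[OF M] by blast

lemma cartier_closed: "\<psi> \<in> cartier_maps R p \<Longrightarrow> x \<in> carrier R \<Longrightarrow> \<psi> x \<in> carrier R"
  and cartier_add: "\<psi> \<in> cartier_maps R p \<Longrightarrow> x \<in> carrier R \<Longrightarrow> y \<in> carrier R \<Longrightarrow>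
    \<psi> (x \<oplus> y) = \<psi> x \<oplus> \<psi> y"
  and cartier_pow_mult: "\<psi> \<in> cartier_maps R p \<Longrightarrow> x \<in> carrier R \<Longrightarrow> y \<in> carrier R \<Longrightarrow>
    \<psi> (y [^] p \<otimes> x) = y \<otimes> \<psi> x"
  by (auto simp: cartier_maps_def)

lemma cartier_pow: "\<psi> \<in> cartier_maps R p \<Longrightarrow> y \<in> carrier R \<Longrightarrow> \<psi> (y [^] p) = y \<otimes> \<psi> \<one>"
  using cartier_pow_mult[of \<psi> \<one> y] by simp

lemma cartier_premult:
  assumes "\<psi> \<in> cartier_maps R p" and "a \<in> carrier R"
  shows "(\<lambda>x. \<psi> (a \<otimes> x)) \<in> cartier_maps R p"
  using assms unfolding cartier_maps_def
  by (auto simp: r_distr m_lcomm[of a])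

lemma colon_ideal:
  assumes K: "ideal K R" and y: "y \<in> carrier R"
  shows "ideal (colon R K y) R"
proof -
  interpret K: ideal K R by fact
  show ?thesis
  proof (rule ideal_intro)
    show "colon R K y \<subseteq> carrier R" by (auto simp: colon_def)
    show "\<zero> \<in> colon R K y" using y by (simp add: colon_def K.zero_closed)
  next
    fix x z assume "x \<in> colon R K y" "z \<in> colon R K y"
    then show "x \<oplus> z \<in> colon R K y" using y by (simp add: colon_def r_distr K.a_closed)
  next
    fix a x assume a: "a \<in> carrier R" and "x \<in> colon R K y"
    then have x: "x \<in> carrier R" "y \<otimes> x \<in> K" by (simp_all add: colon_def)
    have "y \<otimes> (a \<otimes> x) \<in> K"
      unfolding m_lcomm[OF y a x(1)] by (rule K.I_l_closed[OF x(2) a])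
    then show "a \<otimes> x \<in> colon R K y" using a x by (simp add: colon_def)
  qed
qed

lemma colon_sat_ideal:
  assumes K: "sat_ideal R M K" and y: "y \<in> carrier R"
  shows "sat_ideal R M (colon R K y)"
proof -
  have "x \<in> colon R K y" if s: "s \<in> carrier R - M" and x: "x \<in> carrier R"
    and sx: "s \<otimes> x \<in> colon R K y" for s x
  proof -
    have "s \<otimes> (y \<otimes> x) = y \<otimes> (s \<otimes> x)" using s x y by (intro m_lcomm) auto
    then have "s \<otimes> (y \<otimes> x) \<in> K" using sx by (simp add: colon_def)
    then show ?thesis using K s x y unfolding sat_ideal_def colon_def by blast
  qed
  then show ?thesis using assms colon_ideal[of K y] unfolding sat_ideal_def by blast
qed

text \<open>Multiples stay inside because a Cartier map preceded by a multiplication is again a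
  Cartier map.\<close>

lemma frob_pow_ideal:
  assumes J: "ideal J R"
  shows "ideal (frob_pow R p e J) R"
proof (induction e)
  case (Suc e)
  interpret K: ideal "frob_pow R p e J" R by fact
  show ?case
  proof (rule ideal_intro)
    fix a x assume a: "a \<in> carrier R" and x: "x \<in> frob_pow R p (Suc e) J"
    have "\<psi> (a \<otimes> x) \<in> frob_pow R p e J" if "\<psi> \<in> cartier_maps R p" for \<psi>
      using x bspec[OF _ cartier_premult[OF that a], of "\<lambda>\<psi>. \<psi> x \<in> frob_pow R p e J"] by simp
    then show "a \<otimes> x \<in> frob_pow R p (Suc e) J" using a x by simp
  next
    show "\<zero> \<in> frob_pow R p (Suc e) J" unfolding frob_pow.simps using cartier_maps_zero K.zero_closed by fastforce
  next
    fix x y assume "x \<in> frob_pow R p (Suc e) J" "y \<in> frob_pow R p (Suc e) J"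
    then show "x \<oplus> y \<in> frob_pow R p (Suc e) J"
      unfolding frob_pow.simps using cartier_add[of _ x y] K.a_closed by fastforce
  qed auto
qed (use J in simp)

text \<open>With \<open>s \<otimes> x\<close> the ideal contains \<open>s [^] p \<otimes> x\<close>,
  and a Cartier map releases \<open>s [^] p\<close> as the factor \<open>s\<close>, which saturation
  one level lower cancels.\<close>

lemma frob_pow_sat_ideal:
  assumes J: "sat_ideal R M J"
  shows "sat_ideal R M (frob_pow R p e J)"
proof (induction e)
  case (Suc e)
  have I: "ideal (frob_pow R p (Suc e) J) R"
    using J frob_pow_ideal unfolding sat_ideal_def by blast
  have "x \<in> frob_pow R p (Suc e) J" if s: "s \<in> carrier R - M" and x: "x \<in> carrier R"
    and sx: "s \<otimes> x \<in> frob_pow R p (Suc e) J" for s x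
  proof -
    have sc: "s \<in> carrier R" using s by blast
    have "s [^] (p - 1) \<otimes> (s \<otimes> x) \<in> frob_pow R p (Suc e) J"
      by (rule ideal.I_l_closed[OF I sx nat_pow_closed[OF sc]])
    also have "s [^] (p - 1) \<otimes> (s \<otimes> x) = s [^] p \<otimes> x"
      unfolding pow_p_pred[OF sc, symmetric] by (rule m_assoc[symmetric]) (use sc x in auto)
    finally have *: "s [^] p \<otimes> x \<in> frob_pow R p (Suc e) J" .
    have "\<psi> x \<in> frob_pow R p e J" if \<psi>: "\<psi> \<in> cartier_maps R p" for \<psi>
    proof -
      have "s \<otimes> \<psi> x \<in> frob_pow R p e J"
        using * \<psi> unfolding cartier_pow_mult[OF \<psi> x sc, symmetric] by simp
      then show ?thesis using Suc s cartier_closed[OF \<psi> x] unfolding sat_ideal_def by blast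
    qed
    then show ?thesis using x by simp
  qed
  then show ?case using I unfolding sat_ideal_def by blast
qed (use J in simp)

lemma frob_pow_mono: "J \<subseteq> K \<Longrightarrow> frob_pow R p e J \<subseteq> frob_pow R p e K"
proof (induction e)
  case (Suc e)
  then show ?case unfolding frob_pow.simps by blast
qed simp

text \<open>The recursion takes the \<open>p\<close>-th Frobenius power last; this form takes it
  first. Splitting off the leading digit of an exponent needs the latter.\<close>

lemma frob_pow_Suc_commute: "frob_pow R p (Suc e) J = frob_pow R p e (frob_pow R p (Suc 0) J)"
proof (induction e)
  case (Suc e)
  have "frob_pow R p (Suc (Suc e)) J =
      {x \<in> carrier R. \<forall>\<psi>\<in>cartier_maps R p. \<psi> x \<in> frob_pow R p (Suc e) J}" by simp
  also have "\<dots> = {x \<in> carrier R. \<forall>\<psi>\<in>cartier_maps R p.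
      \<psi> x \<in> frob_pow R p e (frob_pow R p (Suc 0) J)}"
    unfolding Suc ..
  also have "\<dots> = frob_pow R p (Suc e) (frob_pow R p (Suc 0) J)" by simp
  finally show ?case .
qed simp

text \<open>Membership is a universal statement over Cartier maps, and such statements commute with
  intersections. For ideals generated by powers this would be a consequence of flatness of
  Frobenius. The family is nonempty because an empty intersection would leave the carrier.\<close>

lemma frob_pow_Inter:
  assumes "\<J> \<noteq> {}"
  shows "x \<in> frob_pow R p e (\<Inter> \<J>) \<longleftrightarrow> (\<forall>J\<in>\<J>. x \<in> frob_pow R p e J)"
proof (induction e arbitrary: x)
  case (Suc e)
  then show ?case unfolding frob_pow.simps mem_Collect_eq using assms by blast
qed simp

lemma frob_pow_carrier: "frob_pow R p e (carrier R) = carrier R"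
proof (induction e)
  case (Suc e)
  then show ?case by (auto intro: cartier_closed)
qed simp

text \<open>This is \<open>(K^[q] : y^q) = (K : y)^[q]\<close>, usually derived from flatness. Each
  Cartier map applied takes one \<open>p\<close>-th root of the factor \<open>y [^] (p ^ e)\<close>,
  until only \<open>y\<close> is left.\<close>

lemma pow_mult_in_frob_pow_iff:
  assumes y: "y \<in> carrier R" and x: "x \<in> carrier R"
  shows "y [^] (p ^ e) \<otimes> x \<in> frob_pow R p e K \<longleftrightarrow> x \<in> frob_pow R p e (colon R K y)"
  using x
proof (induction e arbitrary: x)
  case 0
  then show ?case using y by (simp add: colon_def)
next
  case (Suc e)
  have "y [^] (p ^ Suc e) = (y [^] (p ^ e)) [^] p"
    using y by (simp add: nat_pow_pow mult.commute)
  then have eq: "\<psi> (y [^] (p ^ Suc e) \<otimes> x) = y [^] (p ^ e) \<otimes> \<psi> x" if "\<psi> \<in> cartier_maps R p" for \<psi>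
    using cartier_pow_mult[OF that Suc.prems, of "y [^] (p ^ e)"] y by simp
  have "(\<psi> (y [^] (p ^ Suc e) \<otimes> x) \<in> frob_pow R p e K) =
      (\<psi> x \<in> frob_pow R p e (colon R K y))" if "\<psi> \<in> cartier_maps R p" for \<psi>
    unfolding eq[OF that] by (rule Suc.IH[OF cartier_closed[OF that Suc.prems]])
  then show ?case using Suc.prems y by simp
qed

text \<open>A Cartier map that fixes the unit element sends \<open>x [^] p\<close> back to
  \<open>x\<close>; conversely every Cartier map sends \<open>x [^] p\<close> to a multiple of
  \<open>x\<close>.\<close>

lemma pow_in_frob_pow_iff:
  assumes K: "ideal K R" and x: "x \<in> carrier R"
  shows "x [^] p \<in> frob_pow R p (Suc 0) K \<longleftrightarrow> x \<in> K"
proof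
  assume "x [^] p \<in> frob_pow R p (Suc 0) K"
  then have *: "\<psi> (x [^] p) \<in> K" if "\<psi> \<in> cartier_maps R p" for \<psi>
    using that by simp
  obtain \<psi> where \<psi>: "\<psi> \<in> cartier_maps R p" "\<psi> \<one> = \<one>" using cartier_one by blast
  show "x \<in> K" using *[OF \<psi>(1)] cartier_pow[OF \<psi>(1) x] \<psi>(2) x by simp
next
  assume xK: "x \<in> K"
  have "\<psi> (x [^] p) \<in> K" if \<psi>: "\<psi> \<in> cartier_maps R p" for \<psi>
    unfolding cartier_pow[OF \<psi> x] by (rule ideal.I_r_closed[OF K xK cartier_closed[OF \<psi> one_closed]])
  then show "x [^] p \<in> frob_pow R p (Suc 0) K" using x by simp
qed

text \<open>Generators lie in \<open>frob_pow\<close> because \<open>(J : j)\<close> is the whole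
  ring for \<open>j\<close> in \<open>J\<close>. For the other inclusion the induction hypothesis
  puts each \<open>\<psi> x\<close> into the previous Frobenius power, so that
  \<open>\<psi> x [^] p\<close> lies in the next one, and \<open>cartier_reg\<close> assembles
  \<open>x\<close> from these elements.\<close>

lemma frob_power_eq_frob_pow:
  assumes J: "ideal J R"
  shows "frob_power R p e J = frob_pow R p e J"
proof
  interpret J: ideal J R by fact
  have "j [^] (p ^ e) \<in> frob_pow R p e J" if "j \<in> J" for j
  proof -
    have j: "j \<in> carrier R" using that J.Icarr by blast
    have "colon R J j = carrier R" using that j J.I_r_closed by (auto simp: colon_def)
    then show ?thesis
      using pow_mult_in_frob_pow_iff[OF j one_closed, of e J] j by (simp add: frob_pow_carrier)
  qed
  then show "frob_power R p e J \<subseteq> frob_pow R p e J"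
    unfolding frob_power_def by (intro genideal_minimal frob_pow_ideal[OF J]) auto
  show "frob_pow R p e J \<subseteq> frob_power R p e J"
  proof (induction e)
    case 0
    show ?case unfolding frob_power_def using J.Icarr genideal_self[of J] by (auto simp: subset_iff)
  next
    case (Suc e)
    have sub: "(\<lambda>a. a [^] (p ^ e)) ` J \<subseteq> carrier R" for e using J.Icarr by auto
    define I where "I = frob_power R p (Suc e) J"
    have I: "ideal I R" unfolding I_def frob_power_def by (rule genideal_ideal[OF sub])
    interpret I: ideal I R by fact
    \<comment> \<open>The preimage of \<open>I\<close> under Frobenius, an ideal because Frobenius
      is a ring endomorphism.\<close>
    define Q where "Q = {y \<in> carrier R. y [^] p \<in> I}"
    have "ideal Q R" unfolding Q_def
      using p_pos by (intro ideal_intro)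
        (auto simp: frobenius_add[OF p_prime char] nat_pow_distrib I.I_l_closed nat_pow_zero)
    moreover have "j [^] (p ^ e) \<in> Q" if "j \<in> J" for j
    proof -
      have "j \<in> carrier R" using that J.Icarr by blast
      moreover have "j [^] (p ^ Suc e) \<in> I"
        unfolding I_def frob_power_def using genideal_self[OF sub, of "Suc e"] that by blast
      ultimately show ?thesis by (simp add: Q_def nat_pow_pow mult.commute)
    qed
    ultimately have Q: "frob_power R p e J \<subseteq> Q"
      unfolding frob_power_def by (intro genideal_minimal) auto
    show ?case
    proof
      fix x assume x: "x \<in> frob_pow R p (Suc e) J"
      then have "\<psi> x [^] p \<in> I" if "\<psi> \<in> cartier_maps R p" for \<psi>
        using that Suc Q by (auto simp: Q_def)
      then have "Idl ((\<lambda>\<psi>. \<psi> x [^] p) ` cartier_maps R p) \<subseteq> I"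
        by (intro genideal_minimal I) auto
      then show "x \<in> frob_power R p (Suc e) J" using cartier_reg[of x] x by (auto simp: I_def)
    qed
  qed
qed

lemma sat_ideal_Inter:
  assumes "\<And>J. J \<in> \<J> \<Longrightarrow> sat_ideal R M J" and "\<J> \<noteq> {}"
  shows "sat_ideal R M (\<Inter> \<J>)"
proof -
  have "ideal (\<Inter> \<J>) R" using assms by (intro i_Intersect) (auto simp: sat_ideal_def)
  then show ?thesis using assms by (auto simp: sat_ideal_def)
qed

lemma carrier_sat_ideal: "sat_ideal R M (carrier R)"
  by (simp add: sat_ideal_def oneideal)

abbreviation root where "root \<equiv> frob_root_at R M p"

lemma
  assumes x: "x \<in> carrier R"
  shows root_sat_ideal: "sat_ideal R M (root e x)"
    and in_frob_pow_root: "x \<in> frob_pow R p e (root e x)"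
proof -
  have "carrier R \<in> {J. sat_ideal R M J \<and> x \<in> frob_pow R p e J}"
    by (simp add: carrier_sat_ideal frob_pow_carrier x)
  then have ne: "{J. sat_ideal R M J \<and> x \<in> frob_pow R p e J} \<noteq> {}" by blast
  show "sat_ideal R M (root e x)"
    unfolding frob_root_at_def by (rule sat_ideal_Inter[OF _ ne]) simp
  show "x \<in> frob_pow R p e (root e x)"
    unfolding frob_root_at_def frob_pow_Inter[OF ne] by simp
qed

text \<open>The adjunction between Frobenius roots and Frobenius powers, on which the later
  comparisons of roots rest.\<close>

lemma root_subset_iff:
  assumes x: "x \<in> carrier R" and J: "sat_ideal R M J"
  shows "root e x \<subseteq> J \<longleftrightarrow> x \<in> frob_pow R p e J"
  using in_frob_pow_root[OF x, of e] frob_pow_mono[of "root e x" J e] J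
  by (auto simp: frob_root_at_def)

lemma root_eqI:
  assumes "x \<in> carrier R" "y \<in> carrier R"
    and "\<And>J. sat_ideal R M J \<Longrightarrow> x \<in> frob_pow R p e J \<longleftrightarrow> y \<in> frob_pow R p e' J"
  shows "root e x = root e' y"
  using assms root_subset_iff root_sat_ideal in_frob_pow_root by (metis subset_antisym)

text \<open>Antitonicity holds since \<open>f [^] b\<close> is a multiple of \<open>f [^] a\<close>,
  and \<open>refine\<close> is the splitting of Frobenius. For \<open>self_similar\<close>,
  membership of \<open>f [^] (i * p ^ e + b)\<close> in a Frobenius power of \<open>J\<close> is, by
  the colon rule, a condition on the root of \<open>f [^] b\<close> alone.\<close>

lemma root_tower:
  assumes f: "f \<in> carrier R"
  shows "frobenius_tower p (\<lambda>e a. root e (f [^] a))"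
proof
  show "1 < p" using p_prime prime_gt_1_nat by blast
next
  fix a b e :: nat assume "a \<le> b"
  then have b: "f [^] b = f [^] (b - a) \<otimes> f [^] a" using f by (simp add: nat_pow_mult)
  interpret I: ideal "frob_pow R p e (root e (f [^] a))" R
    using frob_pow_ideal root_sat_ideal f unfolding sat_ideal_def by simp
  have "f [^] b \<in> frob_pow R p e (root e (f [^] a))"
    unfolding b using f by (intro I.I_l_closed in_frob_pow_root) auto
  then show "root e (f [^] b) \<subseteq> root e (f [^] a)"
    using root_subset_iff root_sat_ideal f by simp
next
  fix e a
  show "root (Suc e) (f [^] (p * a)) = root e (f [^] a)"
  proof (rule root_eqI)
    fix J assume J: "sat_ideal R M J"
    have I: "ideal (frob_pow R p e J) R" using J by (simp add: sat_ideal_def frob_pow_ideal)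
    have 1: "f [^] (p * a) = (f [^] a) [^] p" using nat_pow_pow[OF f, of a p] by (simp add: mult.commute)
    have 2: "frob_pow R p (Suc e) J = frob_pow R p (Suc 0) (frob_pow R p e J)" by simp
    show "f [^] (p * a) \<in> frob_pow R p (Suc e) J \<longleftrightarrow> f [^] a \<in> frob_pow R p e J"
      unfolding 1 2 by (rule pow_in_frob_pow_iff[OF I nat_pow_closed[OF f]])
  qed (use f in auto)
next
  fix e a i assume eq: "root e (f [^] a) = root e (f [^] Suc a)"
  have *: "f [^] (i * p ^ e + b) \<in> frob_pow R p (Suc e) J \<longleftrightarrow>
      root e (f [^] b) \<subseteq> colon R (frob_pow R p (Suc 0) J) (f [^] i)" if J: "sat_ideal R M J" for b J
  proof -
    have "f [^] (i * p ^ e + b) = (f [^] i) [^] (p ^ e) \<otimes> f [^] b"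
      using f by (simp add: nat_pow_mult nat_pow_pow)
    then show ?thesis
      unfolding frob_pow_Suc_commute[of e]
      using root_subset_iff[OF nat_pow_closed[OF f] colon_sat_ideal[OF frob_pow_sat_ideal[OF J]]] f
      by (simp add: pow_mult_in_frob_pow_iff del: frob_pow.simps)
  qed
  show "root (Suc e) (f [^] (i * p ^ e + a)) = root (Suc e) (f [^] Suc (i * p ^ e + a))"
  proof (rule root_eqI)
    fix J assume J: "sat_ideal R M J"
    show "f [^] (i * p ^ e + a) \<in> frob_pow R p (Suc e) J \<longleftrightarrow>
        f [^] Suc (i * p ^ e + a) \<in> frob_pow R p (Suc e) J"
      using *[OF J, of a] *[OF J, of "Suc a"] eq by (simp del: frob_pow.simps nat_pow_Suc)
  qed (use f in auto)
qed

section \<open>Perturbation\<close>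

text \<open>From \<open>f^(p^(e+1) - 1) = (f^(p-1))^(p^e) f^(p^e - 1)\<close> the colon rule shows
  that the hypothesis of level \<open>e\<close> holds for \<open>(K^[p] : f^(p-1))\<close>. By
  induction \<open>f^(p-1) g\<close> lies in \<open>K^[p]\<close>, and \<open>\<psi>\<close> brings
  \<open>g\<close> into \<open>K\<close>. At level 0 the ideal contains the unit element.\<close>

lemma jacobian_subset:
  assumes f: "f \<in> carrier R" and g: "g \<in> carrier R"
    and \<psi>: "\<psi> \<in> cartier_maps R p" "\<psi> (f [^] (p - 1) \<otimes> g) = g"
    and "ideal K R" and "f [^] (p ^ e - 1) \<in> frob_pow R p e K"
  shows "g \<in> K"
  using assms(5,6)
proof (induction e arbitrary: K)
  case 0
  then show ?case using ideal.one_imp_carrier[of K R] g by simp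
next
  case (Suc e)
  let ?K1 = "frob_pow R p (Suc 0) K"
  have K1: "ideal ?K1 R" using frob_pow_ideal Suc.prems by blast
  have "p ^ Suc e - 1 = (p - 1) * p ^ e + (p ^ e - 1)"
    using p_pos by (simp add: diff_mult_distrib)
  then have "f [^] (p ^ Suc e - 1) = (f [^] (p - 1)) [^] (p ^ e) \<otimes> f [^] (p ^ e - 1)"
    using f by (simp add: nat_pow_mult nat_pow_pow)
  then have "f [^] (p ^ e - 1) \<in> frob_pow R p e (colon R ?K1 (f [^] (p - 1)))"
    using Suc.prems f unfolding frob_pow_Suc_commute[of e]
    by (simp add: pow_mult_in_frob_pow_iff del: frob_pow.simps)
  then have "g \<in> colon R ?K1 (f [^] (p - 1))"
    by (intro Suc.IH colon_ideal K1) (use f in auto)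
  then have "f [^] (p - 1) \<otimes> g \<in> ?K1" by (simp add: colon_def del: frob_pow.simps)
  then have "\<psi> (f [^] (p - 1) \<otimes> g) \<in> K" using \<psi>(1) by simp
  then show ?case unfolding \<psi>(2) .
qed

text \<open>In the localization at \<open>M\<close>, this is the ideal \<open>A + P g\<close>.\<close>

lemma modulo_multiples:
  assumes A: "sat_ideal R M A" and P: "ideal P R" and g: "g \<in> carrier R"
  shows "sat_ideal R M {y \<in> carrier R. \<exists>s\<in>carrier R - M. \<exists>c\<in>P. s \<otimes> y \<ominus> c \<otimes> g \<in> A}"
    (is "sat_ideal R M ?B")
proof -
  interpret A: ideal A R using A by (simp add: sat_ideal_def)
  interpret P: ideal P R by fact
  have BI: "y \<in> ?B" if "y \<in> carrier R" "s \<in> carrier R" "s \<notin> M" "c \<in> P" "s \<otimes> y \<ominus> c \<otimes> g \<in> A" for y s c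
    using that by blast
  have BE: "\<exists>s c. y \<in> carrier R \<and> s \<in> carrier R \<and> s \<notin> M \<and> c \<in> P \<and> c \<in> carrier R \<and> s \<otimes> y \<ominus> c \<otimes> g \<in> A"
    if "y \<in> ?B" for y
    using that P.Icarr by blast
  have "ideal ?B R"
  proof (rule ideal_intro)
    have "\<one> \<otimes> \<zero> \<ominus> \<zero> \<otimes> g \<in> A" using g by (simp add: a_minus_def)
    then show "\<zero> \<in> ?B" by (intro BI[of _ \<one> \<zero>]) (auto simp: one_notin_M)
  next
    fix x y assume xB: "x \<in> ?B" and yB: "y \<in> ?B"
    obtain s c where x: "x \<in> carrier R" "s \<in> carrier R" "s \<notin> M" "c \<in> P" "c \<in> carrier R"
        "s \<otimes> x \<ominus> c \<otimes> g \<in> A"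
      using BE[OF xB] by (elim exE conjE)
    obtain t d where y: "y \<in> carrier R" "t \<in> carrier R" "t \<notin> M" "d \<in> P" "d \<in> carrier R"
        "t \<otimes> y \<ominus> d \<otimes> g \<in> A"
      using BE[OF yB] by (elim exE conjE)
    have "t \<otimes> (s \<otimes> x \<ominus> c \<otimes> g) \<oplus> s \<otimes> (t \<otimes> y \<ominus> d \<otimes> g) \<in> A"
      by (intro A.a_closed A.I_l_closed x y)
    also have "t \<otimes> (s \<otimes> x \<ominus> c \<otimes> g) \<oplus> s \<otimes> (t \<otimes> y \<ominus> d \<otimes> g) =
        (s \<otimes> t) \<otimes> (x \<oplus> y) \<ominus> (t \<otimes> c \<oplus> s \<otimes> d) \<otimes> g"
      using x(1,2,5) y(1,2,5) g by algebra
    finally have "(s \<otimes> t) \<otimes> (x \<oplus> y) \<ominus> (t \<otimes> c \<oplus> s \<otimes> d) \<otimes> g \<in> A" .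
    moreover have "t \<otimes> c \<oplus> s \<otimes> d \<in> P" by (intro P.a_closed P.I_l_closed x y)
    moreover have "s \<otimes> t \<in> carrier R" "s \<otimes> t \<notin> M" using notin_M_mult[of s t] x y by auto
    ultimately show "x \<oplus> y \<in> ?B" by (intro BI[of "x \<oplus> y" "s \<otimes> t"] a_closed x y)
  next
    fix a x assume a: "a \<in> carrier R" and xB: "x \<in> ?B"
    obtain s c where x: "x \<in> carrier R" "s \<in> carrier R" "s \<notin> M" "c \<in> P" "c \<in> carrier R"
        "s \<otimes> x \<ominus> c \<otimes> g \<in> A"
      using BE[OF xB] by (elim exE conjE)
    have "a \<otimes> (s \<otimes> x \<ominus> c \<otimes> g) \<in> A" by (intro A.I_l_closed x a)
    also have "a \<otimes> (s \<otimes> x \<ominus> c \<otimes> g) = s \<otimes> (a \<otimes> x) \<ominus> (a \<otimes> c) \<otimes> g"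
      using x(1,2,5) g a by algebra
    finally have "s \<otimes> (a \<otimes> x) \<ominus> (a \<otimes> c) \<otimes> g \<in> A" .
    moreover have "a \<otimes> c \<in> P" by (intro P.I_l_closed x a)
    ultimately show "a \<otimes> x \<in> ?B" by (intro BI[of "a \<otimes> x" s] m_closed x a)
  qed blast
  moreover have "x \<in> ?B" if t: "t \<in> carrier R - M" and x: "x \<in> carrier R" and tx: "t \<otimes> x \<in> ?B" for t x
  proof -
    obtain s c where *: "s \<in> carrier R" "s \<notin> M" "c \<in> P" "s \<otimes> (t \<otimes> x) \<ominus> c \<otimes> g \<in> A"
      using BE[OF tx] by (elim exE conjE)
    have "s \<otimes> (t \<otimes> x) = (s \<otimes> t) \<otimes> x" using * t x by (intro m_assoc[symmetric]) auto
    then have "(s \<otimes> t) \<otimes> x \<ominus> c \<otimes> g \<in> A" using *(4) by simp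
    moreover have "s \<otimes> t \<in> carrier R" "s \<otimes> t \<notin> M" using notin_M_mult[of s t] * t by auto
    ultimately show ?thesis using *(3) by (intro BI[of x "s \<otimes> t" c] x)
  qed
  ultimately show ?thesis unfolding sat_ideal_def by blast
qed

text \<open>Nakayama's lemma: the generators are removed one at a time.\<close>

lemma nakayama:
  assumes "finite G" and G: "G \<subseteq> carrier R" and T: "sat_ideal R M T"
    and B: "\<And>B. sat_ideal R M B \<Longrightarrow> T \<subseteq> B \<Longrightarrow> (\<And>x y. x \<in> M \<Longrightarrow> y \<in> Idl G \<Longrightarrow> x \<otimes> y \<in> B) \<Longrightarrow> G \<subseteq> B"
  shows "G \<subseteq> T"
proof -
  interpret M: primeideal M R by (rule M)
  interpret T: ideal T R using T by (simp add: sat_ideal_def)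
  \<comment> \<open>The induction shrinks a set \<open>H\<close> that, together with
    \<open>T\<close>, forces \<open>G\<close> into every saturated ideal. \<open>H = G\<close> is
    trivial and \<open>H = {}\<close> is the claim.\<close>
  have "G \<subseteq> T" if "finite H" "H \<subseteq> G" "\<And>B. sat_ideal R M B \<Longrightarrow> T \<subseteq> B \<Longrightarrow> H \<subseteq> B \<Longrightarrow> G \<subseteq> B" for H
    using that
  proof (induction H rule: finite_induct)
    case empty
    then show ?case using T by simp
  next
    case (insert g H)
    have g: "g \<in> carrier R" using insert G by auto
    show ?case
    proof (rule insert.IH)
      fix A assume A: "sat_ideal R M A" "T \<subseteq> A" "H \<subseteq> A"
      interpret A: ideal A R using A by (simp add: sat_ideal_def)
      \<comment> \<open>After localization \<open>B\<close> is \<open>A + R g\<close> and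
        \<open>C\<close> is \<open>A + M g\<close>. Since \<open>G\<close> lies in \<open>B\<close>,
        products of elements of \<open>M\<close> and of the ideal of \<open>G\<close> lie in
        \<open>C\<close>, and the hypothesis then puts \<open>g\<close> into
        \<open>C\<close>.\<close>
      define B where "B = {y \<in> carrier R. \<exists>s\<in>carrier R - M. \<exists>c\<in>carrier R. s \<otimes> y \<ominus> c \<otimes> g \<in> A}"
      define C where "C = {y \<in> carrier R. \<exists>s\<in>carrier R - M. \<exists>c\<in>M. s \<otimes> y \<ominus> c \<otimes> g \<in> A}"
      have B: "sat_ideal R M B" unfolding B_def by (rule modulo_multiples[OF A(1) oneideal g])
      have C: "sat_ideal R M C" unfolding C_def by (rule modulo_multiples[OF A(1) M.is_ideal g])
      have AC: "A \<subseteq> C"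
      proof
        fix y assume "y \<in> A"
        then have y: "y \<in> carrier R" "\<one> \<otimes> y \<ominus> \<zero> \<otimes> g \<in> A"
          using A.Icarr g by (auto simp: a_minus_def)
        then show "y \<in> C" unfolding C_def using one_notin_M M.zero_closed by blast
      qed
      have CB: "C \<subseteq> B" unfolding B_def C_def using M_subset by blast
      have "\<one> \<otimes> g \<ominus> \<one> \<otimes> g \<in> A" using g by (simp add: a_minus_def r_neg)
      then have "g \<in> B" unfolding B_def using g one_notin_M by blast
      then have "G \<subseteq> B" using insert.prems(2)[OF B] A AC CB by blast
      then have GB: "Idl G \<subseteq> B" using B genideal_minimal unfolding sat_ideal_def by blast
      have "x \<otimes> y \<in> C" if x: "x \<in> M" and "y \<in> Idl G" for x y
      proof -
        obtain s c where *: "y \<in> carrier R" "s \<in> carrier R - M" "c \<in> carrier R"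
          "s \<otimes> y \<ominus> c \<otimes> g \<in> A" using GB \<open>y \<in> Idl G\<close> unfolding B_def by blast
        have xc: "x \<in> carrier R" "s \<in> carrier R" using * x M_subset by auto
        have "x \<otimes> (s \<otimes> y \<ominus> c \<otimes> g) \<in> A" using * xc by (intro A.I_l_closed) auto
        also have "x \<otimes> (s \<otimes> y \<ominus> c \<otimes> g) = s \<otimes> (x \<otimes> y) \<ominus> (x \<otimes> c) \<otimes> g"
          using *(1,3) g xc by algebra
        finally have "s \<otimes> (x \<otimes> y) \<ominus> (x \<otimes> c) \<otimes> g \<in> A" .
        moreover have "x \<otimes> c \<in> M" using * x M.I_r_closed by blast
        ultimately show ?thesis unfolding C_def using * xc by blast
      qed
      then have "G \<subseteq> C" using assms(4)[OF C] A AC by blast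
      then obtain s c where *: "s \<in> carrier R - M" "c \<in> M" "s \<otimes> g \<ominus> c \<otimes> g \<in> A"
        using insert.prems(1) unfolding C_def by blast
      have c: "c \<in> carrier R" "s \<in> carrier R" using * M_subset by auto
      have "s \<otimes> g \<ominus> c \<otimes> g = (s \<ominus> c) \<otimes> g" using c g by algebra
      \<comment> \<open>This plays the role of the unit \<open>1 - c\<close> of a local ring:
        \<open>s\<close> is outside \<open>M\<close> and \<open>c\<close> inside, so saturation
        cancels the difference.\<close>
      moreover have "s \<ominus> c \<in> carrier R - M"
      proof -
        have "(s \<ominus> c) \<oplus> c = s" using c by algebra
        then have "s \<ominus> c \<notin> M" using M.a_closed[OF _ *(2), of "s \<ominus> c"] *(1) by (metis DiffD2)
        then show ?thesis using c by simp
      qed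
      ultimately have "(s \<ominus> c) \<otimes> g \<in> A" "s \<ominus> c \<in> carrier R - M" using *(3) by simp_all
      then have "g \<in> A" using A(1) g unfolding sat_ideal_def by blast
      then show "G \<subseteq> A" using insert.prems(2)[OF A(1,2)] A(3) by blast
    qed (use insert in auto)
  qed
  from this[OF assms(1) order_refl] show ?thesis by blast
qed

end

text \<open>Makes a bound on the length of chains into a bound on the number of values; the greatest
  member is removed repeatedly.\<close>

lemma strict_chain_of_card:
  assumes "finite \<A>" and "card \<A> = Suc k" and "\<And>A B. A \<in> \<A> \<Longrightarrow> B \<in> \<A> \<Longrightarrow> A \<subseteq> B \<or> B \<subseteq> A"
  obtains N :: "nat \<Rightarrow> 'a set" where "\<And>i. i \<le> k \<Longrightarrow> N i \<in> \<A>" "\<And>i. i < k \<Longrightarrow> N i \<subset> N (Suc i)"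
proof -
  have "\<exists>N. (\<forall>i\<le>k. N i \<in> \<A>) \<and> (\<forall>i<k. N i \<subset> N (Suc i))"
    using assms
  proof (induction k arbitrary: \<A>)
    case 0
    then obtain A where "A \<in> \<A>" by fastforce
    then show ?case by (intro exI[of _ "\<lambda>_. A"]) simp
  next
    case (Suc k)
    have ne: "\<A> \<noteq> {}" using Suc.prems(2) by auto
    obtain Z where Z: "Z \<in> \<A>" "\<And>A. A \<in> \<A> \<Longrightarrow> Z \<subseteq> A \<Longrightarrow> A = Z"
      using finite_has_maximal[OF Suc.prems(1) ne] by blast
    have top: "A \<subset> Z" if "A \<in> \<A> - {Z}" for A
      using Suc.prems(3)[OF Z(1), of A] Z that by auto
    have "\<exists>N. (\<forall>i\<le>k. N i \<in> \<A> - {Z}) \<and> (\<forall>i<k. N i \<subset> N (Suc i))"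
      by (rule Suc.IH) (use Suc.prems Z(1) in auto)
    then obtain N where N: "\<And>i. i \<le> k \<Longrightarrow> N i \<in> \<A> - {Z}" "\<And>i. i < k \<Longrightarrow> N i \<subset> N (Suc i)"
      by blast
    define N' where "N' = (\<lambda>i. if i = Suc k then Z else N i)"
    have "N' i \<in> \<A>" if "i \<le> Suc k" for i
      using N(1)[of i] Z(1) that by (auto simp: N'_def)
    moreover have "N' i \<subset> N' (Suc i)" if i: "i < Suc k" for i
    proof (cases "i = k")
      case True
      then show ?thesis using top[OF N(1)[of k]] by (simp add: N'_def)
    next
      case False
      then show ?thesis using i N(2)[of i] by (simp add: N'_def)
    qed
    ultimately show ?case by blast
  qed
  then show ?thesis using that by blast
qed

context frobenius_split
begin

lemma pow_perturb:
  assumes f: "f \<in> carrier R" and h: "h \<in> carrier R"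
  shows "\<exists>z\<in>carrier R. (f \<oplus> h) [^] (a::nat) = f [^] a \<oplus> z \<otimes> h"
proof (induction a)
  case 0
  show ?case using h by (intro bexI[of _ \<zero>]) auto
next
  case (Suc a)
  then obtain z where z: "z \<in> carrier R" "(f \<oplus> h) [^] a = f [^] a \<oplus> z \<otimes> h" by blast
  define F where "F = f [^] a"
  have F: "F \<in> carrier R" using f by (simp add: F_def)
  have "(F \<oplus> z \<otimes> h) \<otimes> (f \<oplus> h) = F \<otimes> f \<oplus> (F \<oplus> z \<otimes> (f \<oplus> h)) \<otimes> h"
    using f h z(1) F by algebra
  then have "(f \<oplus> h) [^] Suc a = f [^] Suc a \<oplus> (F \<oplus> z \<otimes> (f \<oplus> h)) \<otimes> h"
    by (simp add: z(2) F_def)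
  then show ?case using f h z(1) F by (intro bexI[of _ "F \<oplus> z \<otimes> (f \<oplus> h)"]) auto
qed

context
  fixes f :: 'a and G :: "'a set"
  assumes f: "f \<in> carrier R" and G: "finite G" "G \<subseteq> carrier R"
    and jac: "\<And>g. g \<in> G \<Longrightarrow> \<exists>\<psi>\<in>cartier_maps R p. \<psi> (f [^] (p - 1) \<otimes> g) = g"
begin

lemma MG_ideal: "ideal (Idl {x \<otimes> y | x y. x \<in> M \<and> y \<in> Idl G}) R"
  using M_subset ideal.Icarr[OF genideal_ideal[OF G(2)]] by (intro genideal_ideal) auto

text \<open>As \<open>a\<close> is at most \<open>p ^ e - 1\<close>, the power
  \<open>f [^] (p ^ e - 1)\<close> is a multiple of \<open>f [^] a\<close> and lies in the Frobenius
  power of its root, so \<open>jacobian_subset\<close> applies.\<close>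

lemma jacobian_subset_root:
  assumes "a < p ^ e"
  shows "G \<subseteq> root e (f [^] a)"
proof
  fix g assume g: "g \<in> G"
  then obtain \<psi> where \<psi>: "\<psi> \<in> cartier_maps R p" "\<psi> (f [^] (p - 1) \<otimes> g) = g" using jac by blast
  have gc: "g \<in> carrier R" using g G by blast
  have I: "ideal (root e (f [^] a)) R" using root_sat_ideal f by (simp add: sat_ideal_def)
  interpret F: ideal "frob_pow R p e (root e (f [^] a))" R by (rule frob_pow_ideal[OF I])
  have "f [^] (p ^ e - 1) = f [^] (p ^ e - 1 - a) \<otimes> f [^] a"
    using assms f by (simp add: nat_pow_mult)
  also have "\<dots> \<in> frob_pow R p e (root e (f [^] a))"
    by (rule F.I_l_closed[OF in_frob_pow_root]) (use f in auto)
  finally show "g \<in> root e (f [^] a)" by (rule jacobian_subset[OF f gc \<psi> I])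
qed

text \<open>The \<open>a\<close>-th powers of \<open>f\<close> and \<open>f \<oplus> h\<close>
  differ by a multiple of \<open>h\<close>, so the roots \<open>T\<close> and \<open>T'\<close>
  agree modulo \<open>K\<close>, the product of \<open>M\<close> and the ideal of \<open>G\<close>.
  Since \<open>K\<close> lies in \<open>T\<close>, so does \<open>T'\<close>. Conversely
  \<open>G\<close> lies in \<open>T\<close>, hence in every saturated ideal above \<open>T'\<close>
  and \<open>K\<close>; Nakayama's lemma puts \<open>G\<close>, and then \<open>T\<close>, into
  \<open>T'\<close>.\<close>

lemma root_perturb_base:
  assumes h: "h \<in> frob_pow R p e (Idl {x \<otimes> y | x y. x \<in> M \<and> y \<in> Idl G})" and a: "a < p ^ e"
  shows "root e (f [^] a) = root e ((f \<oplus> h) [^] a)"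
proof -
  define K where "K = Idl {x \<otimes> y | x y. x \<in> M \<and> y \<in> Idl G}"
  have IG: "ideal (Idl G) R" by (rule genideal_ideal[OF G(2)])
  have K: "ideal K R" unfolding K_def by (rule MG_ideal)
  have KG: "K \<subseteq> Idl G" unfolding K_def
    using M_subset ideal.I_l_closed[OF IG] by (intro genideal_minimal IG) auto
  have hK: "h \<in> frob_pow R p e K" using h by (simp add: K_def)
  have hc: "h \<in> carrier R" using hK frob_pow_ideal[OF K] ideal.Icarr by metis
  define T T' where "T = root e (f [^] a)" and "T' = root e ((f \<oplus> h) [^] a)"
  have T: "sat_ideal R M T" "f [^] a \<in> frob_pow R p e T"
    unfolding T_def using root_sat_ideal in_frob_pow_root f by simp_all
  have T': "sat_ideal R M T'" "(f \<oplus> h) [^] a \<in> frob_pow R p e T'"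
    unfolding T'_def using root_sat_ideal in_frob_pow_root f hc by simp_all
  obtain z where z: "z \<in> carrier R" "(f \<oplus> h) [^] a = f [^] a \<oplus> z \<otimes> h"
    using pow_perturb[OF f hc] by blast
  have GT: "G \<subseteq> T" unfolding T_def by (rule jacobian_subset_root[OF a])
  \<comment> \<open>Sums of saturated ideals need not be saturated, so the inclusion of
    \<open>T'\<close> in \<open>T + K\<close> is expressed through all saturated ideals above both
    summands. The same holds for \<open>2\<close>.\<close>
  have 1: "T' \<subseteq> B" if B: "sat_ideal R M B" "K \<subseteq> B" "T \<subseteq> B" for B
  proof -
    interpret F: ideal "frob_pow R p e B" R
      using B(1) frob_pow_ideal by (simp add: sat_ideal_def)
    have "h \<in> frob_pow R p e B" "f [^] a \<in> frob_pow R p e B"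
      using hK T(2) frob_pow_mono B by blast+
    then have "(f \<oplus> h) [^] a \<in> frob_pow R p e B"
      unfolding z(2) by (intro F.a_closed F.I_l_closed z(1))
    then show ?thesis
      unfolding T'_def using root_subset_iff[OF _ B(1)] f hc by simp
  qed
  have 2: "T \<subseteq> B" if B: "sat_ideal R M B" "K \<subseteq> B" "T' \<subseteq> B" for B
  proof -
    interpret F: ideal "frob_pow R p e B" R
      using B(1) frob_pow_ideal by (simp add: sat_ideal_def)
    have "h \<in> frob_pow R p e B" "(f \<oplus> h) [^] a \<in> frob_pow R p e B"
      using hK T'(2) frob_pow_mono B by blast+
    then have "(f \<oplus> h) [^] a \<oplus> (\<ominus> z) \<otimes> h \<in> frob_pow R p e B"
      using z(1) by (intro F.a_closed F.I_l_closed) auto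
    also have "(f \<oplus> h) [^] a \<oplus> (\<ominus> z) \<otimes> h = f [^] a"
    proof -
      have "f [^] a \<in> carrier R" using f by simp
      then show ?thesis unfolding z(2) using z(1) hc by algebra
    qed
    finally show ?thesis
      unfolding T_def using root_subset_iff[OF _ B(1)] f by simp
  qed
  have "Idl G \<subseteq> T" using GT T(1) genideal_minimal unfolding sat_ideal_def by blast
  then have TT: "T' \<subseteq> T" using 1[OF T(1)] KG by blast
  have "G \<subseteq> T'"
  proof (rule nakayama[OF G T'(1)])
    fix B assume B: "sat_ideal R M B" "T' \<subseteq> B"
      and xy: "\<And>x y. x \<in> M \<Longrightarrow> y \<in> Idl G \<Longrightarrow> x \<otimes> y \<in> B"
    have "ideal B R" using B(1) by (simp add: sat_ideal_def)
    then have "K \<subseteq> B" unfolding K_def by (intro genideal_minimal) (use xy in auto)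
    then show "G \<subseteq> B" using 2[OF B(1) _ B(2)] GT by blast
  qed
  then have "Idl G \<subseteq> T'" using T'(1) genideal_minimal unfolding sat_ideal_def by blast
  then have "T \<subseteq> T'" using 2[OF T'(1)] KG by blast
  then show ?thesis using TT unfolding T_def T'_def by blast
qed

text \<open>The roots for exponents below \<open>p ^ e\<close> form a chain of ideals above
  \<open>G\<close>, so \<open>bound\<close> limits them to \<open>Suc l\<close> values. Nothing
  comparable is at hand for \<open>f \<oplus> h\<close>, and \<open>frobenius_tower_eqI\<close> asks
  for it only on one side.\<close>

theorem root_perturb:
  assumes bound: "\<And>N k. (\<And>i. i \<le> k \<Longrightarrow> ideal (N i) R \<and> G \<subseteq> N i) \<Longrightarrow>
      (\<And>i. i < k \<Longrightarrow> N i \<subset> N (Suc i)) \<Longrightarrow> k \<le> l"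
    and h: "h \<in> frob_pow R p (Suc l) (Idl {x \<otimes> y | x y. x \<in> M \<and> y \<in> Idl G})"
    and e: "Suc l \<le> e" and a: "a < p ^ e"
  shows "root e (f [^] a) = root e ((f \<oplus> h) [^] a)"
proof -
  have hc: "h \<in> carrier R" by (rule ideal.Icarr[OF frob_pow_ideal[OF MG_ideal] h])
  show ?thesis
  proof (rule frobenius_tower_eqI[OF root_tower[OF f] root_tower[of "f \<oplus> h"] _ _ e a])
    fix e
    interpret tower: frobenius_tower p "\<lambda>e a. root e (f [^] a)" by (rule root_tower[OF f])
    let ?A = "(\<lambda>a. root e (f [^] a)) ` {..<p ^ e}"
    show "card ?A \<le> Suc l"
    proof (rule ccontr)
      assume "\<not> card ?A \<le> Suc l"
      then obtain k where k: "card ?A = Suc k" "l < k" by (cases "card ?A") auto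
      have "A \<subseteq> B \<or> B \<subseteq> A" if A: "A \<in> ?A" and B: "B \<in> ?A" for A B
      proof -
        obtain a b :: nat where ab: "A = root e (f [^] a)" "B = root e (f [^] b)" using A B by blast
        show ?thesis
          unfolding ab using tower.antimono[of a b e] tower.antimono[of b a e] nat_le_linear[of a b] by blast
      qed
      from strict_chain_of_card[OF _ k(1) this]
      obtain N where N: "\<And>i. i \<le> k \<Longrightarrow> N i \<in> ?A" "\<And>i. i < k \<Longrightarrow> N i \<subset> N (Suc i)"
        by auto
      have "k \<le> l"
      proof (rule bound)
        fix i assume "i \<le> k"
        then obtain a where a: "a < p ^ e" "N i = root e (f [^] a)" using N(1) by fastforce
        show "ideal (N i) R \<and> G \<subseteq> N i"
          unfolding a(2) using jacobian_subset_root[OF a(1)] root_sat_ideal f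
          by (simp add: sat_ideal_def)
      qed (rule N(2))
      then show False using k(2) by simp
    qed
  next
    fix a assume "a < p ^ Suc l"
    then show "root (Suc l) (f [^] a) = root (Suc l) ((f \<oplus> h) [^] a)"
      by (rule root_perturb_base[OF h])
  qed (use f hc in simp)
qed

end

end

section \<open>Polynomial rings\<close>

lemma finite_subset_mset: "finite {a. a \<subseteq># (m :: 'c multiset)}"
proof (induction m)
  case (add x m)
  have "{a. a \<subseteq># add_mset x m} \<subseteq> {a. a \<subseteq># m} \<union> add_mset x ` {a. a \<subseteq># m}"
  proof
    fix a assume a: "a \<in> {a. a \<subseteq># add_mset x m}"
    show "a \<in> {a. a \<subseteq># m} \<union> add_mset x ` {a. a \<subseteq># m}"
    proof (cases "x \<in># a")
      case True
      then obtain b where "a = add_mset x b" by (blast dest: multi_member_split)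
      then show ?thesis using a by auto
    next
      case False
      then have "a \<subseteq># m" using a by (simp add: subset_mset.diff_add
        mset_subset_eq_insertD subseteq_mset_def not_in_iff split: if_splits) (metis Suc_leD count_add_mset le_zero_eq not_less_eq_eq nat_le_linear)
      then show ?thesis by blast
    qed
  qed
  then show ?case using add.IH finite_subset by blast
qed simp

lemma decomp_eq_image: "{(a, b). a + b = (m :: 'c multiset)} = (\<lambda>a. (a, m - a)) ` {a. a \<subseteq># m}"
  by (auto simp: image_iff)

lemma finite_decomp: "finite {(a, b). a + b = (m :: 'c multiset)}"
  unfolding decomp_eq_image by (intro finite_imageI finite_subset_mset)

text \<open>Covers both families in use: \<open>W\<close> given by a lower bound on the degree
  yields powers of the maximal ideal of the origin, and \<open>W\<close> given by divisibility by
  some variable of \<open>B\<close> yields the prime ideal of these variables.\<close>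

definition mono_ideal :: "('a, 'b) ring_scheme \<Rightarrow> 'c set \<Rightarrow> 'c multiset set \<Rightarrow> ('c multiset \<Rightarrow> 'a) set"
  where "mono_ideal L I W = {P \<in> carrier (mpoly_ring L I). \<forall>m. P m \<noteq> \<zero>\<^bsub>L\<^esub> \<longrightarrow> m \<in> W}"

definition mon :: "('a, 'b) ring_scheme \<Rightarrow> 'a \<Rightarrow> 'c multiset \<Rightarrow> 'c multiset \<Rightarrow> 'a"
  where "mon L c m = (\<lambda>k. if k = m then c else \<zero>\<^bsub>L\<^esub>)"

locale mpoly = L: field L for L :: "('a, 'b) ring_scheme" (structure) +
  fixes I :: "'c set"
begin

abbreviation R where "R \<equiv> mpoly_ring L I"

lemma R_simps:
  "P \<otimes>\<^bsub>R\<^esub> Q = mpoly_mult L P Q" "P \<oplus>\<^bsub>R\<^esub> Q = (\<lambda>m. P m \<oplus> Q m)"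
  "\<zero>\<^bsub>R\<^esub> = (\<lambda>m. \<zero>)" "\<one>\<^bsub>R\<^esub> = mon L \<one> {#}"
  unfolding mpoly_ring_def mon_def
  by (simp_all add: L.indexed_padd_def[abs_def] L.indexed_zero_def L.indexed_const_def)

lemma mon_zero: "mon L \<zero> m = \<zero>\<^bsub>R\<^esub>"
  by (simp add: mon_def R_simps)

lemma mon_add: "mon L c m \<oplus>\<^bsub>R\<^esub> mon L d m = mon L (c \<oplus> d) m"
  by (auto simp: mon_def R_simps)

lemma mon_in_carrier:
  assumes "c \<in> carrier L" "set_mset m \<subseteq> I"
  shows "mon L c m \<in> carrier R"
  using assms(2)
proof (induction m)
  case empty
  have "mon L c ({#} :: 'c multiset) = L.indexed_const c" by (auto simp: mon_def L.indexed_const_def)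
  then show ?case using L.indexed_pset.indexed_const[OF assms(1), of I]
    by (simp add: mpoly_ring_def)
next
  case (add i m)
  have "mon L c (add_mset i m) = L.indexed_pmult (mon L c m) i"
  proof
    fix k
    show "mon L c (add_mset i m) k = L.indexed_pmult (mon L c m) i k"
      by (cases "i \<in># k") (auto simp: mon_def L.indexed_pmult_def dest: multi_member_split)
  qed
  then show ?case using add L.indexed_pset.indexed_pmult[of "mon L c m" I "carrier L" i]
    by (simp add: mpoly_ring_def)
qed

lemma pset_finsupp:
  assumes "P \<in> carrier R"
  shows "P m \<in> carrier L" "finite {m. P m \<noteq> \<zero>}" "P m \<noteq> \<zero> \<Longrightarrow> set_mset m \<subseteq> I"
proof -
  have "(\<forall>m. P m \<in> carrier L) \<and> finite {m. P m \<noteq> \<zero>} \<and> (\<forall>m. P m \<noteq> \<zero> \<longrightarrow> set_mset m \<subseteq> I)"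
    using assms unfolding mpoly_ring_def partial_object.simps
  proof (induction rule: L.indexed_pset.induct)
    case (indexed_const k)
    have "{m. L.indexed_const k m \<noteq> \<zero>} \<subseteq> {{#}}" by (auto simp: L.indexed_const_def)
    then show ?case using indexed_const finite_subset by (auto simp: L.indexed_const_def)
  next
    case (indexed_padd P Q)
    have "{m. L.indexed_padd P Q m \<noteq> \<zero>} \<subseteq> {m. P m \<noteq> \<zero>} \<union> {m. Q m \<noteq> \<zero>}"
      by (auto simp: L.indexed_padd_def)
    then have "finite {m. L.indexed_padd P Q m \<noteq> \<zero>}"
      using indexed_padd by (meson finite_UnI finite_subset)
    moreover have "P m \<noteq> \<zero> \<or> Q m \<noteq> \<zero>" if "L.indexed_padd P Q m \<noteq> \<zero>" for m
      using that by (auto simp: L.indexed_padd_def)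
    ultimately show ?case using indexed_padd by (metis L.a_closed L.indexed_padd_def)
  next
    case (indexed_pmult P i)
    have "{m. L.indexed_pmult P i m \<noteq> \<zero>} \<subseteq> add_mset i ` {m. P m \<noteq> \<zero>}"
      by (auto simp: L.indexed_pmult_def image_iff split: if_splits) (metis insert_DiffM)
    moreover have "set_mset m \<subseteq> I" if "L.indexed_pmult P i m \<noteq> \<zero>" for m
    proof -
      have "i \<in># m" "P (m - {#i#}) \<noteq> \<zero>" using that by (auto simp: L.indexed_pmult_def split: if_splits)
      then have "set_mset (m - {#i#}) \<subseteq> I" using indexed_pmult by blast
      then have "set_mset (add_mset i (m - {#i#})) \<subseteq> I" using indexed_pmult by simp
      then show ?thesis using \<open>i \<in># m\<close> by simp
    qed
    ultimately show ?case
      using indexed_pmult finite_subset[OF _ finite_imageI, of "{m. L.indexed_pmult P i m \<noteq> \<zero>}" "add_mset i" "{m. P m \<noteq> \<zero>}"]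
      by (simp add: L.indexed_pmult_def[of P i])
  qed
  then show "P m \<in> carrier L" "finite {m. P m \<noteq> \<zero>}" "P m \<noteq> \<zero> \<Longrightarrow> set_mset m \<subseteq> I" by auto
qed

lemma padd_in_carrier: "P \<in> carrier R \<Longrightarrow> Q \<in> carrier R \<Longrightarrow> P \<oplus>\<^bsub>R\<^esub> Q \<in> carrier R"
  using L.indexed_pset.indexed_padd[of P I "carrier L" Q] by (simp add: mpoly_ring_def)

lemma zero_in_carrier: "\<zero>\<^bsub>R\<^esub> \<in> carrier R"
  using mon_in_carrier[of \<zero> "{#}"] by (simp add: mon_zero)

text \<open>Together with \<open>pset_finsupp\<close> this replaces the inductive generation of
  polynomials by finite support, so that operations can be defined on coefficients.\<close>

lemma carrierI:
  assumes "\<And>m. P m \<in> carrier L" "finite {m. P m \<noteq> \<zero>}" "\<And>m. P m \<noteq> \<zero> \<Longrightarrow> set_mset m \<subseteq> I"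
  shows "P \<in> carrier R"
  using assms
proof (induction "card {m. P m \<noteq> \<zero>}" arbitrary: P)
  case 0
  then have "P = \<zero>\<^bsub>R\<^esub>" by (auto simp: R_simps)
  then show ?case by (simp add: zero_in_carrier)
next
  case (Suc n)
  then obtain m where m: "P m \<noteq> \<zero>" by fastforce
  define Q where "Q = P(m := \<zero>)"
  have s: "{m. P m \<noteq> \<zero>} = insert m {m. Q m \<noteq> \<zero>}" "m \<notin> {m. Q m \<noteq> \<zero>}" using m by (auto simp: Q_def)
  then have fin: "finite {m. Q m \<noteq> \<zero>}" using Suc.prems(2) by simp
  then have "n = card {m. Q m \<noteq> \<zero>}" using Suc.hyps(2) s by simp
  then have "Q \<in> carrier R"
    by (rule Suc.hyps(1)) (use Suc.prems fin in \<open>auto simp: Q_def split: if_splits\<close>)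
  moreover have "P = mon L (P m) m \<oplus>\<^bsub>R\<^esub> Q"
    using Suc.prems(1) by (auto simp: R_simps mon_def Q_def)
  ultimately show ?case using padd_in_carrier[of "mon L (P m) m" Q] mon_in_carrier[of "P m" m] m Suc.prems
    by simp
qed

text \<open>The monomial case is demanded only for terms that occur in \<open>P\<close>. This lets
  hypotheses on the support of \<open>P\<close> reach that case.\<close>

lemma mpoly_induct [consumes 1, case_names zero mon add]:
  assumes "P \<in> carrier R" and "Q \<zero>\<^bsub>R\<^esub>"
    and "\<And>m. P m \<noteq> \<zero> \<Longrightarrow> P m \<in> carrier L \<Longrightarrow> set_mset m \<subseteq> I \<Longrightarrow> Q (mon L (P m) m)"
    and "\<And>A B. A \<in> carrier R \<Longrightarrow> B \<in> carrier R \<Longrightarrow> Q A \<Longrightarrow> Q B \<Longrightarrow> Q (A \<oplus>\<^bsub>R\<^esub> B)"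
  shows "Q P"
  using assms(1,3)
proof (induction "card {m. P m \<noteq> \<zero>}" arbitrary: P)
  case 0
  then have "P = \<zero>\<^bsub>R\<^esub>" using pset_finsupp(2)[of P] by (auto simp: R_simps)
  then show ?case using assms(2) by simp
next
  case (Suc n)
  note P = pset_finsupp[OF Suc.prems(1)]
  obtain m where m: "P m \<noteq> \<zero>" using Suc.hyps(2) by fastforce
  define B where "B = P(m := \<zero>)"
  have s: "{m. P m \<noteq> \<zero>} = insert m {m. B m \<noteq> \<zero>}" "m \<notin> {m. B m \<noteq> \<zero>}" using m by (auto simp: B_def)
  then have fin: "finite {m. B m \<noteq> \<zero>}" using P(2) by simp
  have n: "n = card {m. B m \<noteq> \<zero>}" using Suc.hyps(2) s fin by simp
  have BR: "B \<in> carrier R"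
    by (rule carrierI) (use P fin in \<open>auto simp: B_def split: if_splits\<close>)
  have "Q B"
  proof (rule Suc.hyps(1)[OF n BR])
    fix k assume "B k \<noteq> \<zero>"
    then show "Q (mon L (B k) k)"
      using Suc.prems(2)[of k] P(1)[of k] P(3)[of k] by (auto simp: B_def split: if_splits)
  qed
  moreover have "P = mon L (P m) m \<oplus>\<^bsub>R\<^esub> B"
    using P(1) by (auto simp: R_simps mon_def B_def)
  moreover have "Q (mon L (P m) m)" using Suc.prems(2)[OF m] P by (auto simp: m)
  ultimately show ?case using assms(4)[of "mon L (P m) m" B] BR mon_in_carrier[OF P(1), of m m] P(3)[OF m]
    by simp
qed

lemma mult_add_left:
  assumes "P \<in> carrier R" "Q \<in> carrier R" "T \<in> carrier R"
  shows "(P \<oplus>\<^bsub>R\<^esub> Q) \<otimes>\<^bsub>R\<^esub> T = P \<otimes>\<^bsub>R\<^esub> T \<oplus>\<^bsub>R\<^esub> Q \<otimes>\<^bsub>R\<^esub> T"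
proof
  fix m
  note c = pset_finsupp(1)[OF assms(1)] pset_finsupp(1)[OF assms(2)] pset_finsupp(1)[OF assms(3)]
  show "((P \<oplus>\<^bsub>R\<^esub> Q) \<otimes>\<^bsub>R\<^esub> T) m = (P \<otimes>\<^bsub>R\<^esub> T \<oplus>\<^bsub>R\<^esub> Q \<otimes>\<^bsub>R\<^esub> T) m"
    unfolding R_simps mpoly_mult_def
    by (subst L.finsum_addf[symmetric]) (auto simp: c L.l_distr intro!: L.finsum_cong')
qed

lemma mult_comm:
  assumes P: "P \<in> carrier R" and Q: "Q \<in> carrier R"
  shows "P \<otimes>\<^bsub>R\<^esub> Q = Q \<otimes>\<^bsub>R\<^esub> P"
proof
  fix m :: "'c multiset"
  note c = pset_finsupp(1)[OF P] pset_finsupp(1)[OF Q]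
  define D where "D = {(a, b). a + b = m}"
  have swap: "D = prod.swap ` D" unfolding D_def by (auto simp: image_iff add.commute)
  have "(P \<otimes>\<^bsub>R\<^esub> Q) m = (\<Oplus>ab\<in>prod.swap ` D. P (fst ab) \<otimes> Q (snd ab))"
    unfolding R_simps mpoly_mult_def D_def[symmetric] using swap by simp
  also have "\<dots> = (\<Oplus>ab\<in>D. P (snd ab) \<otimes> Q (fst ab))"
    by (subst L.add.finprod_reindex) (use c in auto)
  also have "\<dots> = (Q \<otimes>\<^bsub>R\<^esub> P) m"
    unfolding R_simps mpoly_mult_def D_def[symmetric]
    by (rule L.add.finprod_cong'[OF refl]) (use c in \<open>auto simp: L.m_comm\<close>)
  finally show "(P \<otimes>\<^bsub>R\<^esub> Q) m = (Q \<otimes>\<^bsub>R\<^esub> P) m" .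
qed

lemma mult_add_right:
  assumes "P \<in> carrier R" "Q \<in> carrier R" "T \<in> carrier R"
  shows "T \<otimes>\<^bsub>R\<^esub> (P \<oplus>\<^bsub>R\<^esub> Q) = T \<otimes>\<^bsub>R\<^esub> P \<oplus>\<^bsub>R\<^esub> T \<otimes>\<^bsub>R\<^esub> Q"
  using mult_add_left[OF assms] assms mult_comm[of T] padd_in_carrier by simp

lemma mult_zero:
  assumes "P \<in> carrier R"
  shows "P \<otimes>\<^bsub>R\<^esub> \<zero>\<^bsub>R\<^esub> = \<zero>\<^bsub>R\<^esub>" "\<zero>\<^bsub>R\<^esub> \<otimes>\<^bsub>R\<^esub> P = \<zero>\<^bsub>R\<^esub>"
  using pset_finsupp(1)[OF assms] unfolding R_simps mpoly_mult_def by auto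

lemma mon_mult_coeff:
  assumes "c \<in> carrier L" "P \<in> carrier R"
  shows "(mon L c k \<otimes>\<^bsub>R\<^esub> P) m = (if k \<subseteq># m then c \<otimes> P (m - k) else \<zero>)"
proof (cases "k \<subseteq># m")
  case True
  note P = pset_finsupp(1)[OF assms(2)]
  have "(mon L c k \<otimes>\<^bsub>R\<^esub> P) m = (\<Oplus>ab\<in>{(a, b). a + b = m}. mon L c k (fst ab) \<otimes> P (snd ab))"
    by (simp add: R_simps mpoly_mult_def)
  also have "\<dots> = (\<Oplus>ab\<in>{(a, b). a + b = m}. if (k, m - k) = ab then c \<otimes> P (m - k) else \<zero>)"
  proof (rule L.add.finprod_cong'[OF refl])
    fix ab assume "ab \<in> {(a, b). a + b = m}"
    then have "snd ab = m - fst ab" by auto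
    then show "mon L c k (fst ab) \<otimes> P (snd ab) = (if (k, m - k) = ab then c \<otimes> P (m - k) else \<zero>)"
      using P by (cases ab) (auto simp: mon_def)
  qed (use assms P in auto)
  also have "\<dots> = c \<otimes> P (m - k)"
    by (rule L.add.finprod_singleton) (use True assms P finite_decomp in auto)
  finally show ?thesis using True by simp
next
  case False
  note P = pset_finsupp(1)[OF assms(2)]
  have "(mon L c k \<otimes>\<^bsub>R\<^esub> P) m = (\<Oplus>ab\<in>{(a, b). a + b = m}. \<zero>)"
    unfolding R_simps mpoly_mult_def
    by (rule L.add.finprod_cong'[OF refl]) (use False P in \<open>auto simp: mon_def\<close>)
  then show ?thesis using False by simp
qed

lemma mon_mult_mon:
  assumes "c \<in> carrier L" "d \<in> carrier L"
  shows "mon L c k \<otimes>\<^bsub>R\<^esub> mon L d m = mon L (c \<otimes> d) (k + m)"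
proof
  fix x
  have "(mon L c k \<otimes>\<^bsub>R\<^esub> mon L d m) x =
      (\<Oplus>ab\<in>{(a, b). a + b = x}. if (k, m) = ab then c \<otimes> d else \<zero>)"
    unfolding R_simps mpoly_mult_def
    by (rule L.add.finprod_cong'[OF refl]) (use assms in \<open>auto simp: mon_def\<close>)
  also have "\<dots> = mon L (c \<otimes> d) (k + m) x"
  proof (cases "k + m = x")
    case True
    have "(\<Oplus>ab\<in>{(a, b). a + b = x}. if (k, m) = ab then c \<otimes> d else \<zero>) = c \<otimes> d"
      by (rule L.add.finprod_singleton) (use True assms finite_decomp in auto)
    then show ?thesis using True by (simp add: mon_def)
  next
    case False
    have "(\<Oplus>ab\<in>{(a, b). a + b = x}. if (k, m) = ab then c \<otimes> d else \<zero>) = \<zero>"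
      by (rule L.add.finprod_one_eqI) (use False in auto)
    then show ?thesis using False by (simp add: mon_def)
  qed
  finally show "(mon L c k \<otimes>\<^bsub>R\<^esub> mon L d m) x = mon L (c \<otimes> d) (k + m) x" .
qed

lemma padd_abelian: "abelian_group R"
proof (rule abelian_groupI)
  fix P assume P: "P \<in> carrier R"
  note Pf = pset_finsupp[OF P]
  have "(\<lambda>m. \<ominus> P m) \<in> carrier R"
  proof (rule carrierI)
    have "\<ominus> P m \<noteq> \<zero> \<longleftrightarrow> P m \<noteq> \<zero>" for m
      using Pf(1)[of m] by (metis L.minus_minus L.minus_zero)
    then show "finite {m. \<ominus> P m \<noteq> \<zero>}" "\<And>m. \<ominus> P m \<noteq> \<zero> \<Longrightarrow> set_mset m \<subseteq> I" using Pf by auto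
  qed (use Pf in auto)
  then show "\<exists>Q\<in>carrier R. Q \<oplus>\<^bsub>R\<^esub> P = \<zero>\<^bsub>R\<^esub>"
    using Pf(1) by (intro bexI[of _ "\<lambda>m. \<ominus> P m"]) (auto simp: R_simps L.l_neg)
next
  fix P Q T assume "P \<in> carrier R" "Q \<in> carrier R" "T \<in> carrier R"
  then show "(P \<oplus>\<^bsub>R\<^esub> Q) \<oplus>\<^bsub>R\<^esub> T = P \<oplus>\<^bsub>R\<^esub> (Q \<oplus>\<^bsub>R\<^esub> T)"
    using pset_finsupp(1) by (simp add: R_simps L.a_assoc)
next
  fix P Q assume "P \<in> carrier R" "Q \<in> carrier R"
  then show "P \<oplus>\<^bsub>R\<^esub> Q = Q \<oplus>\<^bsub>R\<^esub> P"
    using pset_finsupp(1) by (simp add: R_simps L.a_comm)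
next
  fix P assume "P \<in> carrier R"
  then show "\<zero>\<^bsub>R\<^esub> \<oplus>\<^bsub>R\<^esub> P = P" using pset_finsupp(1) by (simp add: R_simps)
qed (rule padd_in_carrier zero_in_carrier; assumption?)+

lemma mult_in_carrier:
  assumes P: "P \<in> carrier R" and Q: "Q \<in> carrier R"
  shows "P \<otimes>\<^bsub>R\<^esub> Q \<in> carrier R"
  using P
proof (induction P rule: mpoly_induct)
  case zero
  then show ?case using Q by (simp add: mult_zero zero_in_carrier)
next
  case (mon m)
  define c where "c = P m"
  have c: "c \<in> carrier L" using mon by (simp add: c_def)
  show ?case
    using Q unfolding c_def[symmetric]
  proof (induction Q rule: mpoly_induct)
    case zero
    then show ?case using c mon by (simp add: mult_zero zero_in_carrier mon_in_carrier)
  next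
    case (mon k)
    then show ?case using c \<open>set_mset m \<subseteq> I\<close> by (simp add: mon_mult_mon mon_in_carrier)
  next
    case (add A B)
    then show ?case using c mon by (simp add: mult_add_right mon_in_carrier padd_in_carrier)
  qed
next
  case (add A B)
  then show ?case using Q by (simp add: mult_add_left padd_in_carrier)
qed

lemma mult_assoc:
  assumes P: "P \<in> carrier R" and Q: "Q \<in> carrier R" and T: "T \<in> carrier R"
  shows "(P \<otimes>\<^bsub>R\<^esub> Q) \<otimes>\<^bsub>R\<^esub> T = P \<otimes>\<^bsub>R\<^esub> (Q \<otimes>\<^bsub>R\<^esub> T)"
  using P
proof (induction P rule: mpoly_induct)
  case zero
  then show ?case using Q T by (simp add: mult_zero mult_in_carrier)
next
  case (mon m)
  define c where "c = P m"
  have c: "c \<in> carrier L" "mon L c m \<in> carrier R" using mon by (auto simp: c_def mon_in_carrier)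
  show ?case
    using Q unfolding c_def[symmetric]
  proof (induction Q rule: mpoly_induct)
    case zero
    then show ?case using c T by (simp add: mult_zero)
  next
    case (mon k)
    define d where "d = Q k"
    have d: "d \<in> carrier L" "mon L d k \<in> carrier R" using mon by (auto simp: d_def mon_in_carrier)
    show ?case
      using T unfolding d_def[symmetric]
    proof (induction T rule: mpoly_induct)
      case zero
      then show ?case using c d by (simp add: mult_zero mult_in_carrier)
    next
      case (mon j)
      then show ?case using c d by (simp add: mon_mult_mon L.m_assoc add.assoc)
    next
      case (add A B)
      then show ?case using c d by (simp add: mult_add_right mult_in_carrier)
    qed
  next
    case (add A B)
    then show ?case using c T by (simp add: mult_add_right mult_add_left mult_in_carrier)
  qed
next
  case (add A B)
  then show ?case using Q T by (simp add: mult_add_left mult_in_carrier)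
qed

lemma one_mult:
  assumes P: "P \<in> carrier R"
  shows "\<one>\<^bsub>R\<^esub> \<otimes>\<^bsub>R\<^esub> P = P"
  using pset_finsupp(1)[OF P] P unfolding R_simps(4)
  by (intro ext) (simp add: mon_mult_coeff)

lemma one_in_carrier: "\<one>\<^bsub>R\<^esub> \<in> carrier R"
  by (simp add: R_simps mon_in_carrier)

lemma R_cring: "cring R"
proof (rule cringI[OF padd_abelian])
  show "comm_monoid R"
    by (rule comm_monoidI)
      (simp_all add: mult_in_carrier mult_assoc one_mult one_in_carrier, rule mult_comm)
qed (simp add: mult_add_left)

sublocale R: cring R by (rule R_cring)

end

section \<open>Sums in ideals, and dual bases of a field over its subfield of \<open>p\<close>-th
  powers\<close>

lemma (in cring) finsum_in_ideal:
  assumes J: "ideal J R" and "finite A" and "\<And>a. a \<in> A \<Longrightarrow> f a \<in> J"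
  shows "finsum R f A \<in> J"
  using assms(2,3)
proof (induction A rule: finite_induct)
  case empty
  show ?case using ideal_zero[OF J] by simp
next
  case (insert a A)
  have fJ: "f x \<in> J" if "x \<in> insert a A" for x using insert.prems that by blast
  have "finsum R f A \<in> J" by (rule insert.IH) (use fJ in blast)
  then have "f a \<oplus> finsum R f A \<in> J"
    by (intro ideal_add[OF J] fJ) auto
  moreover have "finsum R f (insert a A) = f a \<oplus> finsum R f A"
    by (rule finsum_insert) (use insert.hyps fJ ideal.Icarr[OF J] in auto)
  ultimately show ?case by (simp only:)
qed

lemma (in cring)
  assumes "c \<in> carrier R" "c' \<in> carrier R" "a \<in> carrier R" "b \<in> carrier R"
    "a' \<in> carrier R" "b' \<in> carrier R"
  shows leibniz_right: "(c \<otimes> a' \<oplus> c' \<otimes> a) \<oplus> (c \<otimes> b' \<oplus> c' \<otimes> b) = c \<otimes> (a' \<oplus> b') \<oplus> c' \<otimes> (a \<oplus> b)"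
    and leibniz_left: "(a \<otimes> c' \<oplus> a' \<otimes> c) \<oplus> (b \<otimes> c' \<oplus> b' \<otimes> c) = (a \<oplus> b) \<otimes> c' \<oplus> (a' \<oplus> b') \<otimes> c"
  using assms by algebra+

lemma (in ring) combine_eq_finsum:
  assumes "length Ks = length Us" and "set Ks \<subseteq> carrier R" and "set Us \<subseteq> carrier R"
  shows "combine Ks Us = (\<Oplus>j\<in>{..<length Us}. Ks ! j \<otimes> Us ! j)"
  using assms
proof (induction Ks Us rule: list_induct2)
  case (Cons k Ks u Us)
  have c: "(\<lambda>j. (k # Ks) ! j \<otimes> (u # Us) ! j) \<in> {..<length (u # Us)} \<rightarrow> carrier R"
    using Cons by (auto simp: nth_Cons subset_iff split: nat.splits)
  have "{..<length (u # Us)} = insert 0 (Suc ` {..<length Us})"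
    by (simp add: lessThan_Suc_eq_insert_0)
  then have "(\<Oplus>j\<in>{..<length (u # Us)}. (k # Ks) ! j \<otimes> (u # Us) ! j)
      = (\<Oplus>j\<in>insert 0 (Suc ` {..<length Us}). (k # Ks) ! j \<otimes> (u # Us) ! j)" by simp
  also have "\<dots> = k \<otimes> u \<oplus> (\<Oplus>j\<in>Suc ` {..<length Us}. (k # Ks) ! j \<otimes> (u # Us) ! j)"
    using c Cons by (subst finsum_insert) auto
  also have "(\<Oplus>j\<in>Suc ` {..<length Us}. (k # Ks) ! j \<otimes> (u # Us) ! j)
      = (\<Oplus>j\<in>{..<length Us}. Ks ! j \<otimes> Us ! j)"
    using c by (subst finsum_reindex) auto
  finally show ?case using Cons by simp
qed simp

lemma (in domain) pow_zero_imp: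
  assumes "x \<in> carrier R" "x [^] (n::nat) = \<zero>" shows "x = \<zero>"
  using assms(2)
proof (induction n)
  case (Suc n)
  then show ?case using assms(1) integral[of "x [^] n" x] by auto
qed simp

lemma (in field) frobenius_inj:
  assumes p: "Factorial_Ring.prime (p :: nat)" and char: "add_pow R p \<one> = \<zero>"
    and "x \<in> carrier R" "y \<in> carrier R" "x [^] p = y [^] p"
  shows "x = y"
proof -
  have "x [^] p = ((x \<ominus> y) \<oplus> y) [^] p" using assms(3,4) by (simp add: a_minus_def a_assoc l_neg)
  also have "\<dots> = (x \<ominus> y) [^] p \<oplus> y [^] p" using assms by (intro frobenius_add) auto
  finally have "(x \<ominus> y) [^] p = \<zero>"
    using assms by (metis add.r_cancel_one minus_closed nat_pow_closed a_comm)
  then have "x \<ominus> y = \<zero>" using assms(3,4) pow_zero_imp by blast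
  then show ?thesis using assms(3,4) by simp
qed

text \<open>The \<open>\<phi> j\<close> are the \<open>p\<close>-th roots of the coordinate
  functions of a basis over the subfield of \<open>p\<close>-th powers. Coordinates are linear over
  that subfield, and injectivity of Frobenius carries this over to their roots.\<close>

lemma (in field) cartier_dual_basis:
  assumes p: "Factorial_Ring.prime (p :: nat)" and char: "add_pow R p \<one> = \<zero>"
    and fin: "finite_dimension ((\<lambda>x. x [^] p) ` carrier R) (carrier R)"
  obtains n b \<phi> where "\<And>j. j < n \<Longrightarrow> \<phi> j \<in> cartier_maps R p" "\<And>j. j < n \<Longrightarrow> b j \<in> carrier R"
    "\<And>x. x \<in> carrier R \<Longrightarrow> x = (\<Oplus>j\<in>{..<n::nat}. \<phi> j x [^] p \<otimes> b j)"
proof -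
  define K where "K = (\<lambda>x. x [^] p) ` carrier R"
  have p0: "0 < p" using p prime_gt_0_nat by blast
  have KI: "x [^] p \<in> K" if "x \<in> carrier R" for x using that by (auto simp: K_def)
  have KE: "\<exists>x\<in>carrier R. k = x [^] p" if "k \<in> K" for k using that by (auto simp: K_def)
  have Kc: "K \<subseteq> carrier R" by (auto simp: K_def)
  have K: "subfield K R"
  proof (rule subfieldI')
    show "subring K R"
    proof (rule subringI[OF Kc])
      show "\<one> \<in> K" using KI[OF one_closed] by simp
    next
      fix h assume "h \<in> K"
      then obtain x where x: "x \<in> carrier R" "h = x [^] p" using KE by blast
      \<comment> \<open>Additivity of Frobenius identifies the power of \<open>\<ominus> x\<close>
        without a distinction between \<open>p = 2\<close> and odd \<open>p\<close>.\<close>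
      have "\<zero> = (\<ominus> x \<oplus> x) [^] p" using x p0 by (simp add: l_neg nat_pow_zero)
      also have "\<dots> = (\<ominus> x) [^] p \<oplus> x [^] p" using x by (intro frobenius_add p char) auto
      finally have "\<ominus> h = (\<ominus> x) [^] p" using x by (metis a_inv_closed minus_equality nat_pow_closed)
      then show "\<ominus> h \<in> K" using KI x by simp
    next
      fix h k assume "h \<in> K" "k \<in> K"
      then obtain x y where xy: "x \<in> carrier R" "h = x [^] p" "y \<in> carrier R" "k = y [^] p"
        using KE by blast
      have "h \<oplus> k = (x \<oplus> y) [^] p" "h \<otimes> k = (x \<otimes> y) [^] p"
        using xy frobenius_add[OF p char] by (simp_all add: nat_pow_distrib)
      then show "h \<oplus> k \<in> K" "h \<otimes> k \<in> K" using KI xy by simp_all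
    qed
  next
    fix k assume k: "k \<in> K - {\<zero>}"
    then obtain x where x: "x \<in> carrier R" "k = x [^] p" using KE by blast
    have "x \<noteq> \<zero>" using k x p0 by (auto simp: nat_pow_zero)
    then have u: "x \<in> Units R" using x field_Units by simp
    have "(inv x) [^] p \<otimes> k = \<one>"
      unfolding x(2) using u x by (simp add: nat_pow_distrib[symmetric])
    then have "inv k = (inv x) [^] p" using u x by (metis Units_inv_closed comm_inv_char m_comm nat_pow_closed)
    then show "inv k \<in> K" using KI u by simp
  qed
  obtain n where "dimension n K (carrier R)" using fin unfolding K_def[symmetric] finite_dimension_def by blast
  then obtain Us where Us: "set Us \<subseteq> carrier R" "independent K Us" "Span K Us = carrier R"
    using exists_base[OF K] by blast
  define ok where "ok x Ks \<longleftrightarrow> set Ks \<subseteq> K \<and> length Ks = length Us \<and> x = combine Ks Us" for x Ks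
  define k where "k x = (THE Ks. ok x Ks)" for x
  have uniq: "\<exists>!Ks. ok x Ks" if "x \<in> carrier R" for x
    unfolding ok_def by (rule unique_decomposition[OF K Us(2)]) (unfold Us(3), rule that)
  have k: "ok x (k x)" if "x \<in> carrier R" for x unfolding k_def by (rule theI'[OF uniq[OF that]])
  have k_eq: "k x = Ks" if "x \<in> carrier R" "ok x Ks" for x Ks
    using uniq[OF that(1)] k[OF that(1)] that(2) by blast
  have kc: "set (k x) \<subseteq> carrier R" "length (k x) = length Us" "k x ! j \<in> K \<or> length Us \<le> j" if "x \<in> carrier R" for x j
    using k[OF that] Kc nth_mem[of j "k x"] unfolding ok_def by (auto simp: subset_iff)
  \<comment> \<open>The inverse of Frobenius on \<open>K\<close>, well defined by
    \<open>frobenius_inj\<close>.\<close>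
  define r where "r y = (THE z. z \<in> carrier R \<and> z [^] p = y)" for y
  have r: "r (z [^] p) = z" if "z \<in> carrier R" for z
    unfolding r_def by (rule the_equality) (use that frobenius_inj[OF p char] in auto)
  have rK: "r y \<in> carrier R" "r y [^] p = y" if "y \<in> K" for y using KE[OF that] r by auto
  define \<phi> where "\<phi> j x = r (k x ! j)" for j x
  have "\<phi> j \<in> cartier_maps R p" if j: "j < length Us" for j
  proof -
    have cl: "\<phi> j x \<in> carrier R" "\<phi> j x [^] p = k x ! j" if "x \<in> carrier R" for x
      unfolding \<phi>_def using kc(3)[OF that, of j] j rK by auto
    have add: "\<phi> j (x \<oplus> y) = \<phi> j x \<oplus> \<phi> j y" if x: "x \<in> carrier R" and y: "y \<in> carrier R" for x y
    proof -
      have "k (x \<oplus> y) = map2 (\<oplus>) (k x) (k y)"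
      proof (rule k_eq)
        have "set (map2 (\<oplus>) (k x) (k y)) \<subseteq> K"
        proof
          fix z assume "z \<in> set (map2 (\<oplus>) (k x) (k y))"
          then obtain a b where ab: "(a, b) \<in> set (zip (k x) (k y))" "z = a \<oplus> b" by auto
          have "a \<in> K" "b \<in> K"
            using set_zip_leftD[OF ab(1)] set_zip_rightD[OF ab(1)] k[OF x] k[OF y]
            unfolding ok_def by blast+
          then show "z \<in> K" unfolding ab(2) by (rule subringE(7)[OF subfieldE(1)[OF K]])
        qed
        moreover have "x \<oplus> y = combine (map2 (\<oplus>) (k x) (k y)) Us"
          using combine_add[of "k x" Us "k y"] kc[OF x] kc[OF y] Us(1) k[OF x] k[OF y]
          unfolding ok_def by metis
        ultimately show "ok (x \<oplus> y) (map2 (\<oplus>) (k x) (k y))"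
          using kc(2)[OF x] kc(2)[OF y] unfolding ok_def by simp
      qed (use x y in simp)
      then have "k (x \<oplus> y) ! j = k x ! j \<oplus> k y ! j" using j kc(2)[OF x] kc(2)[OF y] by simp
      then have "\<phi> j (x \<oplus> y) [^] p = (\<phi> j x \<oplus> \<phi> j y) [^] p"
        using cl x y by (simp add: frobenius_add[OF p char])
      then show ?thesis using frobenius_inj[OF p char] cl x y by simp
    qed
    have mult: "\<phi> j (y [^] p \<otimes> x) = y \<otimes> \<phi> j x" if x: "x \<in> carrier R" and y: "y \<in> carrier R" for x y
    proof -
      have "k (y [^] p \<otimes> x) = map ((\<otimes>) (y [^] p)) (k x)"
      proof (rule k_eq)
        have "set (map ((\<otimes>) (y [^] p)) (k x)) \<subseteq> K"
          using k[OF x] subringE(6)[OF subfieldE(1)[OF K]] KI[OF y] unfolding ok_def by auto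
        moreover have "y [^] p \<otimes> x = combine (map ((\<otimes>) (y [^] p)) (k x)) Us"
          using combine_r_distr[of "k x" Us "y [^] p"] kc[OF x] Us(1) k[OF x] y
          unfolding ok_def by simp
        ultimately show "ok (y [^] p \<otimes> x) (map ((\<otimes>) (y [^] p)) (k x))"
          using kc(2)[OF x] unfolding ok_def by simp
      qed (use x y in simp)
      then have "k (y [^] p \<otimes> x) ! j = y [^] p \<otimes> k x ! j" using j kc(2)[OF x] by simp
      then have "\<phi> j (y [^] p \<otimes> x) [^] p = (y \<otimes> \<phi> j x) [^] p"
        using cl x y by (simp add: nat_pow_distrib)
      then show ?thesis using frobenius_inj[OF p char] cl x y by simp
    qed
    show ?thesis unfolding cartier_maps_def using cl(1) add mult by simp
  qed
  moreover have "Us ! j \<in> carrier R" if "j < length Us" for j using that Us(1) by (meson nth_mem subsetD)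
  moreover have "x = (\<Oplus>j\<in>{..<length Us}. \<phi> j x [^] p \<otimes> Us ! j)" if x: "x \<in> carrier R" for x
  proof -
    have "x = (\<Oplus>j\<in>{..<length Us}. k x ! j \<otimes> Us ! j)"
      using combine_eq_finsum[of "k x" Us] k[OF x] kc[OF x] Us(1) unfolding ok_def by simp
    also have "\<dots> = (\<Oplus>j\<in>{..<length Us}. \<phi> j x [^] p \<otimes> Us ! j)"
    proof (rule add.finprod_cong'[OF refl])
      show "(\<lambda>j. \<phi> j x [^] p \<otimes> Us ! j) \<in> {..<length Us} \<rightarrow> carrier R"
      proof
        fix j assume "j \<in> {..<length Us}"
        then have "Us ! j \<in> carrier R" "\<phi> j x \<in> carrier R"
          using Us(1) nth_mem[of j Us] kc(3)[OF x, of j] rK(1) unfolding \<phi>_def by auto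
        then show "\<phi> j x [^] p \<otimes> Us ! j \<in> carrier R" by simp
      qed
    next
      fix j assume "j \<in> {..<length Us}"
      then show "k x ! j \<otimes> Us ! j = \<phi> j x [^] p \<otimes> Us ! j"
        using kc(3)[OF x, of j] rK(2) unfolding \<phi>_def by auto
    qed
    finally show ?thesis .
  qed
  ultimately show ?thesis using that by blast
qed

context mpoly
begin

lemma mon_pow:
  assumes "c \<in> carrier L" "set_mset m \<subseteq> I"
  shows "mon L c m [^]\<^bsub>R\<^esub> (n::nat) = mon L (c [^] n) (repeat_mset n m)"
proof (induction n)
  case 0
  then show ?case by (simp add: R_simps)
next
  case (Suc n)
  then show ?case using assms by (simp add: mon_mult_mon add.commute)
qed

lemma add_pow_coeff:
  assumes "P \<in> carrier R"
  shows "add_pow R (n::nat) P = (\<lambda>m. add_pow L n (P m))"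
proof (induction n)
  case 0
  then show ?case by (simp add: R_simps)
next
  case (Suc n)
  then show ?case using assms by (simp add: R_simps)
qed

lemma finsum_mon:
  assumes "finite A" "c \<in> A \<rightarrow> carrier L" "set_mset m \<subseteq> I"
  shows "(\<Oplus>\<^bsub>R\<^esub>j\<in>A. mon L (c j) m) = mon L (\<Oplus>j\<in>A. c j) m"
  using assms
proof (induction A rule: finite_induct)
  case empty
  then show ?case by (simp add: mon_zero)
next
  case (insert a A)
  then have "(\<lambda>j. mon L (c j) m) \<in> A \<rightarrow> carrier R" "mon L (c a) m \<in> carrier R"
    by (auto intro!: mon_in_carrier)
  then show ?case using insert by (simp add: mon_add)
qed

section \<open>Partial derivatives\<close>

abbreviation pd where "pd \<equiv> mpoly_pderiv L"

lemma pderiv_mon: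
  assumes "c \<in> carrier L"
  shows "pd i (mon L c m) = (if i \<in># m then mon L (add_pow L (count m i) c) (m - {#i#}) else \<zero>\<^bsub>R\<^esub>)"
proof
  fix k
  show "pd i (mon L c m) k = (if i \<in># m then mon L (add_pow L (count m i) c) (m - {#i#}) else \<zero>\<^bsub>R\<^esub>) k"
  proof (cases "m = add_mset i k")
    case True
    then show ?thesis by (simp add: mpoly_pderiv_def mon_def)
  next
    case False
    then have "k \<noteq> m - {#i#} \<or> i \<notin># m" by auto
    moreover have "pd i (mon L c m) k = \<zero>" using False by (simp add: mpoly_pderiv_def mon_def)
    ultimately show ?thesis by (cases "i \<in># m") (simp_all add: mon_def R_simps)
  qed
qed

lemma pderiv_in_carrier:
  assumes P: "P \<in> carrier R"
  shows "pd i P \<in> carrier R"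
proof (rule carrierI)
  note Pf = pset_finsupp[OF P]
  have nz: "P (add_mset i m) \<noteq> \<zero>" if "pd i P m \<noteq> \<zero>" for m
    using that by (auto simp: mpoly_pderiv_def)
  show "pd i P m \<in> carrier L" for m using Pf by (simp add: mpoly_pderiv_def)
  have "finite (add_mset i -` {m. P m \<noteq> \<zero>})"
    by (rule finite_vimageI[OF Pf(2)]) (simp add: inj_def)
  then show "finite {m. pd i P m \<noteq> \<zero>}" using nz by (auto elim: rev_finite_subset)
  show "set_mset m \<subseteq> I" if "pd i P m \<noteq> \<zero>" for m using Pf(3)[OF nz[OF that]] by simp
qed

lemma pderiv_add:
  assumes "P \<in> carrier R" "Q \<in> carrier R"
  shows "pd i (P \<oplus>\<^bsub>R\<^esub> Q) = pd i P \<oplus>\<^bsub>R\<^esub> pd i Q"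
  using pset_finsupp(1)[OF assms(1)] pset_finsupp(1)[OF assms(2)]
  by (intro ext) (simp add: mpoly_pderiv_def R_simps L.add.nat_pow_distrib L.a_ac)

lemma pderiv_zero: "pd i \<zero>\<^bsub>R\<^esub> = \<zero>\<^bsub>R\<^esub>"
  by (intro ext) (simp add: mpoly_pderiv_def R_simps)

lemma pderiv_mult_mon:
  assumes "c \<in> carrier L" "d \<in> carrier L" "set_mset m \<subseteq> I" "set_mset k \<subseteq> I"
  shows "pd i (mon L c m \<otimes>\<^bsub>R\<^esub> mon L d k) =
    mon L c m \<otimes>\<^bsub>R\<^esub> pd i (mon L d k) \<oplus>\<^bsub>R\<^esub> pd i (mon L c m) \<otimes>\<^bsub>R\<^esub> mon L d k"
proof -
  have in1: "mon L c m \<in> carrier R" "mon L d k \<in> carrier R" using assms by (auto simp: mon_in_carrier)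
  have cc: "add_pow L (n::nat) c \<in> carrier L" "add_pow L n d \<in> carrier L" for n using assms by auto
  have s: "set_mset (m - {#i#}) \<subseteq> I" "set_mset (k - {#i#}) \<subseteq> I"
    using assms by (meson in_diffD subset_iff)+
  show ?thesis
  proof (cases "i \<in># m"; cases "i \<in># k")
    assume i: "i \<in># m" "i \<in># k"
    have e: "m + (k - {#i#}) = m + k - {#i#}" "(m - {#i#}) + k = m + k - {#i#}"
      using i by (auto dest!: multi_member_split)
    have "add_pow L (count m i + count k i) (c \<otimes> d) =
        c \<otimes> add_pow L (count k i) d \<oplus> add_pow L (count m i) c \<otimes> d"
      using assms by (simp add: L.add_pow_rdistr L.add_pow_ldistr L.add.nat_pow_mult add.commute)
    then show ?thesis using assms i cc by (simp add: mon_mult_mon pderiv_mon e mon_add)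
  next
    assume i: "i \<in># m" "i \<notin># k"
    have e: "(m - {#i#}) + k = m + k - {#i#}" using i by (auto dest!: multi_member_split)
    have c0: "count k i = 0" using i by (simp add: not_in_iff)
    have [simp]: "mon L c' (m + k - {#i#}) \<in> carrier R" if "c' \<in> carrier L" for c'
      using that s assms unfolding e[symmetric] by (intro mon_in_carrier) auto
    show ?thesis using assms i cc in1 c0
      by (simp add: mon_mult_mon pderiv_mon e mult_zero L.add_pow_ldistr)
  next
    assume i: "i \<notin># m" "i \<in># k"
    have e: "m + (k - {#i#}) = m + k - {#i#}" using i by (auto dest!: multi_member_split)
    have c0: "count m i = 0" using i by (simp add: not_in_iff)
    have [simp]: "mon L c' (m + k - {#i#}) \<in> carrier R" if "c' \<in> carrier L" for c'
      using that s assms unfolding e[symmetric] by (intro mon_in_carrier) auto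
    show ?thesis using assms i cc in1 c0
      by (simp add: mon_mult_mon pderiv_mon e mult_zero L.add_pow_rdistr)
  next
    assume "i \<notin># m" "i \<notin># k"
    then show ?thesis using assms in1 by (simp add: mon_mult_mon pderiv_mon mult_zero)
  qed
qed

lemma pderiv_mult:
  assumes P: "P \<in> carrier R" and Q: "Q \<in> carrier R"
  shows "pd i (P \<otimes>\<^bsub>R\<^esub> Q) = P \<otimes>\<^bsub>R\<^esub> pd i Q \<oplus>\<^bsub>R\<^esub> pd i P \<otimes>\<^bsub>R\<^esub> Q"
  using P
proof (induction P rule: mpoly_induct)
  case zero
  then show ?case using Q pderiv_in_carrier[OF Q] by (simp add: pderiv_zero)
next
  case (mon m)
  define c where "c = P m"
  have c: "c \<in> carrier L" "mon L c m \<in> carrier R" using mon by (auto simp: c_def mon_in_carrier)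
  note c' = pderiv_in_carrier[OF c(2), of i]
  show ?case
    using Q unfolding c_def[symmetric]
  proof (induction Q rule: mpoly_induct)
    case zero
    then show ?case using c c' by (simp add: pderiv_zero)
  next
    case (mon k)
    then show ?case using c \<open>set_mset m \<subseteq> I\<close> by (simp add: pderiv_mult_mon)
  next
    case (add A B)
    note AB = add(1,2) pderiv_in_carrier[OF add(1), of i] pderiv_in_carrier[OF add(2), of i]
    have "pd i (mon L c m \<otimes>\<^bsub>R\<^esub> (A \<oplus>\<^bsub>R\<^esub> B)) =
        pd i (mon L c m \<otimes>\<^bsub>R\<^esub> A) \<oplus>\<^bsub>R\<^esub> pd i (mon L c m \<otimes>\<^bsub>R\<^esub> B)"
      unfolding R.r_distr[OF AB(1,2) c(2)] by (rule pderiv_add) (use AB c in auto)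
    also have "\<dots> = mon L c m \<otimes>\<^bsub>R\<^esub> (pd i A \<oplus>\<^bsub>R\<^esub> pd i B) \<oplus>\<^bsub>R\<^esub>
        pd i (mon L c m) \<otimes>\<^bsub>R\<^esub> (A \<oplus>\<^bsub>R\<^esub> B)"
      unfolding add(3,4) by (rule R.leibniz_right[OF c(2) c' AB])
    finally show ?case unfolding pderiv_add[OF AB(1,2)] .
  qed
next
  case (add A B)
  note AB = add(1,2) pderiv_in_carrier[OF add(1), of i] pderiv_in_carrier[OF add(2), of i]
  have "pd i ((A \<oplus>\<^bsub>R\<^esub> B) \<otimes>\<^bsub>R\<^esub> Q) = pd i (A \<otimes>\<^bsub>R\<^esub> Q) \<oplus>\<^bsub>R\<^esub> pd i (B \<otimes>\<^bsub>R\<^esub> Q)"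
    unfolding R.l_distr[OF AB(1,2) Q] by (rule pderiv_add) (use AB Q in auto)
  also have "\<dots> = (A \<oplus>\<^bsub>R\<^esub> B) \<otimes>\<^bsub>R\<^esub> pd i Q \<oplus>\<^bsub>R\<^esub> (pd i A \<oplus>\<^bsub>R\<^esub> pd i B) \<otimes>\<^bsub>R\<^esub> Q"
    unfolding add(3,4) by (rule R.leibniz_left[OF Q pderiv_in_carrier[OF Q] AB])
  finally show ?case unfolding pderiv_add[OF AB(1,2)] .
qed

lemma pderiv_derivation: "derivation R (pd i)"
  unfolding derivation_def by (auto simp: pderiv_in_carrier pderiv_add pderiv_mult)

end

section \<open>Cartier maps of polynomial rings\<close>

lemma in_repeat_mset: "0 < p \<Longrightarrow> i \<in># m \<Longrightarrow> i \<in># repeat_mset p m"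
  by (simp flip: count_greater_zero_iff)

text \<open>Division of an exponent vector by \<open>p\<close> with remainder; the induction removes
  \<open>p\<close> copies of one variable at a time.\<close>

lemma repeat_mset_add_div_exists:
  assumes "0 < p"
  shows "\<exists>m' \<alpha>. m = repeat_mset p m' + \<alpha> \<and> (\<forall>i. count \<alpha> i < p)"
proof (induction "size m" arbitrary: m rule: less_induct)
  case less
  show ?case
  proof (cases "\<forall>i. count m i < p")
    case True
    then show ?thesis by (intro exI[of _ "{#}"] exI[of _ m]) simp
  next
    case False
    then obtain i where i: "p \<le> count m i" by (auto simp: not_less)
    define m1 where "m1 = m - replicate_mset p i"
    have m: "m = m1 + replicate_mset p i"
      using i by (simp add: m1_def count_le_replicate_mset_subset_eq)
    then have "size m1 < size m" using assms by simp
    then obtain m' \<alpha> where *: "m1 = repeat_mset p m' + \<alpha>" "\<forall>i. count \<alpha> i < p" using less by blast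
    have "m = repeat_mset p (add_mset i m') + \<alpha>"
      unfolding m *(1) by (rule multiset_eqI) simp
    then show ?thesis using *(2) by blast
  qed
qed

lemma repeat_mset_add_inject:
  assumes "\<And>i. count \<alpha> i < p" "\<And>i. count \<beta> i < p"
  shows "repeat_mset p m + \<alpha> = repeat_mset p k + \<beta> \<longleftrightarrow> m = k \<and> \<alpha> = \<beta>"
proof
  assume eq: "repeat_mset p m + \<alpha> = repeat_mset p k + \<beta>"
  have "count m i = count k i \<and> count \<alpha> i = count \<beta> i" for i
  proof -
    have e: "p * count m i + count \<alpha> i = p * count k i + count \<beta> i"
      using arg_cong[OF eq, of "\<lambda>m. count m i"] by simp
    have "(p * count m i + count \<alpha> i) div p = count m i" "(p * count k i + count \<beta> i) div p = count k i"
      using assms[of i] by (simp_all add: div_nat_eqI)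
    then show ?thesis using e by simp
  qed
  then show "m = k \<and> \<alpha> = \<beta>" by (simp add: multiset_eq_iff)
qed simp

lemma repeat_mset_subset_iff:
  assumes "\<And>i. count \<alpha> i < p"
  shows "repeat_mset p k \<subseteq># repeat_mset p m + \<alpha> \<longleftrightarrow> k \<subseteq># m"
proof -
  have "p * x \<le> p * y + count \<alpha> i \<longleftrightarrow> x \<le> y" for x y i
  proof
    assume "p * x \<le> p * y + count \<alpha> i"
    then have "p * x < p * Suc y" using assms[of i] by simp
    then show "x \<le> y" unfolding mult_less_cancel1 by simp
  next
    assume "x \<le> y"
    then show "p * x \<le> p * y + count \<alpha> i" by (simp add: trans_le_add1)
  qed
  then show ?thesis by (simp add: subseteq_mset_def)
qed

text \<open>Extracts the monomials with exponents congruent to \<open>\<alpha>\<close> modulo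
  \<open>p\<close>. With \<open>\<phi>\<close> running through the dual basis of the coefficient
  field and \<open>\<alpha>\<close> through the residues, these maps are the dual basis of the
  polynomial ring over its \<open>p\<close>-th powers.\<close>

definition lift_cartier :: "('a \<Rightarrow> 'a) \<Rightarrow> 'c multiset \<Rightarrow> nat \<Rightarrow> ('c multiset \<Rightarrow> 'a) \<Rightarrow> 'c multiset \<Rightarrow> 'a"
  where "lift_cartier \<phi> \<alpha> p P = (\<lambda>m. \<phi> (P (repeat_mset p m + \<alpha>)))"

locale mpoly_frobenius = mpoly L I for L :: "('a, 'b) ring_scheme" (structure) and I :: "'c set" +
  fixes p :: nat
  assumes p_prime: "Factorial_Ring.prime p"
    and charL: "add_pow L p \<one> = \<zero>"
    and F_finite: "L.finite_dimension ((\<lambda>x. x [^] p) ` carrier L) (carrier L)"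
    and finite_I: "finite I"
begin

lemma p_pos: "0 < p" using p_prime prime_gt_0_nat by blast

lemma charL': "c \<in> carrier L \<Longrightarrow> add_pow L (p * n) c = \<zero>"
proof -
  assume c: "c \<in> carrier L"
  have "add_pow L p c = add_pow L p \<one> \<otimes> c" using c by (simp add: L.add_pow_ldistr)
  then have "add_pow L p c = \<zero>" using c charL by simp
  then show ?thesis using c L.add.nat_pow_pow[OF c, of n p] by simp
qed

lemma charR: "add_pow R p \<one>\<^bsub>R\<^esub> = \<zero>\<^bsub>R\<^esub>"
  unfolding add_pow_coeff[OF one_in_carrier] using charL by (auto simp: R_simps mon_def)

lemma cartier_L:
  assumes "\<phi> \<in> cartier_maps L p"
  shows "x \<in> carrier L \<Longrightarrow> \<phi> x \<in> carrier L" "\<phi> \<zero> = \<zero>"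
    "x \<in> carrier L \<Longrightarrow> y \<in> carrier L \<Longrightarrow> \<phi> (x \<oplus> y) = \<phi> x \<oplus> \<phi> y"
    "x \<in> carrier L \<Longrightarrow> y \<in> carrier L \<Longrightarrow> \<phi> (y [^] p \<otimes> x) = y \<otimes> \<phi> x"
  using assms L.cartier_maps_zero[OF assms] by (auto simp: cartier_maps_def)

context
  fixes \<phi> and \<alpha> :: "'c multiset"
  assumes \<phi>: "\<phi> \<in> cartier_maps L p" and \<alpha>: "\<And>i. count \<alpha> i < p"
begin

abbreviation \<psi> where "\<psi> \<equiv> lift_cartier \<phi> \<alpha> p"

lemma lift_cartier_closed:
  assumes P: "P \<in> carrier R"
  shows "\<psi> P \<in> carrier R"
proof (rule carrierI)
  note Pf = pset_finsupp[OF P]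
  have nz: "P (repeat_mset p m + \<alpha>) \<noteq> \<zero>" if "\<psi> P m \<noteq> \<zero>" for m
    using that cartier_L(2)[OF \<phi>] by (auto simp: lift_cartier_def)
  show "\<psi> P m \<in> carrier L" for m
    using Pf(1) cartier_L(1)[OF \<phi>] by (simp add: lift_cartier_def)
  have "finite ((\<lambda>m. repeat_mset p m + \<alpha>) -` {m. P m \<noteq> \<zero>})"
    by (rule finite_vimageI[OF Pf(2)]) (rule injI, simp add: repeat_mset_add_inject[OF \<alpha> \<alpha>] del: add_right_cancel)
  then show "finite {m. \<psi> P m \<noteq> \<zero>}" using nz by (auto elim: rev_finite_subset)
  show "set_mset m \<subseteq> I" if "\<psi> P m \<noteq> \<zero>" for m
  proof
    fix i assume i: "i \<in># m"
    have "i \<in># repeat_mset p m + \<alpha>" using in_repeat_mset[OF p_pos i] by simp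
    then show "i \<in> I" using Pf(3)[OF nz[OF that]] by blast
  qed
qed

lemma lift_cartier_add:
  assumes "P \<in> carrier R" "Q \<in> carrier R"
  shows "\<psi> (P \<oplus>\<^bsub>R\<^esub> Q) = \<psi> P \<oplus>\<^bsub>R\<^esub> \<psi> Q"
  using cartier_L(3)[OF \<phi>] pset_finsupp(1)[OF assms(1)] pset_finsupp(1)[OF assms(2)]
  by (intro ext) (simp add: lift_cartier_def R_simps)

text \<open>Both sides are additive in \<open>Q\<close> since Frobenius is. For a monomial
  \<open>Q\<close>, multiplication by its \<open>p\<close>-th power shifts exponents by multiples of
  \<open>p\<close> and preserves residues.\<close>

lemma lift_cartier_pow_mult:
  assumes P: "P \<in> carrier R" and Q: "Q \<in> carrier R"
  shows "\<psi> (Q [^]\<^bsub>R\<^esub> p \<otimes>\<^bsub>R\<^esub> P) = Q \<otimes>\<^bsub>R\<^esub> \<psi> P"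
  using Q
proof (induction Q rule: mpoly_induct)
  case zero
  have "\<psi> \<zero>\<^bsub>R\<^esub> = \<zero>\<^bsub>R\<^esub>" using cartier_L(2)[OF \<phi>] by (simp add: lift_cartier_def R_simps)
  then show ?case using p_pos P lift_cartier_closed[OF P] by (simp add: R.nat_pow_zero)
next
  case (mon k)
  define d where "d = Q k"
  have d: "d \<in> carrier L" "d [^] p \<in> carrier L" using mon by (auto simp: d_def)
  show ?case unfolding d_def[symmetric] mon_pow[OF d(1) mon(3)]
  proof
    fix m
    have "repeat_mset p m + \<alpha> - repeat_mset p k = repeat_mset p (m - k) + \<alpha>" if "k \<subseteq># m"
    proof (rule multiset_eqI)
      fix i
      have "count k i \<le> count m i" using that by (simp add: subseteq_mset_def)
      then show "count (repeat_mset p m + \<alpha> - repeat_mset p k) i = count (repeat_mset p (m - k) + \<alpha>) i"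
        by (simp add: diff_mult_distrib2)
    qed
    then have "\<psi> (mon L (d [^] p) (repeat_mset p k) \<otimes>\<^bsub>R\<^esub> P) m =
        \<phi> (if k \<subseteq># m then d [^] p \<otimes> P (repeat_mset p (m - k) + \<alpha>) else \<zero>)"
      by (simp add: mon_mult_coeff[OF d(2) P] lift_cartier_def repeat_mset_subset_iff[OF \<alpha>])
    also have "\<dots> = (if k \<subseteq># m then d \<otimes> \<psi> P (m - k) else \<zero>)"
      using cartier_L(2)[OF \<phi>] cartier_L(4)[OF \<phi> pset_finsupp(1)[OF P] d(1)]
      by (simp add: lift_cartier_def)
    also have "\<dots> = (mon L d k \<otimes>\<^bsub>R\<^esub> \<psi> P) m"
      by (rule mon_mult_coeff[OF d(1) lift_cartier_closed[OF P], symmetric])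
    finally show "\<psi> (mon L (d [^] p) (repeat_mset p k) \<otimes>\<^bsub>R\<^esub> P) m = (mon L d k \<otimes>\<^bsub>R\<^esub> \<psi> P) m" .
  qed
next
  case (add A B)
  have cl: "A [^]\<^bsub>R\<^esub> p \<in> carrier R" "B [^]\<^bsub>R\<^esub> p \<in> carrier R" "\<psi> P \<in> carrier R"
    using add lift_cartier_closed[OF P] by auto
  have "(A \<oplus>\<^bsub>R\<^esub> B) [^]\<^bsub>R\<^esub> p \<otimes>\<^bsub>R\<^esub> P = A [^]\<^bsub>R\<^esub> p \<otimes>\<^bsub>R\<^esub> P \<oplus>\<^bsub>R\<^esub> B [^]\<^bsub>R\<^esub> p \<otimes>\<^bsub>R\<^esub> P"
    unfolding R.frobenius_add[OF p_prime charR add(1,2)] by (rule R.l_distr[OF cl(1,2) P])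
  then have "\<psi> ((A \<oplus>\<^bsub>R\<^esub> B) [^]\<^bsub>R\<^esub> p \<otimes>\<^bsub>R\<^esub> P) =
      \<psi> (A [^]\<^bsub>R\<^esub> p \<otimes>\<^bsub>R\<^esub> P) \<oplus>\<^bsub>R\<^esub> \<psi> (B [^]\<^bsub>R\<^esub> p \<otimes>\<^bsub>R\<^esub> P)"
    using lift_cartier_add cl P by simp
  also have "\<dots> = (A \<oplus>\<^bsub>R\<^esub> B) \<otimes>\<^bsub>R\<^esub> \<psi> P"
    unfolding add(3,4) by (rule R.l_distr[symmetric]) (use add cl in auto)
  finally show ?case .
qed

lemma lift_cartier_in_cartier_maps: "\<psi> \<in> cartier_maps R p"
  unfolding cartier_maps_def
  using lift_cartier_closed lift_cartier_add lift_cartier_pow_mult by auto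

lemma lift_cartier_mon:
  assumes "\<And>i. count \<beta> i < p"
  shows "\<psi> (mon L c (repeat_mset p m + \<beta>)) = (if \<alpha> = \<beta> then mon L (\<phi> c) m else \<zero>\<^bsub>R\<^esub>)"
  using cartier_L(2)[OF \<phi>]
  by (auto simp: lift_cartier_def mon_def R_simps repeat_mset_add_inject[OF \<alpha> assms]
      simp del: add_right_cancel)

end

lemma finite_residues: "finite {\<alpha>. set_mset \<alpha> \<subseteq> I \<and> (\<forall>i. count \<alpha> i < p)}"
proof (rule finite_subset[OF _ finite_subset_mset[of "repeat_mset p (mset_set I)"]])
  show "{\<alpha>. set_mset \<alpha> \<subseteq> I \<and> (\<forall>i. count \<alpha> i < p)} \<subseteq> {\<alpha>. \<alpha> \<subseteq># repeat_mset p (mset_set I)}"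
  proof clarify
    fix \<alpha> assume *: "set_mset \<alpha> \<subseteq> I" "\<forall>i. count \<alpha> i < p"
    show "\<alpha> \<subseteq># repeat_mset p (mset_set I)"
      unfolding subseteq_mset_def
    proof
      fix i
      show "count \<alpha> i \<le> count (repeat_mset p (mset_set I)) i"
      proof (cases "i \<in># \<alpha>")
        case True
        then have "i \<in> I" using * by blast
        then show ?thesis using * finite_I by (simp add: less_imp_le)
      qed (simp add: not_in_iff)
    qed
  qed
qed

text \<open>The monomials \<open>b j\<close> times \<open>x^\<alpha>\<close> form a basis over the
  \<open>p\<close>-th powers. The expansion of \<open>x\<close> in it has coordinates
  \<open>\<psi> x [^] p\<close> for Cartier maps \<open>\<psi>\<close>, so it lies in the ideal in
  question.\<close>

lemma cartier_reg:
  assumes x: "x \<in> carrier R"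
  shows "x \<in> Idl\<^bsub>R\<^esub> ((\<lambda>\<psi>. \<psi> x [^]\<^bsub>R\<^esub> p) ` cartier_maps R p)"
proof -
  obtain n b \<phi> where \<phi>: "\<And>j. j < n \<Longrightarrow> \<phi> j \<in> cartier_maps L p" and b: "\<And>j. j < n \<Longrightarrow> b j \<in> carrier L"
    and dual: "\<And>x. x \<in> carrier L \<Longrightarrow> x = (\<Oplus>j\<in>{..<n::nat}. \<phi> j x [^] p \<otimes> b j)"
    by (rule L.cartier_dual_basis[OF p_prime charL F_finite]) blast
  define A where "A = {\<alpha>. set_mset \<alpha> \<subseteq> I \<and> (\<forall>i. count \<alpha> i < p)}"
  have A: "finite A" "\<And>\<alpha>. \<alpha> \<in> A \<Longrightarrow> set_mset \<alpha> \<subseteq> I" "\<And>\<alpha> i. \<alpha> \<in> A \<Longrightarrow> count \<alpha> i < p"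
    using finite_residues by (auto simp: A_def)
  define t where "t P \<alpha> j = lift_cartier (\<phi> j) \<alpha> p P [^]\<^bsub>R\<^esub> p \<otimes>\<^bsub>R\<^esub> mon L (b j) \<alpha>" for P \<alpha> j
  have \<psi>: "lift_cartier (\<phi> j) \<alpha> p \<in> cartier_maps R p" if "\<alpha> \<in> A" "j < n" for \<alpha> j
    by (rule lift_cartier_in_cartier_maps[OF \<phi>[OF that(2)] A(3)[OF that(1)]])
  have bm: "mon L (b j) \<alpha> \<in> carrier R" if "\<alpha> \<in> A" "j < n" for \<alpha> j
    by (rule mon_in_carrier[OF b[OF that(2)] A(2)[OF that(1)]])
  have \<psi>c: "lift_cartier (\<phi> j) \<alpha> p P \<in> carrier R" if "\<alpha> \<in> A" "j < n" "P \<in> carrier R" for P \<alpha> j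
    by (rule lift_cartier_closed[OF \<phi>[OF that(2)] A(3)[OF that(1)] that(3)])
  have t: "t P \<alpha> j \<in> carrier R" if "\<alpha> \<in> A" "j < n" "P \<in> carrier R" for P \<alpha> j
    unfolding t_def using \<psi>c[OF that] bm[OF that(1,2)] by simp
  \<comment> \<open>\<open>F P\<close> is the basis expansion of \<open>P\<close>. It is additive in
    \<open>P\<close>, which reduces \<open>F x = x\<close> to monomials.\<close>
  define F where "F P = (\<Oplus>\<^bsub>R\<^esub>\<alpha>\<in>A. \<Oplus>\<^bsub>R\<^esub>j\<in>{..<n}. t P \<alpha> j)" for P
  have Fin: "(\<Oplus>\<^bsub>R\<^esub>j\<in>{..<n}. t P \<alpha> j) \<in> carrier R" if "\<alpha> \<in> A" "P \<in> carrier R" for P \<alpha>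
    using t that by (intro R.finsum_closed) auto
  have "F x = x"
    using x
  proof (induction x rule: mpoly_induct)
    case zero
    have "t \<zero>\<^bsub>R\<^esub> \<alpha> j = \<zero>\<^bsub>R\<^esub>" if "\<alpha> \<in> A" "j < n" for \<alpha> j
      unfolding t_def using R.cartier_maps_zero[OF \<psi>[OF that]] bm[OF that] p_pos
      by (simp add: R.nat_pow_zero)
    then have "(\<Oplus>\<^bsub>R\<^esub>j\<in>{..<n}. t \<zero>\<^bsub>R\<^esub> \<alpha> j) = \<zero>\<^bsub>R\<^esub>" if "\<alpha> \<in> A" for \<alpha>
      by (intro R.add.finprod_one_eqI) (use that in auto)
    then show ?case unfolding F_def by (rule R.add.finprod_one_eqI)
  next
    case (add P Q)
    have tPQ: "t (P \<oplus>\<^bsub>R\<^esub> Q) \<alpha> j = t P \<alpha> j \<oplus>\<^bsub>R\<^esub> t Q \<alpha> j" if "\<alpha> \<in> A" "j < n" for \<alpha> j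
    proof -
      have "lift_cartier (\<phi> j) \<alpha> p (P \<oplus>\<^bsub>R\<^esub> Q) = lift_cartier (\<phi> j) \<alpha> p P \<oplus>\<^bsub>R\<^esub> lift_cartier (\<phi> j) \<alpha> p Q"
        by (rule lift_cartier_add[OF \<phi>[OF that(2)] A(3)[OF that(1)] add(1,2)])
      then show ?thesis
        unfolding t_def using \<psi>c[OF that add(1)] \<psi>c[OF that add(2)] bm[OF that]
        by (simp add: R.frobenius_add[OF p_prime charR] R.l_distr)
    qed
    have inner: "(\<Oplus>\<^bsub>R\<^esub>j\<in>{..<n}. t (P \<oplus>\<^bsub>R\<^esub> Q) \<alpha> j) =
        (\<Oplus>\<^bsub>R\<^esub>j\<in>{..<n}. t P \<alpha> j) \<oplus>\<^bsub>R\<^esub> (\<Oplus>\<^bsub>R\<^esub>j\<in>{..<n}. t Q \<alpha> j)" if \<alpha>: "\<alpha> \<in> A" for \<alpha>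
    proof -
      have c: "t P \<alpha> \<in> {..<n} \<rightarrow> carrier R" "t Q \<alpha> \<in> {..<n} \<rightarrow> carrier R"
        using t[OF \<alpha> _ add(1)] t[OF \<alpha> _ add(2)] by auto
      have "(\<Oplus>\<^bsub>R\<^esub>j\<in>{..<n}. t (P \<oplus>\<^bsub>R\<^esub> Q) \<alpha> j) = (\<Oplus>\<^bsub>R\<^esub>j\<in>{..<n}. t P \<alpha> j \<oplus>\<^bsub>R\<^esub> t Q \<alpha> j)"
        by (rule R.add.finprod_cong'[OF refl]) (use c tPQ \<alpha> in auto)
      then show ?thesis unfolding R.finsum_addf[OF c] .
    qed
    have c: "(\<lambda>\<alpha>. \<Oplus>\<^bsub>R\<^esub>j\<in>{..<n}. t P \<alpha> j) \<in> A \<rightarrow> carrier R"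
      "(\<lambda>\<alpha>. \<Oplus>\<^bsub>R\<^esub>j\<in>{..<n}. t Q \<alpha> j) \<in> A \<rightarrow> carrier R"
      using Fin[OF _ add(1)] Fin[OF _ add(2)] by auto
    have "F (P \<oplus>\<^bsub>R\<^esub> Q) = (\<Oplus>\<^bsub>R\<^esub>\<alpha>\<in>A. (\<Oplus>\<^bsub>R\<^esub>j\<in>{..<n}. t P \<alpha> j) \<oplus>\<^bsub>R\<^esub> (\<Oplus>\<^bsub>R\<^esub>j\<in>{..<n}. t Q \<alpha> j))"
      unfolding F_def by (rule R.add.finprod_cong'[OF refl]) (use c inner in auto)
    then have "F (P \<oplus>\<^bsub>R\<^esub> Q) = F P \<oplus>\<^bsub>R\<^esub> F Q"
      unfolding F_def R.finsum_addf[OF c] .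
    then show ?case using add by simp
  next
    case (mon m)
    define c where "c = x m"
    have c: "c \<in> carrier L" using mon by (simp add: c_def)
    obtain k \<beta> where m: "m = repeat_mset p k + \<beta>" "\<And>i. count \<beta> i < p"
      using repeat_mset_add_div_exists[OF p_pos, of m] by blast
    have kI: "set_mset k \<subseteq> I" "set_mset \<beta> \<subseteq> I"
      using mon(3) in_repeat_mset[OF p_pos, of _ k] unfolding m(1) by fastforce+
    have \<beta>A: "\<beta> \<in> A" using m kI by (simp add: A_def)
    have tz: "t (mon L c m) \<alpha> j = (if \<alpha> = \<beta> then mon L (\<phi> j c [^] p \<otimes> b j) m else \<zero>\<^bsub>R\<^esub>)"
      if "\<alpha> \<in> A" "j < n" for \<alpha> j
    proof -
      have e: "lift_cartier (\<phi> j) \<alpha> p (mon L c m) = (if \<alpha> = \<beta> then mon L (\<phi> j c) k else \<zero>\<^bsub>R\<^esub>)"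
        unfolding m(1) by (rule lift_cartier_mon[OF \<phi>[OF that(2)] A(3)[OF that(1)] m(2)])
      have f: "\<phi> j c \<in> carrier L" by (rule cartier_L(1)[OF \<phi>[OF that(2)] c])
      show ?thesis
        unfolding t_def e using f bm[OF that] p_pos b[OF that(2)]
        by (simp add: mon_pow[OF f kI(1)] mon_mult_mon m(1) R.nat_pow_zero)
    qed
    \<comment> \<open>Only the residue \<open>\<beta>\<close> of the exponent \<open>m\<close>
      contributes, and there the dual basis of \<open>L\<close> reassembles the coefficient
      \<open>c\<close>.\<close>
    have "(\<Oplus>\<^bsub>R\<^esub>j\<in>{..<n}. t (mon L c m) \<alpha> j) = (if \<beta> = \<alpha> then mon L c m else \<zero>\<^bsub>R\<^esub>)" if \<alpha>: "\<alpha> \<in> A" for \<alpha>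
    proof (cases "\<alpha> = \<beta>")
      case True
      have cl: "(\<lambda>j. \<phi> j c [^] p \<otimes> b j) \<in> {..<n} \<rightarrow> carrier L"
        using cartier_L(1)[OF \<phi> c] b by auto
      have "(\<Oplus>\<^bsub>R\<^esub>j\<in>{..<n}. t (mon L c m) \<alpha> j) = (\<Oplus>\<^bsub>R\<^esub>j\<in>{..<n}. mon L (\<phi> j c [^] p \<otimes> b j) m)"
        by (rule R.add.finprod_cong'[OF refl]) (use tz[OF \<alpha>] True cl mon(3) in \<open>auto intro!: mon_in_carrier\<close>)
      also have "\<dots> = mon L c m"
        unfolding finsum_mon[OF finite_lessThan cl mon(3)] dual[OF c, symmetric] ..
      finally show ?thesis using True by simp
    next
      case False
      then have "(\<Oplus>\<^bsub>R\<^esub>j\<in>{..<n}. t (mon L c m) \<alpha> j) = \<zero>\<^bsub>R\<^esub>"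
        by (intro R.add.finprod_one_eqI) (use tz[OF \<alpha>] in auto)
      then show ?thesis using False by simp
    qed
    then have "F (mon L c m) = (\<Oplus>\<^bsub>R\<^esub>\<alpha>\<in>A. if \<beta> = \<alpha> then mon L c m else \<zero>\<^bsub>R\<^esub>)"
      unfolding F_def using mon_in_carrier[OF c mon(3)]
      by (intro R.add.finprod_cong') auto
    also have "\<dots> = mon L c m"
      by (rule R.add.finprod_singleton[OF \<beta>A A(1)]) (use mon_in_carrier[OF c mon(3)] in auto)
    finally show ?case unfolding c_def .
  qed
  moreover have "F x \<in> Idl\<^bsub>R\<^esub> ((\<lambda>\<psi>. \<psi> x [^]\<^bsub>R\<^esub> p) ` cartier_maps R p)"
  proof -
    have sub: "(\<lambda>\<psi>. \<psi> x [^]\<^bsub>R\<^esub> p) ` cartier_maps R p \<subseteq> carrier R"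
      using x by (auto simp: cartier_maps_def)
    note J = R.genideal_ideal[OF sub]
    have "t x \<alpha> j \<in> Idl\<^bsub>R\<^esub> ((\<lambda>\<psi>. \<psi> x [^]\<^bsub>R\<^esub> p) ` cartier_maps R p)" if "\<alpha> \<in> A" "j < n" for \<alpha> j
    proof -
      have "lift_cartier (\<phi> j) \<alpha> p x [^]\<^bsub>R\<^esub> p \<in> Idl\<^bsub>R\<^esub> ((\<lambda>\<psi>. \<psi> x [^]\<^bsub>R\<^esub> p) ` cartier_maps R p)"
        using R.genideal_self[OF sub] \<psi>[OF that] by blast
      then show ?thesis unfolding t_def by (rule ideal.I_r_closed[OF J _ bm[OF that]])
    qed
    then show ?thesis unfolding F_def using A(1) by (intro R.finsum_in_ideal[OF J]) auto
  qed
  ultimately show ?thesis by simp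
qed

text \<open>The expansion of \<open>\<one>\<close> in the dual basis has a nonzero coordinate
  \<open>\<phi> j \<one>\<close>; dividing \<open>\<phi> j\<close> by this constant keeps it a
  Cartier map.\<close>

lemma cartier_maps_one:
  obtains \<phi> where "\<phi> \<in> cartier_maps L p" "\<phi> \<one> = \<one>"
proof -
  obtain n b \<phi> where \<phi>: "\<And>j. j < n \<Longrightarrow> \<phi> j \<in> cartier_maps L p" and b: "\<And>j. j < n \<Longrightarrow> b j \<in> carrier L"
    and dual: "\<And>x. x \<in> carrier L \<Longrightarrow> x = (\<Oplus>j\<in>{..<n::nat}. \<phi> j x [^] p \<otimes> b j)"
    by (rule L.cartier_dual_basis[OF p_prime charL F_finite]) blast
  have "\<exists>j<n. \<phi> j \<one> \<noteq> \<zero>"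
  proof (rule ccontr)
    assume "\<not> ?thesis"
    then have "(\<Oplus>j\<in>{..<n}. \<phi> j \<one> [^] p \<otimes> b j) = \<zero>"
      using b p_pos by (intro L.add.finprod_one_eqI) (auto simp: L.nat_pow_zero)
    then show False using dual[OF L.one_closed] by simp
  qed
  then obtain j where j: "j < n" "\<phi> j \<one> \<noteq> \<zero>" by blast
  have cl: "\<phi> j \<one> \<in> carrier L" using cartier_L(1)[OF \<phi>[OF j(1)]] by simp
  then have u: "\<phi> j \<one> \<in> Units L" using j(2) L.field_Units by simp
  note f = cartier_L[OF \<phi>[OF j(1)]]
  have "(\<lambda>x. inv (\<phi> j \<one>) \<otimes> \<phi> j x) \<in> cartier_maps L p"
    unfolding cartier_maps_def using f(1,3,4) u
    by (auto simp: L.r_distr L.m_lcomm)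
  then show ?thesis using that[of "\<lambda>x. inv (\<phi> j \<one>) \<otimes> \<phi> j x"] u by simp
qed

lemma cartier_one: "\<exists>\<psi>\<in>cartier_maps R p. \<psi> \<one>\<^bsub>R\<^esub> = \<one>\<^bsub>R\<^esub>"
proof -
  obtain \<phi> where \<phi>: "\<phi> \<in> cartier_maps L p" "\<phi> \<one> = \<one>" by (rule cartier_maps_one)
  have "lift_cartier \<phi> {#} p \<one>\<^bsub>R\<^esub> = \<one>\<^bsub>R\<^esub>"
    using lift_cartier_mon[OF \<phi>(1), of "{#}" "{#}" \<one> "{#}"] p_pos \<phi>(2) by (simp add: R_simps)
  then show ?thesis
    by (rule bexI[OF _ lift_cartier_in_cartier_maps[OF \<phi>(1), of "{#}"]]) (use p_pos in simp)
qed

text \<open>The map \<open>\<psi>\<close> reads off the monomials whose exponent in the variable \<open>i\<close> is \<open>- 1\<close> modulo \<open>p\<close>,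
  so it kills all derivatives. By \<open>derivation_frobenius_defect\<close> both sides are then additive in \<open>P\<close>,
  and monomials suffice.\<close>

lemma cartier_pderiv:
  assumes i: "i \<in> I" and P: "P \<in> carrier R"
  shows "\<exists>\<psi>\<in>cartier_maps R p. \<psi> (P [^]\<^bsub>R\<^esub> (p - 1) \<otimes>\<^bsub>R\<^esub> pd i P) = pd i P"
proof -
  obtain \<phi> where \<phi>: "\<phi> \<in> cartier_maps L p" "\<phi> \<one> = \<one>" by (rule cartier_maps_one)
  define \<alpha> where "\<alpha> = replicate_mset (p - 1) i"
  have \<alpha>: "count \<alpha> j < p" for j using p_pos by (simp add: \<alpha>_def)
  define \<psi> where "\<psi> = lift_cartier \<phi> \<alpha> p"
  have \<psi>: "\<psi> \<in> cartier_maps R p" unfolding \<psi>_def by (rule lift_cartier_in_cartier_maps[OF \<phi>(1) \<alpha>])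
  note add_\<psi> = lift_cartier_add[OF \<phi>(1) \<alpha>, folded \<psi>_def]
  have \<phi>_pow: "\<phi> (c [^] p) = c" if "c \<in> carrier L" for c
    using cartier_L(4)[OF \<phi>(1) L.one_closed that] \<phi>(2) that by simp
  have \<psi>_deriv: "\<psi> (pd i u) = \<zero>\<^bsub>R\<^esub>" if u: "u \<in> carrier R" for u
  proof
    fix m
    \<comment> \<open>The coefficient of a derivative at an exponent read off by
      \<open>\<psi>\<close> carries this multiple of \<open>p\<close> as a factor and vanishes in
      \<open>L\<close>.\<close>
    have "Suc (count (repeat_mset p m + \<alpha>) i) = p * Suc (count m i)"
      using p_pos by (simp add: \<alpha>_def)
    then have "pd i u (repeat_mset p m + \<alpha>) = add_pow L (p * Suc (count m i)) (u (add_mset i (repeat_mset p m + \<alpha>)))"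
      unfolding mpoly_pderiv_def by (simp only:)
    also have "\<dots> = \<zero>" by (rule charL'[OF pset_finsupp(1)[OF u]])
    finally show "\<psi> (pd i u) m = \<zero>\<^bsub>R\<^esub> m"
      using cartier_L(2)[OF \<phi>(1)] by (simp add: \<psi>_def lift_cartier_def R_simps)
  qed
  have "\<psi> (P [^]\<^bsub>R\<^esub> (p - 1) \<otimes>\<^bsub>R\<^esub> pd i P) = pd i P"
    using P
  proof (induction P rule: mpoly_induct)
    case zero
    then show ?case using R.cartier_maps_zero[OF \<psi>] by (simp add: pderiv_zero)
  next
    case (mon m)
    define c where "c = P m"
    have c: "c \<in> carrier L" using mon by (simp add: c_def)
    show ?case
    proof (cases "i \<in># m")
      case False
      then show ?thesis
        unfolding c_def[symmetric] using c R.cartier_maps_zero[OF \<psi>] mon_in_carrier[OF c mon(3)]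
        by (simp add: pderiv_mon)
    next
      case True
      define k where "k = m - {#i#}"
      have m: "m = add_mset i k" using True by (simp add: k_def)
      define d where "d = add_pow L (count m i) c"
      have d: "d \<in> carrier L" using c by (simp add: d_def)
      have D: "pd i (mon L c m) = mon L d k" using True c by (simp add: pderiv_mon d_def k_def)
      \<comment> \<open>With \<open>m\<close> equal to \<open>k\<close> plus one more
        \<open>i\<close>, the product has exponent \<open>p k\<close> plus \<open>p - 1\<close>
        copies of \<open>i\<close>. This is the residue \<open>\<alpha>\<close>, and
        \<open>\<psi>\<close> returns the monomial with exponent \<open>k\<close>.\<close>
      have "repeat_mset (p - 1) m + k = repeat_mset p k + \<alpha>"
      proof (rule multiset_eqI)
        fix j
        obtain q where q: "p = Suc q" using p_pos by (cases p) auto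
        show "count (repeat_mset (p - 1) m + k) j = count (repeat_mset p k + \<alpha>) j"
          unfolding m \<alpha>_def q by simp
      qed
      moreover have "c [^] (p - 1) \<otimes> d = add_pow L (count m i) (c [^] p)"
      proof -
        have "c [^] (p - 1) \<otimes> c = c [^] p" using p_pos by (metis L.nat_pow_Suc Suc_pred')
        then show ?thesis unfolding d_def using c by (simp add: L.add_pow_rdistr)
      qed
      ultimately have "mon L c m [^]\<^bsub>R\<^esub> (p - 1) \<otimes>\<^bsub>R\<^esub> mon L d k =
          mon L (add_pow L (count m i) (c [^] p)) (repeat_mset p k + \<alpha>)"
        using c d mon(3) by (simp add: mon_pow mon_mult_mon)
      then have "\<psi> (mon L c m [^]\<^bsub>R\<^esub> (p - 1) \<otimes>\<^bsub>R\<^esub> mon L d k) = mon L (\<phi> (add_pow L (count m i) (c [^] p))) k"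
        unfolding \<psi>_def using lift_cartier_mon[OF \<phi>(1) \<alpha> \<alpha>] by simp
      \<comment> \<open>The integer factor from the derivative passes through \<open>\<phi>\<close>
        by additivity alone.\<close>
      moreover have "\<phi> (add_pow L (n::nat) (c [^] p)) = add_pow L n c" for n
        by (induction n) (use c cartier_L[OF \<phi>(1)] \<phi>_pow in auto)
      ultimately show ?thesis unfolding c_def[symmetric] D d_def by simp
    qed
  next
    case (add A B)
    obtain u where u: "u \<in> carrier R" "(A \<oplus>\<^bsub>R\<^esub> B) [^]\<^bsub>R\<^esub> (p - 1) \<otimes>\<^bsub>R\<^esub> pd i (A \<oplus>\<^bsub>R\<^esub> B) =
        A [^]\<^bsub>R\<^esub> (p - 1) \<otimes>\<^bsub>R\<^esub> pd i A \<oplus>\<^bsub>R\<^esub> B [^]\<^bsub>R\<^esub> (p - 1) \<otimes>\<^bsub>R\<^esub> pd i B \<oplus>\<^bsub>R\<^esub> pd i u"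
      by (rule R.derivation_frobenius_defect[OF pderiv_derivation p_prime add(1,2)])
    have cl: "A [^]\<^bsub>R\<^esub> (p - 1) \<otimes>\<^bsub>R\<^esub> pd i A \<in> carrier R" "B [^]\<^bsub>R\<^esub> (p - 1) \<otimes>\<^bsub>R\<^esub> pd i B \<in> carrier R"
      "pd i A \<in> carrier R" "pd i B \<in> carrier R" "pd i u \<in> carrier R"
      using add u by (auto simp: pderiv_in_carrier)
    have "\<psi> ((A \<oplus>\<^bsub>R\<^esub> B) [^]\<^bsub>R\<^esub> (p - 1) \<otimes>\<^bsub>R\<^esub> pd i (A \<oplus>\<^bsub>R\<^esub> B)) = pd i A \<oplus>\<^bsub>R\<^esub> pd i B \<oplus>\<^bsub>R\<^esub> \<zero>\<^bsub>R\<^esub>"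
      unfolding u(2) using cl by (simp only: add_\<psi> R.a_closed add(3,4) \<psi>_deriv[OF u(1)])
    then show ?case using cl by (simp add: pderiv_add[OF add(1,2)])
  qed
  then show ?thesis using \<psi> by blast
qed

end

section \<open>Monomial ideals\<close>

context mpoly
begin

lemma mono_ideal_ideal:
  assumes up: "\<And>m k. m \<in> W \<Longrightarrow> m + k \<in> W"
  shows "ideal (mono_ideal L I W) R"
proof (rule R.ideal_intro)
  show "mono_ideal L I W \<subseteq> carrier R" by (auto simp: mono_ideal_def)
  show "\<zero>\<^bsub>R\<^esub> \<in> mono_ideal L I W" using zero_in_carrier by (simp add: mono_ideal_def R_simps)
  show add: "P \<oplus>\<^bsub>R\<^esub> Q \<in> mono_ideal L I W" if "P \<in> mono_ideal L I W" "Q \<in> mono_ideal L I W" for P Q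
  proof -
    have "m \<in> W" if nz: "(P \<oplus>\<^bsub>R\<^esub> Q) m \<noteq> \<zero>" for m
    proof -
      have "P m \<noteq> \<zero> \<or> Q m \<noteq> \<zero>" using nz by (auto simp: R_simps)
      then show ?thesis using \<open>P \<in> _\<close> \<open>Q \<in> _\<close> by (auto simp: mono_ideal_def)
    qed
    then show ?thesis using that padd_in_carrier by (simp add: mono_ideal_def)
  qed
  show "P \<otimes>\<^bsub>R\<^esub> Q \<in> mono_ideal L I W" if "P \<in> carrier R" "Q \<in> mono_ideal L I W" for P Q
    using that(1)
  proof (induction P rule: mpoly_induct)
    have Q: "Q \<in> carrier R" using that(2) by (simp add: mono_ideal_def)
    case zero
    then show ?case using Q \<open>\<zero>\<^bsub>R\<^esub> \<in> mono_ideal L I W\<close> by simp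
  next
    case (mon m)
    have Q: "Q \<in> carrier R" using that(2) by (simp add: mono_ideal_def)
    have "k \<in> W" if nz: "(mon L (P m) m \<otimes>\<^bsub>R\<^esub> Q) k \<noteq> \<zero>" for k
    proof -
      have k: "m \<subseteq># k" "Q (k - m) \<noteq> \<zero>"
        using nz mon(2) unfolding mon_mult_coeff[OF mon(2) Q] by (auto split: if_splits)
      then have "k - m \<in> W" using \<open>Q \<in> mono_ideal L I W\<close> by (simp add: mono_ideal_def)
      then have "(k - m) + m \<in> W" by (rule up)
      then show ?thesis using k(1) by simp
    qed
    then show ?case using mult_in_carrier[OF mon_in_carrier[OF mon(2,3)] Q] by (simp add: mono_ideal_def)
  next
    case (add A B)
    have Q: "Q \<in> carrier R" using that(2) by (simp add: mono_ideal_def)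
    show ?case unfolding R.l_distr[OF add(1,2) Q] by (rule \<open>\<And>Q P. P \<in> _ \<Longrightarrow> Q \<in> _ \<Longrightarrow> P \<oplus>\<^bsub>R\<^esub> Q \<in> _\<close>[OF add(3,4)])
  qed
qed

lemma mono_ideal_subset:
  assumes K: "ideal K R"
    and mon: "\<And>c m. c \<in> carrier L \<Longrightarrow> set_mset m \<subseteq> I \<Longrightarrow> m \<in> W \<Longrightarrow> mon L c m \<in> K"
  shows "mono_ideal L I W \<subseteq> K"
proof
  fix P assume P: "P \<in> mono_ideal L I W"
  then have "P \<in> carrier R" by (simp add: mono_ideal_def)
  then show "P \<in> K"
  proof (induction P rule: mpoly_induct)
    case zero
    show ?case by (rule R.ideal_zero[OF K])
  next
    case (mon m)
    then show ?case using P by (intro assms(2)) (auto simp: mono_ideal_def)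
  next
    case (add A B)
    show ?case by (rule R.ideal_add[OF K add(3,4)])
  qed
qed

lemma mon_in_mono_ideal:
  assumes "c \<in> carrier L" "set_mset m \<subseteq> I" "m \<in> W"
  shows "mon L c m \<in> mono_ideal L I W"
  using assms mon_in_carrier by (auto simp: mono_ideal_def mon_def)

lemma mon_factor:
  assumes "c \<in> carrier L" "set_mset m \<subseteq> I" "k \<subseteq># m"
  shows "mon L c m = mon L \<one> k \<otimes>\<^bsub>R\<^esub> mon L c (m - k)"
  using assms by (simp add: mon_mult_mon)

lemma mon_factor_power:
  assumes "c \<in> carrier L" "set_mset m \<subseteq> I" "k \<le> count m i" "i \<in> I"
  shows "mon L c m = mon L \<one> {#i#} [^]\<^bsub>R\<^esub> k \<otimes>\<^bsub>R\<^esub> mon L c (m - replicate_mset k i)"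
proof -
  have "replicate_mset k i \<subseteq># m" using assms(3) by (simp add: count_le_replicate_mset_subset_eq)
  moreover have "repeat_mset k {#i#} = replicate_mset k i" by (rule multiset_eqI) simp
  ultimately show ?thesis using mon_factor[OF assms(1,2)] assms(4) by (simp add: mon_pow)
qed

lemma var_eq_mon: "L.indexed_var i = mon L \<one> {#i#}"
proof
  fix k
  show "L.indexed_var i k = mon L \<one> {#i#} k"
    by (cases "i \<in># k")
      (auto simp: L.indexed_var_def L.indexed_pmult_def L.indexed_const_def mon_def dest: multi_member_split)
qed

abbreviation var_ideal where "var_ideal B \<equiv> mono_ideal L I {m. \<exists>i\<in>B. i \<in># m}"
abbreviation deg_ideal where "deg_ideal k \<equiv> mono_ideal L I {m. k \<le> size m}"

lemma var_ideal_ideal: "ideal (var_ideal B) R"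
  by (rule mono_ideal_ideal) auto

lemma deg_ideal_ideal: "ideal (deg_ideal k) R"
  by (rule mono_ideal_ideal) auto

lemma Idl_vars: "Idl\<^bsub>R\<^esub> (L.indexed_var ` I) = var_ideal I"
proof
  have vars: "L.indexed_var ` I \<subseteq> var_ideal I"
    unfolding var_eq_mon using mon_in_mono_ideal[of \<one> "{#_#}"] by auto
  then show "Idl\<^bsub>R\<^esub> (L.indexed_var ` I) \<subseteq> var_ideal I" by (rule R.genideal_minimal[OF var_ideal_ideal])
  have sub: "L.indexed_var ` I \<subseteq> carrier R" using vars by (auto simp: mono_ideal_def)
  show "var_ideal I \<subseteq> Idl\<^bsub>R\<^esub> (L.indexed_var ` I)"
  proof (rule mono_ideal_subset[OF R.genideal_ideal[OF sub]])
    fix c m assume c: "c \<in> carrier L" and m: "set_mset m \<subseteq> I" and "m \<in> {m. \<exists>i\<in>I. i \<in># m}"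
    then obtain i where i: "i \<in> I" "i \<in># m" by blast
    have "mon L \<one> {#i#} \<in> Idl\<^bsub>R\<^esub> (L.indexed_var ` I)"
      using R.genideal_self[OF sub] i(1) unfolding var_eq_mon by blast
    moreover have "mon L c (m - {#i#}) \<in> carrier R"
      using m by (intro mon_in_carrier c) (meson in_diffD subset_iff)
    ultimately show "mon L c m \<in> Idl\<^bsub>R\<^esub> (L.indexed_var ` I)"
      unfolding mon_factor[OF c m, of "{#i#}", simplified, OF i(2)]
      by (rule ideal.I_r_closed[OF R.genideal_ideal[OF sub]])
  qed
qed

lemma deg_ideal_mult:
  assumes "P \<in> deg_ideal a" "Q \<in> deg_ideal b"
  shows "P \<otimes>\<^bsub>R\<^esub> Q \<in> deg_ideal (a + b)"
proof -
  have P: "P \<in> carrier R" and Q: "Q \<in> carrier R" using assms by (auto simp: mono_ideal_def)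
  show ?thesis
    using P
  proof (induction P rule: mpoly_induct)
    case zero
    show ?case using Q additive_subgroup.zero_closed[OF ideal.axioms(1)[OF deg_ideal_ideal]] by simp
  next
    case (mon m)
    have am: "a \<le> size m" using mon(1) assms(1) by (simp add: mono_ideal_def)
    have "a + b \<le> size k" if nz: "(mon L (P m) m \<otimes>\<^bsub>R\<^esub> Q) k \<noteq> \<zero>" for k
    proof -
      have k: "m \<subseteq># k" "Q (k - m) \<noteq> \<zero>"
        using nz mon(2) unfolding mon_mult_coeff[OF mon(2) Q] by (auto split: if_splits)
      then have "b \<le> size (k - m)" using assms(2) by (simp add: mono_ideal_def)
      then show ?thesis using am k(1) size_mset_mono[OF k(1)] by (simp add: size_Diff_submset)
    qed
    then show ?case using mult_in_carrier[OF mon_in_carrier[OF mon(2,3)] Q] by (simp add: mono_ideal_def)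
  next
    case (add A B)
    show ?case unfolding R.l_distr[OF add(1,2) Q]
      by (rule additive_subgroup.a_closed[OF ideal.axioms(1)[OF deg_ideal_ideal] add(3,4)])
  qed
qed

lemma var_ideal_power_subset:
  "var_ideal I [^]\<^bsub>ideals_set R\<^esub> (N::nat) \<subseteq> deg_ideal N"
proof (induction N)
  case 0
  then show ?case by (auto simp: ideals_set_def mono_ideal_def)
next
  case (Suc N)
  have "m = {#} \<Longrightarrow> \<not> (\<exists>i\<in>I. i \<in># m)" for m by simp
  then have V: "var_ideal I \<subseteq> deg_ideal 1"
    by (auto simp: mono_ideal_def Suc_le_eq nonempty_has_size[symmetric])
  have "x \<in> deg_ideal (Suc N)" if "x \<in> ideal_prod R (var_ideal I [^]\<^bsub>ideals_set R\<^esub> N) (var_ideal I)" for x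
    using that
  proof (induction rule: ideal_prod.induct)
    case (prod i j)
    then show ?case using deg_ideal_mult[of i N j 1] Suc V by auto
  next
    case (sum s1 s2)
    show ?case by (rule additive_subgroup.a_closed[OF ideal.axioms(1)[OF deg_ideal_ideal] sum(3,4)])
  qed
  then show ?case by (auto simp: ideals_set_def)
qed

lemma pigeonhole_multiset:
  assumes "finite I" "I \<noteq> {}" "set_mset m \<subseteq> I" "card I * k \<le> size m" "0 < k"
  shows "\<exists>i\<in>I. k \<le> count m i"
proof (rule ccontr)
  assume *: "\<not> ?thesis"
  have "size m = (\<Sum>i\<in>set_mset m. count m i)" by (rule size_multiset_overloaded_eq)
  also have "\<dots> \<le> (\<Sum>i\<in>I. count m i)" using assms by (intro sum_mono2) auto
  also have "\<dots> < (\<Sum>i\<in>I. k)" using * assms by (intro sum_strict_mono) (auto simp: not_le)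
  also have "\<dots> = card I * k" by simp
  finally show False using assms(4) by simp
qed

text \<open>A monomial of degree at least \<open>N\<close> has some exponent of size at least
  \<open>k * p ^ e\<close> and is a multiple of the \<open>p ^ e\<close>-th power of the
  \<open>k\<close>-th power of that variable. The pigeonhole principle costs the factor
  \<open>card I\<close>, which is the dimension in the theorem.\<close>

lemma deg_ideal_frob_power:
  assumes "finite I" "I \<noteq> {}" "0 < k" "0 < p" and N: "card I * (k * p ^ e) \<le> N"
  shows "deg_ideal N \<subseteq> frob_power R p e (deg_ideal k)"
proof -
  have sub: "(\<lambda>a. a [^]\<^bsub>R\<^esub> (p ^ e)) ` deg_ideal k \<subseteq> carrier R" by (auto simp: mono_ideal_def)
  show ?thesis unfolding frob_power_def
  proof (rule mono_ideal_subset[OF R.genideal_ideal[OF sub]])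
    fix c m assume c: "c \<in> carrier L" and m: "set_mset m \<subseteq> I" and "m \<in> {m. N \<le> size m}"
    then obtain i where i: "i \<in> I" "k * p ^ e \<le> count m i"
      using pigeonhole_multiset[OF assms(1,2) m, of "k * p ^ e"] assms(3,4) N by auto
    let ?X = "mon L \<one> {#i#}"
    have Xc: "?X \<in> carrier R" using i by (simp add: mon_in_carrier)
    have "?X [^]\<^bsub>R\<^esub> k \<in> deg_ideal k"
      using i by (subst mon_pow) (auto intro!: mon_in_mono_ideal simp: size_repeat_mset split: if_splits)
    then have "(?X [^]\<^bsub>R\<^esub> k) [^]\<^bsub>R\<^esub> (p ^ e) \<in> Idl\<^bsub>R\<^esub> ((\<lambda>a. a [^]\<^bsub>R\<^esub> (p ^ e)) ` deg_ideal k)"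
      using R.genideal_self[OF sub] by blast
    then have "?X [^]\<^bsub>R\<^esub> (k * p ^ e) \<in> Idl\<^bsub>R\<^esub> ((\<lambda>a. a [^]\<^bsub>R\<^esub> (p ^ e)) ` deg_ideal k)"
      unfolding R.nat_pow_pow[OF Xc] .
    moreover have "mon L c (m - replicate_mset (k * p ^ e) i) \<in> carrier R"
      using m by (intro mon_in_carrier c) (meson in_diffD subset_iff)
    ultimately show "mon L c m \<in> Idl\<^bsub>R\<^esub> ((\<lambda>a. a [^]\<^bsub>R\<^esub> (p ^ e)) ` deg_ideal k)"
      unfolding mon_factor_power[OF c m i(2,1)] by (rule ideal.I_r_closed[OF R.genideal_ideal[OF sub]])
  qed
qed

text \<open>Some power of each variable lies in \<open>J\<close>, and a monomial of large degree is
  divisible by one of these powers. The resulting \<open>K\<close> is uncontrolled; it only lets the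
  iteration of \<open>deg_ideal_subset_of_step\<close> stop.\<close>

lemma deg_ideal_subset_of_radical:
  assumes "finite I" "I \<noteq> {}" and J: "ideal J R" and rad: "var_ideal I \<subseteq> radical R J"
  shows "\<exists>K. deg_ideal K \<subseteq> J"
proof -
  have "\<exists>k::nat. mon L \<one> {#i#} [^]\<^bsub>R\<^esub> k \<in> J" if "i \<in> I" for i
    using rad mon_in_mono_ideal[of \<one> "{#i#}" "{m. \<exists>i\<in>I. i \<in># m}"] that by (auto simp: radical_def)
  then obtain k :: "'c \<Rightarrow> nat" where k: "\<And>i. i \<in> I \<Longrightarrow> mon L \<one> {#i#} [^]\<^bsub>R\<^esub> k i \<in> J" by metis
  define K where "K = Suc (Max (k ` I))"
  have kK: "k i \<le> K" if "i \<in> I" for i using that assms(1) by (auto simp: K_def le_SucI)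
  have "deg_ideal (card I * K) \<subseteq> J"
  proof (rule mono_ideal_subset[OF J])
    fix c m assume c: "c \<in> carrier L" and m: "set_mset m \<subseteq> I" and "m \<in> {m. card I * K \<le> size m}"
    then obtain i where i: "i \<in> I" "K \<le> count m i"
      using pigeonhole_multiset[OF assms(1,2) m, of K] by (auto simp: K_def)
    have ki: "k i \<le> count m i" using kK[OF i(1)] i(2) by simp
    have "mon L c (m - replicate_mset (k i) i) \<in> carrier R"
      using m by (intro mon_in_carrier c) (meson in_diffD subset_iff)
    then show "mon L c m \<in> J"
      unfolding mon_factor_power[OF c m ki i(1)] by (rule ideal.I_r_closed[OF J k[OF i(1)]])
  qed
  then show ?thesis by blast
qed

lemma sum_deg_ideal:
  assumes J: "ideal J R"
  shows "ideal (J <+>\<^bsub>R\<^esub> deg_ideal j) R"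
    and "J \<subseteq> J <+>\<^bsub>R\<^esub> deg_ideal j" and "deg_ideal j \<subseteq> J <+>\<^bsub>R\<^esub> deg_ideal j"
  using R.add_ideals[OF J deg_ideal_ideal, of j] R.union_genideal[OF J deg_ideal_ideal, of j]
    R.genideal_self[of "J \<union> deg_ideal j"] ideal.Icarr[OF J]
  by (auto simp: mono_ideal_def subset_iff)

text \<open>Nakayama's lemma for a nilpotent ideal of the quotient by \<open>J\<close>. Multiplying
  the hypothesis by monomials of degree \<open>j - k\<close> gives the same inclusion at every
  degree \<open>j\<close> from \<open>k\<close> on, and the chain of inclusions runs until degree
  \<open>K\<close>.\<close>

lemma deg_ideal_subset_of_step:
  assumes J: "ideal J R" and K: "deg_ideal K \<subseteq> J"
    and step: "deg_ideal k \<subseteq> J <+>\<^bsub>R\<^esub> deg_ideal (Suc k)"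
  shows "deg_ideal k \<subseteq> J"
proof -
  note JD = sum_deg_ideal(1)[OF J] and mem = sum_deg_ideal(2,3)[OF J]
  have "deg_ideal k \<subseteq> J <+>\<^bsub>R\<^esub> deg_ideal j" if "k \<le> j" for j
    using that
  proof (induction j rule: dec_induct)
    case base
    show ?case by (rule mem)
  next
    case (step j)
    have "deg_ideal j \<subseteq> J <+>\<^bsub>R\<^esub> deg_ideal (Suc j)"
    proof (rule mono_ideal_subset[OF JD])
      fix c m assume c: "c \<in> carrier L" and m: "set_mset m \<subseteq> I" and "m \<in> {m. j \<le> size m}"
      then have jm: "j \<le> size m" by simp
      \<comment> \<open>An arbitrary ordering of the variables of \<open>m\<close> yields a factor
        \<open>b\<close> of degree exactly \<open>k\<close>, to which the hypothesis
        applies.\<close>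
      obtain xs where xs: "mset xs = m" using ex_mset by blast
      define a b where "a = mset (drop k xs)" and "b = mset (take k xs)"
      have ab: "m = b + a" unfolding a_def b_def xs[symmetric] mset_append[symmetric] by simp
      have sz: "size b = k" "size a = size m - k"
        using jm step.hyps xs by (auto simp: a_def b_def)
      have abI: "set_mset a \<subseteq> I" "set_mset b \<subseteq> I" using m by (auto simp: ab)
      have "mon L \<one> b \<in> deg_ideal k" using abI sz by (intro mon_in_mono_ideal) auto
      then obtain u v where uv: "u \<in> J" "v \<in> deg_ideal (Suc k)" "mon L \<one> b = u \<oplus>\<^bsub>R\<^esub> v"
        using assms(3) unfolding set_add_def' by blast
      have uvc: "u \<in> carrier R" "v \<in> carrier R" "mon L c a \<in> carrier R"
        using uv ideal.Icarr[OF J] abI c by (auto simp: mono_ideal_def mon_in_carrier)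
      have "mon L c m = mon L c a \<otimes>\<^bsub>R\<^esub> mon L \<one> b" using c by (simp add: mon_mult_mon ab add.commute)
      then have e: "mon L c m = mon L c a \<otimes>\<^bsub>R\<^esub> u \<oplus>\<^bsub>R\<^esub> mon L c a \<otimes>\<^bsub>R\<^esub> v"
        unfolding uv(3) using uvc by (simp add: R.r_distr)
      have 1: "mon L c a \<otimes>\<^bsub>R\<^esub> u \<in> J" by (rule ideal.I_l_closed[OF J uv(1) uvc(3)])
      have "mon L c a \<in> deg_ideal (size a)" using abI c by (intro mon_in_mono_ideal) auto
      then have "mon L c a \<otimes>\<^bsub>R\<^esub> v \<in> deg_ideal (size a + Suc k)" by (rule deg_ideal_mult[OF _ uv(2)])
      then have 2: "mon L c a \<otimes>\<^bsub>R\<^esub> v \<in> deg_ideal (Suc j)"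
        using sz jm step.hyps by (auto simp: mono_ideal_def)
      show "mon L c m \<in> J <+>\<^bsub>R\<^esub> deg_ideal (Suc j)"
        unfolding e using 1 2 unfolding set_add_def' by blast
    qed
    moreover have "J <+>\<^bsub>R\<^esub> deg_ideal j \<subseteq> J <+>\<^bsub>R\<^esub> deg_ideal (Suc j)"
      if "deg_ideal j \<subseteq> J <+>\<^bsub>R\<^esub> deg_ideal (Suc j)"
      unfolding R.union_genideal[OF J deg_ideal_ideal, of j, symmetric]
      by (rule R.genideal_minimal[OF JD]) (use that mem in blast)
    ultimately show ?case using step.IH by blast
  qed
  \<comment> \<open>From degree \<open>K\<close> on the second summand is absorbed by
    \<open>J\<close>.\<close>
  from this[of "max k K"] have "deg_ideal k \<subseteq> J <+>\<^bsub>R\<^esub> deg_ideal (max k K)" by simp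
  also have "\<dots> \<subseteq> J <+>\<^bsub>R\<^esub> J"
    using K by (auto simp: set_add_def' mono_ideal_def)
  also have "\<dots> \<subseteq> J" using R.ideal_add[OF J] by (auto simp: set_add_def')
  finally show ?thesis .
qed

text \<open>If the claim fails, no two neighbours among the ideals \<open>J <+> deg_ideal k\<close>
  with \<open>k \<le> Suc l\<close> coincide: a coincidence at some \<open>k \<le> l\<close> would
  put \<open>deg_ideal k\<close>, and with it \<open>deg_ideal l\<close>, into \<open>J\<close>.
  This makes a chain with \<open>Suc l\<close> strict steps.\<close>

lemma deg_ideal_length_subset:
  assumes J: "ideal J R" and K: "deg_ideal K \<subseteq> J"
    and bound: "\<And>N k. (\<And>i. i \<le> k \<Longrightarrow> ideal (N i) R \<and> J \<subseteq> N i) \<Longrightarrow>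
      (\<And>i. i < k \<Longrightarrow> N i \<subset> N (Suc i)) \<Longrightarrow> k \<le> l"
  shows "deg_ideal l \<subseteq> J"
proof (rule ccontr)
  assume n: "\<not> deg_ideal l \<subseteq> J"
  \<comment> \<open>The index is reversed to make the chain ascend: it starts at degree
    \<open>Suc l\<close> and ends at degree 0, the whole ring.\<close>
  define N where "N i = J <+>\<^bsub>R\<^esub> deg_ideal (Suc l - i)" for i
  note JD = sum_deg_ideal(1)[OF J] and mem = sum_deg_ideal(2,3)[OF J]
  have "Suc l \<le> l"
  proof (rule bound)
    fix i assume "i \<le> Suc l"
    show "ideal (N i) R \<and> J \<subseteq> N i" unfolding N_def using JD mem by blast
  next
    fix i assume i: "i < Suc l"
    define k where "k = l - i"
    have k: "Suc l - i = Suc k" "Suc l - Suc i = k" using i by (auto simp: k_def)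
    have sub: "deg_ideal (Suc k) \<subseteq> deg_ideal k" by (auto simp: mono_ideal_def)
    have "J <+>\<^bsub>R\<^esub> deg_ideal (Suc k) \<subseteq> J <+>\<^bsub>R\<^esub> deg_ideal k"
      using sub by (auto simp: set_add_def')
    moreover have "J <+>\<^bsub>R\<^esub> deg_ideal (Suc k) \<noteq> J <+>\<^bsub>R\<^esub> deg_ideal k"
    proof
      assume "J <+>\<^bsub>R\<^esub> deg_ideal (Suc k) = J <+>\<^bsub>R\<^esub> deg_ideal k"
      then have "deg_ideal k \<subseteq> J" using deg_ideal_subset_of_step[OF J K, of k] mem by blast
      moreover have "deg_ideal l \<subseteq> deg_ideal k" by (auto simp: mono_ideal_def k_def)
      ultimately show False using n by blast
    qed
    ultimately show "N i \<subset> N (Suc i)" unfolding N_def k by blast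
  qed
  then show False by simp
qed

text \<open>One variable is split off from each monomial. The additional degree pays for the factor
  from the maximal ideal that Nakayama's lemma requires, and is the origin of \<open>l + 1\<close>
  as a linear factor of \<open>N\<close>.\<close>

lemma deg_ideal_Suc_subset:
  assumes J: "J \<subseteq> carrier R" and l: "deg_ideal l \<subseteq> J"
  shows "deg_ideal (Suc l) \<subseteq> Idl\<^bsub>R\<^esub> {x \<otimes>\<^bsub>R\<^esub> y | x y. x \<in> var_ideal I \<and> y \<in> J}"
proof -
  have sub: "{x \<otimes>\<^bsub>R\<^esub> y | x y. x \<in> var_ideal I \<and> y \<in> J} \<subseteq> carrier R"
    using J by (auto simp: mono_ideal_def)
  show ?thesis
  proof (rule mono_ideal_subset[OF R.genideal_ideal[OF sub]])
    fix c m assume c: "c \<in> carrier L" and m: "set_mset m \<subseteq> I" and "m \<in> {m. Suc l \<le> size m}"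
    then have sz: "Suc l \<le> size m" by simp
    then obtain i where i: "i \<in># m" by (metis Suc_le_D size_eq_Suc_imp_elem)
    then have iI: "i \<in> I" using m by blast
    have "mon L \<one> {#i#} \<in> var_ideal I" using iI by (intro mon_in_mono_ideal) auto
    moreover have "mon L c (m - {#i#}) \<in> deg_ideal l"
    proof (rule mon_in_mono_ideal[OF c])
      show "set_mset (m - {#i#}) \<subseteq> I" using m by (meson in_diffD subset_iff)
      show "m - {#i#} \<in> {m. l \<le> size m}" using sz i by (simp add: size_Diff_singleton)
    qed
    ultimately have "mon L \<one> {#i#} \<otimes>\<^bsub>R\<^esub> mon L c (m - {#i#}) \<in> {x \<otimes>\<^bsub>R\<^esub> y | x y. x \<in> var_ideal I \<and> y \<in> J}"
      using l by blast
    then show "mon L c m \<in> Idl\<^bsub>R\<^esub> {x \<otimes>\<^bsub>R\<^esub> y | x y. x \<in> var_ideal I \<and> y \<in> J}"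
      unfolding mon_factor[OF c m, of "{#i#}", simplified, OF i] using R.genideal_self[OF sub] by blast
  qed
qed

end

section \<open>Prime ideals generated by variables, and the Krull dimension\<close>

text \<open>Among the monomials without variables from \<open>B\<close>, each factor outside the
  ideal has a greatest one in the multiset order. This order is total and compatible with addition,
  so the product of the two leading terms cannot cancel in the product of the factors.\<close>

lemma var_ideal_prime:
  fixes L :: "('a, 'b) ring_scheme" and I :: "('c :: linorder) set"
  assumes L: "field L" and B: "B \<subseteq> I"
  shows "primeideal (mono_ideal L I {m. \<exists>i\<in>B. i \<in># m}) (mpoly_ring L I)"
proof -
  interpret mpoly L I by (rule mpoly.intro[OF L])
  have one: "\<one>\<^bsub>R\<^esub> \<notin> var_ideal B" by (auto simp: mono_ideal_def R_simps mon_def)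
  have top: "\<exists>m. P m \<noteq> \<zero>\<^bsub>L\<^esub> \<and> B \<inter> set_mset m = {} \<and>
      (\<forall>k. P k \<noteq> \<zero>\<^bsub>L\<^esub> \<longrightarrow> B \<inter> set_mset k = {} \<longrightarrow> k \<le> m)"
    if P: "P \<in> carrier R" "P \<notin> var_ideal B" for P
  proof -
    define S where "S = {m. P m \<noteq> \<zero>\<^bsub>L\<^esub> \<and> B \<inter> set_mset m = {}}"
    have S: "finite S" unfolding S_def by (rule finite_subset[OF _ pset_finsupp(2)[OF P(1)]]) auto
    have ne: "S \<noteq> {}" using P by (auto simp: S_def mono_ideal_def)
    have "Max S \<in> S" "\<And>k. k \<in> S \<Longrightarrow> k \<le> Max S" using S ne by auto
    then show ?thesis unfolding S_def by blast
  qed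
  show ?thesis
  proof (rule primeidealI[OF var_ideal_ideal R_cring])
    show "carrier R \<noteq> var_ideal B" using one R.one_closed by blast
    fix P Q assume P: "P \<in> carrier R" and Q: "Q \<in> carrier R" and PQ: "P \<otimes>\<^bsub>R\<^esub> Q \<in> var_ideal B"
    show "P \<in> var_ideal B \<or> Q \<in> var_ideal B"
    proof (rule ccontr)
      assume n: "\<not> ?thesis"
      obtain m where m: "P m \<noteq> \<zero>\<^bsub>L\<^esub>" "B \<inter> set_mset m = {}"
        "\<And>k. P k \<noteq> \<zero>\<^bsub>L\<^esub> \<Longrightarrow> B \<inter> set_mset k = {} \<Longrightarrow> k \<le> m" using top[OF P] n by blast
      obtain k where k: "Q k \<noteq> \<zero>\<^bsub>L\<^esub>" "B \<inter> set_mset k = {}"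
        "\<And>m. Q m \<noteq> \<zero>\<^bsub>L\<^esub> \<Longrightarrow> B \<inter> set_mset m = {} \<Longrightarrow> m \<le> k" using top[OF Q] n by blast
      note Pf = pset_finsupp(1)[OF P] and Qf = pset_finsupp(1)[OF Q]
      have z: "P a = \<zero>\<^bsub>L\<^esub> \<or> Q b = \<zero>\<^bsub>L\<^esub>" if "a + b = m + k" "(a, b) \<noteq> (m, k)" for a b
      proof (rule ccontr)
        assume nz: "\<not> ?thesis"
        have "set_mset a \<union> set_mset b = set_mset m \<union> set_mset k" by (metis that(1) set_mset_union)
        then have "B \<inter> set_mset a = {}" "B \<inter> set_mset b = {}" using m(2) k(2) by blast+
        then have ab: "a \<le> m" "b \<le> k" using m(3) k(3) nz by auto
        show False
        proof (cases "a = m")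
          case True
          then show ?thesis using that by simp
        next
          case False
          then have "a < m" using ab by simp
          then have "a + b < m + k" using ab(2) by (rule add_less_le_mono)
          then show ?thesis using that(1) by simp
        qed
      qed
      have "(P \<otimes>\<^bsub>R\<^esub> Q) (m + k) =
          (\<Oplus>\<^bsub>L\<^esub>ab\<in>{(a, b). a + b = m + k}. if (m, k) = ab then P m \<otimes>\<^bsub>L\<^esub> Q k else \<zero>\<^bsub>L\<^esub>)"
        unfolding R_simps mpoly_mult_def
      proof (rule L.add.finprod_cong'[OF refl])
        fix ab assume ab: "ab \<in> {(a, b). a + b = m + k}"
        obtain a b where e: "ab = (a, b)" by (cases ab)
        show "P (fst ab) \<otimes>\<^bsub>L\<^esub> Q (snd ab) = (if (m, k) = ab then P m \<otimes>\<^bsub>L\<^esub> Q k else \<zero>\<^bsub>L\<^esub>)"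
          using z[of a b] ab Pf Qf unfolding e by auto
      qed (use Pf Qf in auto)
      also have "\<dots> = P m \<otimes>\<^bsub>L\<^esub> Q k"
        by (rule L.add.finprod_singleton) (use Pf Qf finite_decomp in auto)
      finally have "(P \<otimes>\<^bsub>R\<^esub> Q) (m + k) \<noteq> \<zero>\<^bsub>L\<^esub>"
        using L.integral[OF _ Pf Qf, of m k] m(1) k(1) by auto
      then have "\<exists>i\<in>B. i \<in># m + k" using PQ unfolding mono_ideal_def by blast
      then show False using m(2) k(2) by auto
    qed
  qed
qed

text \<open>The chain consists of the ideals of the first \<open>i\<close> variables. An inequality
  is enough, since the exponent \<open>N\<close> grows with the dimension.\<close>

lemma krull_dim_mpoly_ge:
  fixes L :: "('a, 'b) ring_scheme"
  assumes L: "field L"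
  shows "enat n \<le> krull_dim (mpoly_ring L {1..n})"
proof -
  interpret mpoly L "{1..n}" by (rule mpoly.intro[OF L])
  have "primeideal (var_ideal {1..i}) R" if "i \<le> n" for i
    using that by (intro var_ideal_prime[OF L]) auto
  moreover have "var_ideal {1..i} \<subset> var_ideal {1..Suc i}" if "i < n" for i
  proof -
    have "mon L \<one>\<^bsub>L\<^esub> {#Suc i#} \<in> var_ideal {1..Suc i}"
      using that by (intro mon_in_mono_ideal) auto
    moreover have "mon L \<one>\<^bsub>L\<^esub> {#Suc i#} \<notin> var_ideal {1..i}"
      by (auto simp: mono_ideal_def mon_def)
    moreover have "var_ideal {1..i} \<subseteq> var_ideal {1..Suc i}"
      by (fastforce simp: mono_ideal_def)
    ultimately show ?thesis by blast
  qed
  ultimately have "(\<forall>i\<le>n. primeideal (var_ideal {1..i}) R) \<and>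
      (\<forall>i<n. var_ideal {1..i} \<subset> var_ideal {1..Suc i})" by blast
  then have "\<exists>P :: nat \<Rightarrow> (nat multiset \<Rightarrow> 'a) set.
      (\<forall>i\<le>n. primeideal (P i) R) \<and> (\<forall>i<n. P i \<subset> P (Suc i))"
    by (rule exI[of _ "\<lambda>i. var_ideal {1..i}"])
  then show ?thesis unfolding krull_dim_def by (intro Sup_upper) blast
qed

section \<open>Localization\<close>

locale fraction_ring = cring R for R (structure) +
  fixes U
  assumes U_subset: "U \<subseteq> carrier R" and one_in_U: "\<one> \<in> U"
    and U_mult: "s \<in> U \<Longrightarrow> t \<in> U \<Longrightarrow> s \<otimes> t \<in> U"
begin

abbreviation S where "S \<equiv> loc_ring R U"
abbreviation fr where "fr \<equiv> frac_class R U"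

lemma U_carrier [simp]: "s \<in> U \<Longrightarrow> s \<in> carrier R"
  using U_subset by blast

lemma loc_rel_iff:
  "((a, s), (b, t)) \<in> loc_rel R U \<longleftrightarrow> a \<in> carrier R \<and> b \<in> carrier R \<and> s \<in> U \<and> t \<in> U \<and>
    (\<exists>u\<in>U. u \<otimes> (t \<otimes> a) = u \<otimes> (s \<otimes> b))"
  by (simp add: loc_rel_def)

lemma loc_rel_trans:
  assumes "((a, s), (b, t)) \<in> loc_rel R U" "((b, t), (c, w)) \<in> loc_rel R U"
  shows "((a, s), (c, w)) \<in> loc_rel R U"
proof -
  obtain u v where u: "u \<in> U" "u \<otimes> (t \<otimes> a) = u \<otimes> (s \<otimes> b)" and v: "v \<in> U" "v \<otimes> (w \<otimes> b) = v \<otimes> (t \<otimes> c)"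
    and cl: "a \<in> carrier R" "b \<in> carrier R" "c \<in> carrier R" "s \<in> U" "t \<in> U" "w \<in> U"
    using assms unfolding loc_rel_iff by blast
  have c: "s \<in> carrier R" "t \<in> carrier R" "w \<in> carrier R" "u \<in> carrier R" "v \<in> carrier R"
    using cl u v by auto
  \<comment> \<open>The middle denominator \<open>t\<close> has to join the multipliers
    \<open>u\<close> and \<open>v\<close>, since it can only be removed by cancellation.\<close>
  have "(u \<otimes> v \<otimes> t) \<otimes> (w \<otimes> a) = (v \<otimes> w) \<otimes> (u \<otimes> (t \<otimes> a))" using c cl(1) by algebra
  also have "\<dots> = (u \<otimes> s) \<otimes> (v \<otimes> (w \<otimes> b))" unfolding u(2) using c cl(2) by algebra
  also have "\<dots> = (u \<otimes> v \<otimes> t) \<otimes> (s \<otimes> c)" unfolding v(2) using c cl(3) by algebra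
  finally have "(u \<otimes> v \<otimes> t) \<otimes> (w \<otimes> a) = (u \<otimes> v \<otimes> t) \<otimes> (s \<otimes> c)" .
  moreover have "u \<otimes> v \<otimes> t \<in> U" using u v cl U_mult by blast
  ultimately show ?thesis unfolding loc_rel_iff using cl by blast
qed

lemma loc_rel_sym: "(x, y) \<in> loc_rel R U \<Longrightarrow> (y, x) \<in> loc_rel R U"
  by (cases x; cases y) (auto simp: loc_rel_iff intro: sym)

lemma loc_rel_refl: "a \<in> carrier R \<Longrightarrow> s \<in> U \<Longrightarrow> ((a, s), (a, s)) \<in> loc_rel R U"
  unfolding loc_rel_iff using one_in_U by blast

lemma fr_eq_iff:
  assumes "a \<in> carrier R" "b \<in> carrier R" "s \<in> U" "t \<in> U"
  shows "fr a s = fr b t \<longleftrightarrow> (\<exists>u\<in>U. u \<otimes> (t \<otimes> a) = u \<otimes> (s \<otimes> b))"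
proof
  assume "fr a s = fr b t"
  then have "(b, t) \<in> fr a s" using loc_rel_refl[OF assms(2,4)] by (auto simp: frac_class_def)
  then show "\<exists>u\<in>U. u \<otimes> (t \<otimes> a) = u \<otimes> (s \<otimes> b)" by (simp add: frac_class_def loc_rel_iff)
next
  assume "\<exists>u\<in>U. u \<otimes> (t \<otimes> a) = u \<otimes> (s \<otimes> b)"
  then have r: "((a, s), (b, t)) \<in> loc_rel R U" using assms by (simp add: loc_rel_iff)
  show "fr a s = fr b t"
    unfolding frac_class_def
  proof (intro equalityI subsetI)
    fix x assume x: "x \<in> loc_rel R U `` {(a, s)}"
    obtain c w where e: "x = (c, w)" by (cases x)
    have "((a, s), (c, w)) \<in> loc_rel R U" using x unfolding e by blast
    from loc_rel_trans[OF loc_rel_sym[OF r] this] show "x \<in> loc_rel R U `` {(b, t)}" unfolding e by blast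
  next
    fix x assume x: "x \<in> loc_rel R U `` {(b, t)}"
    obtain c w where e: "x = (c, w)" by (cases x)
    have "((b, t), (c, w)) \<in> loc_rel R U" using x unfolding e by blast
    from loc_rel_trans[OF r this] show "x \<in> loc_rel R U `` {(a, s)}" unfolding e by blast
  qed
qed

lemma fr_eqI:
  assumes "a \<in> carrier R" "b \<in> carrier R" "s \<in> U" "t \<in> U" "t \<otimes> a = s \<otimes> b"
  shows "fr a s = fr b t"
  using assms one_in_U by (subst fr_eq_iff) auto

lemma fr_mem_iff: "(b, t) \<in> fr a s \<longleftrightarrow> ((a, s), (b, t)) \<in> loc_rel R U"
  by (simp add: frac_class_def)

lemma carrier_S: "carrier S = {fr a s | a s. a \<in> carrier R \<and> s \<in> U}"
  by (auto simp: loc_ring_def quotient_def frac_class_def)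

lemma fr_in_carrier: "a \<in> carrier R \<Longrightarrow> s \<in> U \<Longrightarrow> fr a s \<in> carrier S"
  unfolding carrier_S by blast

lemma carrier_SE:
  assumes "x \<in> carrier S"
  obtains a s where "a \<in> carrier R" "s \<in> U" "x = fr a s"
  using assms unfolding carrier_S by blast

text \<open>The operations of the localization are unions over representatives; when the result does
  not depend on them, the union collapses to a single class.\<close>

lemma UN_const_pair:
  assumes "x \<in> C" "y \<in> D" and "\<And>a s b t. (a, s) \<in> C \<Longrightarrow> (b, t) \<in> D \<Longrightarrow> F a s b t = Z"
  shows "(\<Union>(a, s)\<in>C. \<Union>(b, t)\<in>D. F a s b t) = Z"
proof
  show "(\<Union>(a, s)\<in>C. \<Union>(b, t)\<in>D. F a s b t) \<subseteq> Z" using assms(3) by fastforce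
  obtain a s b t where e: "x = (a, s)" "y = (b, t)" by (cases x; cases y)
  have "F a s b t = Z" using assms unfolding e by blast
  then show "Z \<subseteq> (\<Union>(a, s)\<in>C. \<Union>(b, t)\<in>D. F a s b t)" using assms(1,2) unfolding e by fastforce
qed

lemma fr_mult:
  assumes "a \<in> carrier R" "b \<in> carrier R" "s \<in> U" "t \<in> U"
  shows "fr a s \<otimes>\<^bsub>S\<^esub> fr b t = fr (a \<otimes> b) (s \<otimes> t)"
proof -
  have "(\<Union>(a, s)\<in>fr a s. \<Union>(b, t)\<in>fr b t. fr (a \<otimes> b) (s \<otimes> t)) = fr (a \<otimes> b) (s \<otimes> t)"
  proof (rule UN_const_pair)
    show "(a, s) \<in> fr a s" "(b, t) \<in> fr b t" using assms loc_rel_refl by (auto simp: fr_mem_iff)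
    fix a' s' b' t' assume "(a', s') \<in> fr a s" "(b', t') \<in> fr b t"
    then obtain u v where u: "u \<in> U" "u \<otimes> (s' \<otimes> a) = u \<otimes> (s \<otimes> a')"
      and v: "v \<in> U" "v \<otimes> (t' \<otimes> b) = v \<otimes> (t \<otimes> b')"
      and cl: "a' \<in> carrier R" "b' \<in> carrier R" "s' \<in> U" "t' \<in> U"
      unfolding fr_mem_iff loc_rel_iff by blast
    have c: "s \<in> carrier R" "t \<in> carrier R" "s' \<in> carrier R" "t' \<in> carrier R" "u \<in> carrier R" "v \<in> carrier R"
      using cl u v assms by auto
    have "(u \<otimes> v) \<otimes> ((s \<otimes> t) \<otimes> (a' \<otimes> b')) = (u \<otimes> (s \<otimes> a')) \<otimes> (v \<otimes> (t \<otimes> b'))"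
      using c cl(1,2) by algebra
    also have "\<dots> = (u \<otimes> v) \<otimes> ((s' \<otimes> t') \<otimes> (a \<otimes> b))"
      unfolding u(2)[symmetric] v(2)[symmetric] using c assms(1,2) by algebra
    finally show "fr (a' \<otimes> b') (s' \<otimes> t') = fr (a \<otimes> b) (s \<otimes> t)"
      using cl assms u(1) v(1) U_mult by (subst fr_eq_iff) auto
  qed
  then show ?thesis by (simp add: loc_ring_def)
qed

lemma fr_add:
  assumes "a \<in> carrier R" "b \<in> carrier R" "s \<in> U" "t \<in> U"
  shows "fr a s \<oplus>\<^bsub>S\<^esub> fr b t = fr (a \<otimes> t \<oplus> b \<otimes> s) (s \<otimes> t)"
proof -
  have "(\<Union>(a, s)\<in>fr a s. \<Union>(b, t)\<in>fr b t. fr (a \<otimes> t \<oplus> b \<otimes> s) (s \<otimes> t)) = fr (a \<otimes> t \<oplus> b \<otimes> s) (s \<otimes> t)"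
  proof (rule UN_const_pair)
    show "(a, s) \<in> fr a s" "(b, t) \<in> fr b t" using assms loc_rel_refl by (auto simp: fr_mem_iff)
    fix a' s' b' t' assume "(a', s') \<in> fr a s" "(b', t') \<in> fr b t"
    then obtain u v where u: "u \<in> U" "u \<otimes> (s' \<otimes> a) = u \<otimes> (s \<otimes> a')"
      and v: "v \<in> U" "v \<otimes> (t' \<otimes> b) = v \<otimes> (t \<otimes> b')"
      and cl: "a' \<in> carrier R" "b' \<in> carrier R" "s' \<in> U" "t' \<in> U"
      unfolding fr_mem_iff loc_rel_iff by blast
    have c: "s \<in> carrier R" "t \<in> carrier R" "s' \<in> carrier R" "t' \<in> carrier R" "u \<in> carrier R" "v \<in> carrier R"
      using cl u v assms by auto
    have "(u \<otimes> v) \<otimes> ((s \<otimes> t) \<otimes> (a' \<otimes> t' \<oplus> b' \<otimes> s')) =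
        (u \<otimes> (s \<otimes> a')) \<otimes> (v \<otimes> (t \<otimes> t')) \<oplus> (v \<otimes> (t \<otimes> b')) \<otimes> (u \<otimes> (s \<otimes> s'))"
      using c cl(1,2) by algebra
    also have "\<dots> = (u \<otimes> v) \<otimes> ((s' \<otimes> t') \<otimes> (a \<otimes> t \<oplus> b \<otimes> s))"
      unfolding u(2)[symmetric] v(2)[symmetric] using c assms(1,2) by algebra
    finally show "fr (a' \<otimes> t' \<oplus> b' \<otimes> s') (s' \<otimes> t') = fr (a \<otimes> t \<oplus> b \<otimes> s) (s \<otimes> t)"
      using cl assms u(1) v(1) U_mult by (subst fr_eq_iff) auto
  qed
  then show ?thesis by (simp add: loc_ring_def)
qed

lemma S_one: "\<one>\<^bsub>S\<^esub> = fr \<one> \<one>" and S_zero: "\<zero>\<^bsub>S\<^esub> = fr \<zero> \<one>"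
  by (simp_all add: loc_ring_def)

lemma S_abelian: "abelian_group S"
proof (rule abelian_groupI)
  fix x y assume "x \<in> carrier S" "y \<in> carrier S"
  then obtain a s b t where *: "a \<in> carrier R" "s \<in> U" "x = fr a s" "b \<in> carrier R" "t \<in> U" "y = fr b t"
    by (elim carrier_SE)
  show "x \<oplus>\<^bsub>S\<^esub> y \<in> carrier S" using * by (simp add: fr_add fr_in_carrier U_mult)
  show "x \<oplus>\<^bsub>S\<^esub> y = y \<oplus>\<^bsub>S\<^esub> x" using * by (simp add: fr_add a_comm m_comm)
next
  fix x y z assume "x \<in> carrier S" "y \<in> carrier S" "z \<in> carrier S"
  then obtain a s b t c w where *: "a \<in> carrier R" "s \<in> U" "x = fr a s" "b \<in> carrier R" "t \<in> U" "y = fr b t"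
    "c \<in> carrier R" "w \<in> U" "z = fr c w"
    by (elim carrier_SE)
  have cl: "s \<in> carrier R" "t \<in> carrier R" "w \<in> carrier R" using * by auto
  have "(a \<otimes> t \<oplus> b \<otimes> s) \<otimes> w \<oplus> c \<otimes> (s \<otimes> t) = a \<otimes> (t \<otimes> w) \<oplus> (b \<otimes> w \<oplus> c \<otimes> t) \<otimes> s"
    using *(1,4,7) cl by algebra
  then show "(x \<oplus>\<^bsub>S\<^esub> y) \<oplus>\<^bsub>S\<^esub> z = x \<oplus>\<^bsub>S\<^esub> (y \<oplus>\<^bsub>S\<^esub> z)"
    using * by (simp add: fr_add U_mult m_assoc[of s t w])
next
  fix x assume "x \<in> carrier S"
  then obtain a s where *: "a \<in> carrier R" "s \<in> U" "x = fr a s" by (elim carrier_SE)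
  show "\<zero>\<^bsub>S\<^esub> \<oplus>\<^bsub>S\<^esub> x = x" using * by (simp add: S_zero fr_add one_in_U)
  have "fr (\<ominus> a) s \<oplus>\<^bsub>S\<^esub> x = fr ((\<ominus> a \<oplus> a) \<otimes> s) (s \<otimes> s)" using * by (simp add: fr_add l_distr)
  also have "\<dots> = \<zero>\<^bsub>S\<^esub>"
    unfolding S_zero using * U_mult one_in_U by (intro fr_eqI) (auto simp: l_neg)
  finally show "\<exists>y\<in>carrier S. y \<oplus>\<^bsub>S\<^esub> x = \<zero>\<^bsub>S\<^esub>" using * fr_in_carrier[of "\<ominus> a" s] by blast
qed (simp add: S_zero fr_in_carrier one_in_U)

lemma S_cring: "cring S"
proof (rule cringI[OF S_abelian])
  show "comm_monoid S"
  proof (rule comm_monoidI)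
    fix x y assume "x \<in> carrier S" "y \<in> carrier S"
    then obtain a s b t where *: "a \<in> carrier R" "s \<in> U" "x = fr a s" "b \<in> carrier R" "t \<in> U" "y = fr b t"
      by (elim carrier_SE)
    show "x \<otimes>\<^bsub>S\<^esub> y \<in> carrier S" using * by (simp add: fr_mult fr_in_carrier U_mult)
    show "x \<otimes>\<^bsub>S\<^esub> y = y \<otimes>\<^bsub>S\<^esub> x" using * by (simp add: fr_mult m_comm)
  next
    fix x y z assume "x \<in> carrier S" "y \<in> carrier S" "z \<in> carrier S"
    then obtain a s b t c w where *: "a \<in> carrier R" "s \<in> U" "x = fr a s" "b \<in> carrier R" "t \<in> U" "y = fr b t"
      "c \<in> carrier R" "w \<in> U" "z = fr c w"
      by (elim carrier_SE)
    show "(x \<otimes>\<^bsub>S\<^esub> y) \<otimes>\<^bsub>S\<^esub> z = x \<otimes>\<^bsub>S\<^esub> (y \<otimes>\<^bsub>S\<^esub> z)"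
      using * by (simp add: fr_mult U_mult m_assoc)
  next
    fix x assume "x \<in> carrier S"
    then obtain a s where *: "a \<in> carrier R" "s \<in> U" "x = fr a s" by (elim carrier_SE)
    then show "\<one>\<^bsub>S\<^esub> \<otimes>\<^bsub>S\<^esub> x = x" by (simp add: S_one fr_mult one_in_U)
  qed (simp add: S_one fr_in_carrier one_in_U)
next
  fix x y z assume "x \<in> carrier S" "y \<in> carrier S" "z \<in> carrier S"
  then obtain a s b t c w where *: "a \<in> carrier R" "s \<in> U" "x = fr a s" "b \<in> carrier R" "t \<in> U" "y = fr b t"
    "c \<in> carrier R" "w \<in> U" "z = fr c w"
    by (elim carrier_SE)
  have cl: "s \<in> carrier R" "t \<in> carrier R" "w \<in> carrier R" using * by auto
  have "(s \<otimes> w \<otimes> (t \<otimes> w)) \<otimes> ((a \<otimes> t \<oplus> b \<otimes> s) \<otimes> c) =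
      (s \<otimes> t \<otimes> w) \<otimes> (a \<otimes> c \<otimes> (t \<otimes> w) \<oplus> b \<otimes> c \<otimes> (s \<otimes> w))"
    using *(1,4,7) cl by algebra
  then have eq: "fr ((a \<otimes> t \<oplus> b \<otimes> s) \<otimes> c) (s \<otimes> t \<otimes> w) =
      fr (a \<otimes> c \<otimes> (t \<otimes> w) \<oplus> b \<otimes> c \<otimes> (s \<otimes> w)) (s \<otimes> w \<otimes> (t \<otimes> w))"
    using *(1,2,4,5,7,8) U_mult by (intro fr_eqI) auto
  have "(x \<oplus>\<^bsub>S\<^esub> y) \<otimes>\<^bsub>S\<^esub> z = fr ((a \<otimes> t \<oplus> b \<otimes> s) \<otimes> c) (s \<otimes> t \<otimes> w)"
    unfolding *(3,6,9) using *(1,2,4,5,7,8) by (simp add: fr_add fr_mult U_mult)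
  also have "\<dots> = x \<otimes>\<^bsub>S\<^esub> z \<oplus>\<^bsub>S\<^esub> y \<otimes>\<^bsub>S\<^esub> z"
    unfolding eq *(3,6,9) using *(1,2,4,5,7,8) by (simp add: fr_add fr_mult U_mult)
  finally show "(x \<oplus>\<^bsub>S\<^esub> y) \<otimes>\<^bsub>S\<^esub> z = x \<otimes>\<^bsub>S\<^esub> z \<oplus>\<^bsub>S\<^esub> y \<otimes>\<^bsub>S\<^esub> z" .
qed

sublocale S: cring S by (rule S_cring)

lemma U_pow: "s \<in> U \<Longrightarrow> s [^] (n::nat) \<in> U"
  by (induction n) (auto simp: one_in_U U_mult)

lemma fr_pow:
  assumes "a \<in> carrier R" "s \<in> U"
  shows "fr a s [^]\<^bsub>S\<^esub> (n::nat) = fr (a [^] n) (s [^] n)"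
  by (induction n) (use assms in \<open>auto simp: S_one fr_mult U_pow\<close>)

lemma fr_pow_one: "a \<in> carrier R \<Longrightarrow> fr a \<one> [^]\<^bsub>S\<^esub> (n::nat) = fr (a [^] n) \<one>"
  using fr_pow[of a \<one> n] one_in_U by simp

definition ext where "ext J = {fr a s | a s. a \<in> J \<and> s \<in> U}"
definition contr where "contr K = {a \<in> carrier R. fr a \<one> \<in> K}"

lemma ext_ideal:
  assumes J: "ideal J R"
  shows "ideal (ext J) S"
proof (rule S.ideal_intro)
  note Jc = ideal.Icarr[OF J]
  note Ja = ideal_add[OF J]
  show "ext J \<subseteq> carrier S" using Jc by (auto simp: ext_def intro: fr_in_carrier)
  show "\<zero>\<^bsub>S\<^esub> \<in> ext J" unfolding ext_def S_zero
    using one_in_U ideal_zero[OF J] by blast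
  show "x \<oplus>\<^bsub>S\<^esub> y \<in> ext J" if x: "x \<in> ext J" and y: "y \<in> ext J" for x y
  proof -
    obtain a s where a: "a \<in> J" "s \<in> U" "x = fr a s" using x unfolding ext_def by blast
    obtain b t where b: "b \<in> J" "t \<in> U" "y = fr b t" using y unfolding ext_def by blast
    have "a \<otimes> t \<oplus> b \<otimes> s \<in> J"
      using a b by (intro Ja ideal.I_r_closed[OF J]) auto
    moreover have "x \<oplus>\<^bsub>S\<^esub> y = fr (a \<otimes> t \<oplus> b \<otimes> s) (s \<otimes> t)"
      unfolding a(3) b(3) by (rule fr_add[OF Jc[OF a(1)] Jc[OF b(1)] a(2) b(2)])
    ultimately show ?thesis using U_mult[OF a(2) b(2)] unfolding ext_def by blast
  qed
  show "x \<otimes>\<^bsub>S\<^esub> y \<in> ext J" if x: "x \<in> carrier S" and y: "y \<in> ext J" for x y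
  proof -
    obtain a s where a: "a \<in> carrier R" "s \<in> U" "x = fr a s" using x by (rule carrier_SE)
    obtain b t where b: "b \<in> J" "t \<in> U" "y = fr b t" using y unfolding ext_def by blast
    have "a \<otimes> b \<in> J" by (rule ideal.I_l_closed[OF J b(1) a(1)])
    moreover have "x \<otimes>\<^bsub>S\<^esub> y = fr (a \<otimes> b) (s \<otimes> t)"
      unfolding a(3) b(3) by (rule fr_mult[OF a(1) Jc[OF b(1)] a(2) b(2)])
    ultimately show ?thesis using U_mult[OF a(2) b(2)] unfolding ext_def by blast
  qed
qed

lemma fr_in_ideal_iff:
  assumes K: "ideal K S" and a: "a \<in> carrier R" and s: "s \<in> U"
  shows "fr a s \<in> K \<longleftrightarrow> fr a \<one> \<in> K"
proof
  assume *: "fr a s \<in> K"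
  have "fr s \<one> \<otimes>\<^bsub>S\<^esub> fr a s \<in> K"
    by (rule ideal.I_l_closed[OF K *]) (use s one_in_U fr_in_carrier in auto)
  moreover have "fr s \<one> \<otimes>\<^bsub>S\<^esub> fr a s = fr (s \<otimes> a) s" using a s one_in_U by (simp add: fr_mult)
  moreover have "fr (s \<otimes> a) s = fr a \<one>" using a s one_in_U by (intro fr_eqI) auto
  ultimately show "fr a \<one> \<in> K" by simp
next
  assume *: "fr a \<one> \<in> K"
  have "fr \<one> s \<otimes>\<^bsub>S\<^esub> fr a \<one> \<in> K"
    by (rule ideal.I_l_closed[OF K *]) (use s fr_in_carrier in auto)
  then show "fr a s \<in> K" using a s one_in_U by (simp add: fr_mult)
qed

lemma contr_ideal:
  assumes K: "ideal K S"
  shows "ideal (contr K) R"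
proof (rule ideal_intro)
  show "contr K \<subseteq> carrier R" by (auto simp: contr_def)
  show "\<zero> \<in> contr K"
    using S.ideal_zero[OF K] by (simp add: contr_def S_zero)
  show "x \<oplus> y \<in> contr K" if "x \<in> contr K" "y \<in> contr K" for x y
  proof -
    have "fr x \<one> \<oplus>\<^bsub>S\<^esub> fr y \<one> \<in> K"
      using that by (intro S.ideal_add[OF K]) (auto simp: contr_def)
    then show ?thesis using that one_in_U by (simp add: contr_def fr_add)
  qed
  show "a \<otimes> x \<in> contr K" if "a \<in> carrier R" "x \<in> contr K" for a x
  proof -
    have "fr a \<one> \<otimes>\<^bsub>S\<^esub> fr x \<one> \<in> K"
      using that one_in_U by (intro ideal.I_l_closed[OF K] fr_in_carrier) (auto simp: contr_def)
    then show ?thesis using that one_in_U by (simp add: contr_def fr_mult)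
  qed
qed

lemma ext_contr_subset:
  assumes K: "ideal K S"
  shows "ext (contr K) \<subseteq> K"
  unfolding ext_def contr_def using fr_in_ideal_iff[OF K] by auto

end

section \<open>Frobenius roots and test ideals of the localization\<close>

context frobenius_split
begin

sublocale loc: fraction_ring R "carrier R - M"
  by unfold_locales (use one_notin_M notin_M_mult in auto)

lemma contr_sat_ideal:
  assumes K: "ideal K (loc_at R M)"
  shows "sat_ideal R M (loc.contr K)"
proof -
  have K': "ideal K loc.S" using K by (simp add: loc_at_def)
  have "x \<in> loc.contr K" if s: "s \<in> carrier R - M" and x: "x \<in> carrier R" and sx: "s \<otimes> x \<in> loc.contr K" for s x
  proof -
    have "loc.fr (s \<otimes> x) s \<in> K"
      using sx s x by (subst loc.fr_in_ideal_iff[OF K']) (auto simp: loc.contr_def)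
    moreover have "loc.fr (s \<otimes> x) s = loc.fr x \<one>"
      using s x loc.one_in_U by (intro loc.fr_eqI) auto
    ultimately show ?thesis using x by (simp add: loc.contr_def)
  qed
  then show ?thesis unfolding sat_ideal_def using loc.contr_ideal[OF K'] by blast
qed

text \<open>Equality of fractions puts \<open>u \<otimes> (s \<otimes> a)\<close> into
  \<open>J\<close> with \<open>u\<close> and \<open>s\<close> outside \<open>M\<close>, and
  saturation cancels both.\<close>

lemma fr_in_ext_iff:
  assumes J: "sat_ideal R M J" and a: "a \<in> carrier R"
  shows "loc.fr a \<one> \<in> loc.ext J \<longleftrightarrow> a \<in> J"
proof
  have J': "ideal J R" using J by (simp add: sat_ideal_def)
  assume "loc.fr a \<one> \<in> loc.ext J"
  then obtain b s where b: "b \<in> J" "s \<in> carrier R - M" "loc.fr a \<one> = loc.fr b s"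
    unfolding loc.ext_def by blast
  have bc: "b \<in> carrier R" using ideal.Icarr[OF J' b(1)] .
  obtain u where u: "u \<in> carrier R - M" "u \<otimes> (s \<otimes> a) = u \<otimes> (\<one> \<otimes> b)"
    using b(2,3) loc.fr_eq_iff[OF a bc loc.one_in_U b(2)] by blast
  have "u \<otimes> (s \<otimes> a) \<in> J" unfolding u(2) using bc u(1) by (simp add: ideal.I_l_closed[OF J' b(1)])
  moreover have "s \<otimes> a \<in> carrier R" using a b(2) by simp
  ultimately have "s \<otimes> a \<in> J" using J u(1) unfolding sat_ideal_def by blast
  then show "a \<in> J" using J a b(2) unfolding sat_ideal_def by blast
next
  assume "a \<in> J"
  then show "loc.fr a \<one> \<in> loc.ext J" unfolding loc.ext_def using loc.one_in_U by blast
qed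

text \<open>Frobenius powers commute with contraction. One inclusion holds because the power of the
  contraction is saturated and its extension contains the powers of all fractions in
  \<open>K\<close>; the other because the contraction of the power contains the powers of all
  elements of the contraction.\<close>

lemma frob_power_loc_iff:
  assumes K: "ideal K (loc_at R M)" and g: "g \<in> carrier R"
  shows "loc_at_map R M g \<in> frob_power (loc_at R M) p e K \<longleftrightarrow> g \<in> frob_pow R p e (loc.contr K)"
proof -
  have K': "ideal K loc.S" using K by (simp add: loc_at_def)
  let ?C = "loc.contr K"
  have C: "sat_ideal R M ?C" "ideal ?C R" by (rule contr_sat_ideal[OF K], rule loc.contr_ideal[OF K'])
  have sub: "(\<lambda>a. a [^]\<^bsub>loc.S\<^esub> (p ^ e)) ` K \<subseteq> carrier loc.S"
    using ideal.Icarr[OF K'] by auto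
  define Q where "Q = Idl\<^bsub>loc.S\<^esub> ((\<lambda>a. a [^]\<^bsub>loc.S\<^esub> (p ^ e)) ` K)"
  have Q: "ideal Q loc.S" unfolding Q_def by (rule loc.S.genideal_ideal[OF sub])
  have "loc_at_map R M g \<in> frob_power (loc_at R M) p e K \<longleftrightarrow> loc.fr g \<one> \<in> Q"
    by (simp add: loc_at_map_def loc_at_def frob_power_def Q_def)
  also have "\<dots> \<longleftrightarrow> g \<in> frob_pow R p e ?C"
  proof
    assume "loc.fr g \<one> \<in> Q"
    moreover have "Q \<subseteq> loc.ext (frob_pow R p e ?C)"
      unfolding Q_def
    proof (rule loc.S.genideal_minimal[OF loc.ext_ideal[OF frob_pow_ideal[OF C(2)]]])
      show "(\<lambda>a. a [^]\<^bsub>loc.S\<^esub> (p ^ e)) ` K \<subseteq> loc.ext (frob_pow R p e ?C)"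
      proof clarify
        fix x assume x: "x \<in> K"
        obtain a s where a: "a \<in> carrier R" "s \<in> carrier R - M" "x = loc.fr a s"
          by (rule loc.carrier_SE[OF ideal.Icarr[OF K' x]])
        have "a \<in> ?C" using x a loc.fr_in_ideal_iff[OF K' a(1,2)] by (simp add: loc.contr_def)
        moreover have "(\<lambda>a. a [^] (p ^ e)) ` ?C \<subseteq> carrier R"
          using ideal.Icarr[OF C(2)] by auto
        ultimately have "a [^] (p ^ e) \<in> frob_pow R p e ?C"
          unfolding frob_power_eq_frob_pow[OF C(2), symmetric] frob_power_def
          using genideal_self by blast
        then show "x [^]\<^bsub>loc.S\<^esub> (p ^ e) \<in> loc.ext (frob_pow R p e ?C)"
          unfolding a(3) loc.fr_pow[OF a(1,2)] loc.ext_def using loc.U_pow[OF a(2)] by blast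
      qed
    qed
    ultimately show "g \<in> frob_pow R p e ?C"
      using fr_in_ext_iff[OF frob_pow_sat_ideal[OF C(1)] g] by blast
  next
    assume "g \<in> frob_pow R p e ?C"
    moreover have "frob_pow R p e ?C \<subseteq> loc.contr Q"
      unfolding frob_power_eq_frob_pow[OF C(2), symmetric] frob_power_def
    proof (rule genideal_minimal[OF loc.contr_ideal[OF Q]])
      show "(\<lambda>a. a [^] (p ^ e)) ` ?C \<subseteq> loc.contr Q"
      proof clarify
        fix a assume a: "a \<in> ?C"
        then have ac: "a \<in> carrier R" "loc.fr a \<one> \<in> K" by (auto simp: loc.contr_def)
        then have "loc.fr a \<one> [^]\<^bsub>loc.S\<^esub> (p ^ e) \<in> Q"
          unfolding Q_def using loc.S.genideal_self[OF sub] by blast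
        then show "a [^] (p ^ e) \<in> loc.contr Q"
          using ac(1) by (simp add: loc.contr_def loc.fr_pow_one)
      qed
    qed
    ultimately show "loc.fr g \<one> \<in> Q" by (auto simp: loc.contr_def)
  qed
  finally show ?thesis .
qed

text \<open>\<open>LEAST\<close> is meaningful only once a least ideal is exhibited. Extension and
  contraction identify the candidates in the localization with saturated ideals of \<open>R\<close>,
  among which \<open>root e g\<close> is the least.\<close>

lemma frob_root_loc:
  assumes g: "g \<in> carrier R"
  shows "frob_root (loc_at R M) p e (loc_at_map R M g) = loc.ext (root e g)"
  unfolding frob_root_def
proof (rule Least_equality)
  have r: "sat_ideal R M (root e g)" by (rule root_sat_ideal[OF g])
  then have rI: "ideal (root e g) R" by (simp add: sat_ideal_def)
  have I: "ideal (loc.ext (root e g)) (loc_at R M)"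
    unfolding loc_at_def by (rule loc.ext_ideal[OF rI])
  moreover have "loc.contr (loc.ext (root e g)) = root e g"
    using fr_in_ext_iff[OF r] ideal.Icarr[OF rI] by (auto simp: loc.contr_def)
  ultimately show "ideal (loc.ext (root e g)) (loc_at R M) \<and>
      loc_at_map R M g \<in> frob_power (loc_at R M) p e (loc.ext (root e g))"
    using frob_power_loc_iff[OF I g, of e] in_frob_pow_root[OF g, of e] by simp
next
  fix K assume *: "ideal K (loc_at R M) \<and> loc_at_map R M g \<in> frob_power (loc_at R M) p e K"
  then have "root e g \<subseteq> loc.contr K"
    using frob_power_loc_iff[of K g e] g contr_sat_ideal root_subset_iff[OF g] by blast
  then have "loc.ext (root e g) \<subseteq> loc.ext (loc.contr K)" by (auto simp: loc.ext_def)
  also have "\<dots> \<subseteq> K" using * by (intro loc.ext_contr_subset) (simp add: loc_at_def)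
  finally show "loc.ext (root e g) \<subseteq> K" .
qed

text \<open>The union is ascending: rounding gives \<open>c (Suc e) \<le> p * c e\<close>, and by
  \<open>refine\<close> the exponent \<open>p * c e\<close> at level \<open>Suc e\<close> has the
  same root as \<open>c e\<close> at level \<open>e\<close>. Hence finitely many levels may be
  dropped.\<close>

lemma test_ideal_tail:
  assumes f: "f \<in> carrier R" and lam: "0 \<le> lam" and E: "1 \<le> E"
  shows "test_ideal (loc_at R M) p (loc_at_map R M f) lam =
    (\<Union>e\<in>{E..}. loc.ext (root e (f [^] nat \<lceil>real (p ^ e) * lam\<rceil>)))"
proof -
  interpret tower: frobenius_tower p "\<lambda>e a. root e (f [^] a)" by (rule root_tower[OF f])
  define c where "c e = nat \<lceil>real (p ^ e) * lam\<rceil>" for e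
  define T where "T e = loc.ext (root e (f [^] c e))" for e
  have pw: "loc_at_map R M f [^]\<^bsub>loc_at R M\<^esub> (k::nat) = loc_at_map R M (f [^] k)" for k
    unfolding loc_at_map_def loc_at_def by (rule loc.fr_pow_one[OF f])
  have Te: "frob_root (loc_at R M) p e (loc_at_map R M f [^]\<^bsub>loc_at R M\<^esub> c e) = T e" for e
    unfolding pw T_def using f by (intro frob_root_loc) simp
  have "T e \<subseteq> T (Suc e)" for e
  proof -
    have "real (p ^ Suc e) * lam = real p * (real (p ^ e) * lam)" by simp
    also have "\<dots> \<le> real p * real_of_int \<lceil>real (p ^ e) * lam\<rceil>"
      by (intro mult_left_mono) auto
    also have "\<dots> = real_of_int (int p * \<lceil>real (p ^ e) * lam\<rceil>)" by simp
    finally have "\<lceil>real (p ^ Suc e) * lam\<rceil> \<le> int p * \<lceil>real (p ^ e) * lam\<rceil>"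
      unfolding ceiling_le_iff .
    moreover have "0 \<le> \<lceil>real (p ^ e) * lam\<rceil>"
      using ceiling_mono[of 0 "real (p ^ e) * lam"] lam by simp
    ultimately have "c (Suc e) \<le> p * c e" unfolding c_def by (simp add: nat_mult_distrib nat_le_iff)
    then have "root (Suc e) (f [^] (p * c e)) \<subseteq> root (Suc e) (f [^] c (Suc e))"
      by (rule tower.antimono)
    then show ?thesis unfolding T_def tower.refine by (auto simp: loc.ext_def)
  qed
  then have mono: "T i \<subseteq> T j" if "i \<le> j" for i j using that by (rule lift_Suc_mono_le)
  have "test_ideal (loc_at R M) p (loc_at_map R M f) lam = (\<Union>e\<in>{1..}. T e)"
    unfolding test_ideal_def c_def[symmetric] Te ..
  also have "\<dots> = (\<Union>e\<in>{E..}. T e)"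
  proof
    show "(\<Union>e\<in>{1..}. T e) \<subseteq> (\<Union>e\<in>{E..}. T e)"
    proof
      fix x assume "x \<in> (\<Union>e\<in>{1..}. T e)"
      then obtain e where "x \<in> T e" by blast
      then have "x \<in> T (max e E)" using mono[of e "max e E"] by auto
      then show "x \<in> (\<Union>e\<in>{E..}. T e)" by (intro UN_I[of "max e E"]) auto
    qed
    show "(\<Union>e\<in>{E..}. T e) \<subseteq> (\<Union>e\<in>{1..}. T e)" using E by (intro UN_mono) auto
  qed
  finally show ?thesis unfolding T_def c_def .
qed

text \<open>Roots are compared only for exponents below \<open>p ^ e\<close>. The exponents in the
  test ideal satisfy this as soon as \<open>p ^ e * (1 - lam)\<close> exceeds 1, and the earlier
  levels are dropped.\<close>

theorem test_ideal_eqI: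
  assumes f: "f \<in> carrier R" and g: "g \<in> carrier R" and lam: "0 \<le> lam" "lam < 1"
    and eq: "\<And>e a. E \<le> e \<Longrightarrow> a < p ^ e \<Longrightarrow> root e (f [^] a) = root e (g [^] a)"
  shows "test_ideal (loc_at R M) p (loc_at_map R M f) lam = test_ideal (loc_at R M) p (loc_at_map R M g) lam"
proof -
  have p1: "1 < real p" using prime_gt_1_nat[OF p_prime] by simp
  \<comment> \<open>This is the place where \<open>lam < 1\<close> enters.\<close>
  obtain e0 where e0: "1 / (1 - lam) < real p ^ e0" using real_arch_pow[OF p1] by blast
  define F where "F = max 1 (max E e0)"
  have "nat \<lceil>real (p ^ e) * lam\<rceil> < p ^ e" if "F \<le> e" for e
  proof -
    have "real p ^ e0 \<le> real p ^ e" using that p1 by (intro power_increasing) (auto simp: F_def)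
    then have "1 / (1 - lam) < real p ^ e" using e0 by simp
    then have "1 < real (p ^ e) * (1 - lam)" using lam by (simp add: pos_divide_less_eq)
    then have "real (p ^ e) * lam \<le> real_of_int (int (p ^ e) - 1)" by (simp add: algebra_simps)
    then have "\<lceil>real (p ^ e) * lam\<rceil> \<le> int (p ^ e) - 1" unfolding ceiling_le_iff .
    then have "\<lceil>real (p ^ e) * lam\<rceil> < int (p ^ e)" by linarith
    moreover have "0 \<le> \<lceil>real (p ^ e) * lam\<rceil>"
      using ceiling_mono[of 0 "real (p ^ e) * lam"] lam by simp
    ultimately show ?thesis using nat_less_iff[of "\<lceil>real (p ^ e) * lam\<rceil>" "p ^ e"] by simp
  qed
  then have "root e (f [^] nat \<lceil>real (p ^ e) * lam\<rceil>) = root e (g [^] nat \<lceil>real (p ^ e) * lam\<rceil>)" if "F \<le> e" for e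
    using that by (intro eq) (auto simp: F_def)
  then show ?thesis
    using test_ideal_tail[OF f lam(1), of F] test_ideal_tail[OF g lam(1), of F] by (simp add: F_def)
qed

end

section \<open>Length\<close>

lemma (in cring) submodule_quot_module:
  assumes J: "ideal J R" and K: "ideal K R"
  shows "submodule ((\<lambda>a. J +>\<^bsub>R\<^esub> a) ` K) R (quot_module R J)"
proof -
  interpret J: ideal J R by (rule J)
  interpret h: ring_hom_ring R "R Quot J" "(+>\<^bsub>R\<^esub>) J" by (rule J.rcos_ring_hom_ring)
  let ?H = "(\<lambda>a. J +>\<^bsub>R\<^esub> a) ` K"
  note Kc = ideal.Icarr[OF K]
  note Ka = ideal_add[OF K]
  have sub: "?H \<subseteq> carrier (R Quot J)" using Kc by auto
  have "subgroup ?H (add_monoid (R Quot J))"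
  proof (rule h.S.add.subgroupI)
    show "?H \<subseteq> carrier (R Quot J)" by (rule sub)
    show "?H \<noteq> {}" using ideal_zero[OF K] by blast
  next
    fix x assume "x \<in> ?H"
    then obtain a where a: "a \<in> K" "x = J +>\<^bsub>R\<^esub> a" by blast
    have "\<ominus>\<^bsub>R Quot J\<^esub> x = J +>\<^bsub>R\<^esub> (\<ominus> a)" unfolding a(2) using Kc[OF a(1)] by simp
    moreover have "\<ominus> a \<in> K" using additive_subgroup.a_inv_closed[OF ideal.axioms(1)[OF K] a(1)] .
    ultimately show "\<ominus>\<^bsub>R Quot J\<^esub> x \<in> ?H" by blast
  next
    fix x y assume "x \<in> ?H" "y \<in> ?H"
    then obtain a b where ab: "a \<in> K" "x = J +>\<^bsub>R\<^esub> a" "b \<in> K" "y = J +>\<^bsub>R\<^esub> b" by blast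
    have "x \<oplus>\<^bsub>R Quot J\<^esub> y = J +>\<^bsub>R\<^esub> (a \<oplus> b)" unfolding ab(2,4) using Kc ab(1,3) by simp
    then show "x \<oplus>\<^bsub>R Quot J\<^esub> y \<in> ?H" using Ka[OF ab(1,3)] by blast
  qed
  then have 1: "subgroup ?H (add_monoid (quot_module R J))"
    by (simp add: subgroup_def quot_module_def ring.defs module.defs m_inv_def)
  have 2: "a \<odot>\<^bsub>quot_module R J\<^esub> x \<in> ?H" if a: "a \<in> carrier R" and "x \<in> ?H" for a x
  proof -
    obtain b where b: "b \<in> K" "x = J +>\<^bsub>R\<^esub> b" using \<open>x \<in> ?H\<close> by blast
    have "a \<odot>\<^bsub>quot_module R J\<^esub> x = rcoset_mult R J (J +>\<^bsub>R\<^esub> a) (J +>\<^bsub>R\<^esub> b)"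
      unfolding b(2) by (simp add: quot_module_def ring.defs module.defs)
    also have "\<dots> = J +>\<^bsub>R\<^esub> (a \<otimes> b)" by (rule J.rcoset_mult_add[OF a Kc[OF b(1)]])
    finally show ?thesis using ideal.I_l_closed[OF K b(1) a] by blast
  qed
  show ?thesis by (intro submodule.intro submodule_axioms.intro 1 2)
qed

text \<open>Ideals above \<open>J\<close> are determined by their images in the quotient, so a
  strict chain of them becomes a strict chain of submodules.\<close>

lemma (in cring) ideal_chain_le_length:
  assumes J: "ideal J R" and l: "enat l = module_length R (quot_module R J)"
    and N: "\<And>i. i \<le> k \<Longrightarrow> ideal (N i) R \<and> J \<subseteq> N i" "\<And>i. i < k \<Longrightarrow> N i \<subset> N (Suc i)"
  shows "k \<le> l"
proof -
  interpret J: ideal J R by (rule J)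
  let ?H = "\<lambda>i. (\<lambda>a. J +>\<^bsub>R\<^esub> a) ` N i"
  have "submodule (?H i) R (quot_module R J)" if "i \<le> k" for i
    using submodule_quot_module[OF J] N(1)[OF that] by blast
  moreover have "?H i \<subset> ?H (Suc i)" if i: "i < k" for i
  proof -
    obtain x where x: "x \<in> N (Suc i)" "x \<notin> N i" using N(2)[OF i] by blast
    have Ni: "ideal (N i) R" "J \<subseteq> N i" and Ni': "ideal (N (Suc i)) R" using N(1)[of i] N(1)[of "Suc i"] i by auto
    have xc: "x \<in> carrier R" by (rule ideal.Icarr[OF Ni' x(1)])
    have "J +>\<^bsub>R\<^esub> x \<notin> ?H i"
    proof
      assume "J +>\<^bsub>R\<^esub> x \<in> ?H i"
      then obtain y where y: "y \<in> N i" "J +>\<^bsub>R\<^esub> x = J +>\<^bsub>R\<^esub> y" by blast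
      have "x \<in> J +>\<^bsub>R\<^esub> y" using y(2) J.a_rcos_self[OF xc] by simp
      then obtain j where j: "j \<in> J" "x = j \<oplus> y" unfolding a_r_coset_def' by blast
      have "x \<in> N i" unfolding j(2)
        by (rule ideal_add[OF Ni(1)]) (use j Ni y in auto)
      then show False using x by blast
    qed
    then show ?thesis using N(2)[OF i] x(1) by blast
  qed
  ultimately have "(\<forall>i\<le>k. submodule (?H i) R (quot_module R J)) \<and> (\<forall>i<k. ?H i \<subset> ?H (Suc i))" by blast
  then have "\<exists>N :: nat \<Rightarrow> 'a set set. (\<forall>i\<le>k. submodule (N i) R (quot_module R J)) \<and> (\<forall>i<k. N i \<subset> N (Suc i))"
    by (rule exI[of _ ?H])
  then have "enat k \<le> module_length R (quot_module R J)"
    unfolding module_length_def by (intro Sup_upper) blast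
  then show ?thesis unfolding l[symmetric] by simp
qed

section \<open>Isolated singularities at the origin of affine space\<close>

theorem theorem4p5:
  fixes L :: "('a, 'b) ring_scheme"
    and R :: "(nat multiset \<Rightarrow> 'a) ring"
    and S :: "((nat multiset \<Rightarrow> 'a) \<times> (nat multiset \<Rightarrow> 'a)) set ring"
    and p n l N :: nat
    and \<mm> :: "(nat multiset \<Rightarrow> 'a) set"
    and f h :: "nat multiset \<Rightarrow> 'a"
    and \<iota> :: "(nat multiset \<Rightarrow> 'a) \<Rightarrow> ((nat multiset \<Rightarrow> 'a) \<times> (nat multiset \<Rightarrow> 'a)) set"
    and lam :: real
  assumes "field L" and "Factorial_Ring.prime p" and "ring_char L = p" and "F_finite_field p L"
    and "n \<ge> 1"
    and R: "R = mpoly_ring L {1..n}"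
    and \<mm>: "\<mm> = Idl\<^bsub>R\<^esub> (ring.indexed_var L ` {1..n})"
    and S: "S = loc_at R \<mm>"
    and \<iota>: "\<iota> = loc_at_map R \<mm>"
    and "f \<in> carrier R"
    and "radical R (Jac L {1..n} f) = \<mm>"
    and l: "enat l = module_length R (quot_module R (Jac L {1..n} f))"
    and N: "enat N = enat (p ^ (2 * l + 1) * (l + 1)) * krull_dim R"
    and "h \<in> \<mm> [^]\<^bsub>ideals_set R\<^esub> N"
    and "0 \<le> lam" and "lam < 1"
  shows "test_ideal S p (\<iota> f) lam = test_ideal S p (\<iota> (f \<oplus>\<^bsub>R\<^esub> h)) lam"
proof -
  interpret L: field L by fact
  have charL: "add_pow L p \<one>\<^bsub>L\<^esub> = \<zero>\<^bsub>L\<^esub>"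
    using L.add.pow_ord_eq_1[OF L.one_closed] \<open>ring_char L = p\<close>
    unfolding ring_char_def add_pow_def by simp
  interpret P: mpoly_frobenius L "{1..n}" p
    by unfold_locales
      (use assms(2) charL \<open>F_finite_field p L\<close> in \<open>auto simp: F_finite_field_def\<close>)
  have \<mm>_eq: "\<mm> = P.var_ideal {1..n}" unfolding \<mm> R by (rule P.Idl_vars)
  interpret F: frobenius_split P.R p "P.var_ideal {1..n}"
    by (rule frobenius_split.intro[OF P.R_cring], rule frobenius_split_axioms.intro)
      (use assms(2) P.charR var_ideal_prime[OF L.field_axioms order_refl] P.cartier_reg P.cartier_one in auto)
  define G where "G = {f} \<union> (\<lambda>i. mpoly_pderiv L i f) ` {1..n}"
  have f: "f \<in> carrier P.R" using assms(10) unfolding R .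
  have G: "finite G" "G \<subseteq> carrier P.R" using f P.pderiv_in_carrier[OF f] by (auto simp: G_def)
  have Jac: "Jac L {1..n} f = Idl\<^bsub>P.R\<^esub> G" by (simp add: Jac_def G_def)
  let ?J = "Idl\<^bsub>P.R\<^esub> G"
  have J: "ideal ?J P.R" by (rule P.R.genideal_ideal[OF G(2)])
  \<comment> \<open>For \<open>f\<close> itself the product is \<open>f [^] p\<close>, so a
    splitting of Frobenius serves. The partial derivatives need the map of
    \<open>cartier_pderiv\<close>, which depends on the variable.\<close>
  have jac: "\<exists>\<psi>\<in>cartier_maps P.R p. \<psi> (f [^]\<^bsub>P.R\<^esub> (p - 1) \<otimes>\<^bsub>P.R\<^esub> g) = g" if g: "g \<in> G" for g
  proof (cases "g = f")
    case True
    obtain \<psi> where \<psi>: "\<psi> \<in> cartier_maps P.R p" "\<psi> \<one>\<^bsub>P.R\<^esub> = \<one>\<^bsub>P.R\<^esub>" using F.cartier_one by blast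
    have "\<psi> (f [^]\<^bsub>P.R\<^esub> (p - 1) \<otimes>\<^bsub>P.R\<^esub> f) = f"
      unfolding F.pow_p_pred[OF f] F.cartier_pow[OF \<psi>(1) f] \<psi>(2) by (rule P.R.r_one[OF f])
    then show ?thesis unfolding True using \<psi>(1) by blast
  next
    case False
    then obtain i where i: "i \<in> {1..n}" "g = mpoly_pderiv L i f" using g by (auto simp: G_def)
    show ?thesis unfolding i(2) by (rule P.cartier_pderiv[OF i(1) f])
  qed
  have bound: "k \<le> l" if "\<And>i. i \<le> k \<Longrightarrow> ideal (N i) P.R \<and> G \<subseteq> N i" "\<And>i. i < k \<Longrightarrow> N i \<subset> N (Suc i)"
    for N and k :: nat
  proof (rule P.R.ideal_chain_le_length[OF J])
    show "enat l = module_length P.R (quot_module P.R ?J)" using l unfolding Jac R .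
    show "ideal (N i) P.R \<and> ?J \<subseteq> N i" if "i \<le> k" for i
      using \<open>\<And>i. i \<le> k \<Longrightarrow> ideal (N i) P.R \<and> G \<subseteq> N i\<close>[OF that] P.R.genideal_minimal by blast
  qed (rule that(2))
  have ne: "{1..n} \<noteq> {}" using \<open>n \<ge> 1\<close> by simp
  have rad: "radical P.R ?J = P.var_ideal {1..n}" using assms(11) unfolding Jac R \<mm>_eq .
  obtain K where "P.deg_ideal K \<subseteq> ?J"
    using P.deg_ideal_subset_of_radical[OF finite_atLeastAtMost ne J] rad by blast
  then have "P.deg_ideal l \<subseteq> ?J"
  proof (rule P.deg_ideal_length_subset[OF J])
    fix N :: "nat \<Rightarrow> (nat multiset \<Rightarrow> 'a) set" and k :: nat
    assume *: "\<And>i. i \<le> k \<Longrightarrow> ideal (N i) P.R \<and> ?J \<subseteq> N i" and **: "\<And>i. i < k \<Longrightarrow> N i \<subset> N (Suc i)"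
    show "k \<le> l"
    proof (rule bound[of k N])
      fix i assume "i \<le> k"
      then show "ideal (N i) P.R \<and> G \<subseteq> N i" using * P.R.genideal_self[OF G(2)] by blast
    qed (rule **)
  qed
  then have D: "P.deg_ideal (Suc l) \<subseteq> Idl\<^bsub>P.R\<^esub> {x \<otimes>\<^bsub>P.R\<^esub> y | x y. x \<in> P.var_ideal {1..n} \<and> y \<in> ?J}"
    using ideal.Icarr[OF J] by (intro P.deg_ideal_Suc_subset) auto
  \<comment> \<open>The factors are \<open>n\<close> from the pigeonhole principle,
    \<open>Suc l\<close> from the degree at which monomials enter the product of the maximal and the
    Jacobian ideal, and \<open>p ^ Suc l\<close> from the level that determines the tower; the
    exponent \<open>2 * l + 1\<close> dominates \<open>Suc l\<close>.\<close>
  have Nge: "card {1..n} * (Suc l * p ^ Suc l) \<le> N"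
  proof -
    have "enat (p ^ (2 * l + 1) * (l + 1)) * enat n \<le> enat N"
      unfolding N R using krull_dim_mpoly_ge[OF L.field_axioms, of n] by (intro mult_left_mono) auto
    then have "p ^ (2 * l + 1) * (l + 1) * n \<le> N" by simp
    moreover have "p ^ Suc l \<le> p ^ (2 * l + 1)" using P.p_pos by (intro power_increasing) auto
    then have "n * (Suc l * p ^ Suc l) \<le> n * (Suc l * p ^ (2 * l + 1))" by (intro mult_le_mono order_refl)
    ultimately show ?thesis by (simp add: algebra_simps)
  qed
  have "h \<in> P.deg_ideal N" using assms(14) P.var_ideal_power_subset[of N] unfolding \<mm>_eq R by blast
  also have "\<dots> \<subseteq> frob_power P.R p (Suc l) (P.deg_ideal (Suc l))"
    by (rule P.deg_ideal_frob_power[OF finite_atLeastAtMost ne _ P.p_pos Nge]) simp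
  also have "\<dots> = frob_pow P.R p (Suc l) (P.deg_ideal (Suc l))"
    by (rule F.frob_power_eq_frob_pow[OF P.deg_ideal_ideal])
  also have "\<dots> \<subseteq> frob_pow P.R p (Suc l) (Idl\<^bsub>P.R\<^esub> {x \<otimes>\<^bsub>P.R\<^esub> y | x y. x \<in> P.var_ideal {1..n} \<and> y \<in> ?J})"
    by (rule F.frob_pow_mono[OF D])
  finally have h: "h \<in> frob_pow P.R p (Suc l) (Idl\<^bsub>P.R\<^esub> {x \<otimes>\<^bsub>P.R\<^esub> y | x y. x \<in> P.var_ideal {1..n} \<and> y \<in> ?J})" .
  have hc: "h \<in> carrier P.R" using \<open>h \<in> P.deg_ideal N\<close> by (simp add: mono_ideal_def)
  show ?thesis
    unfolding S \<iota> \<mm>_eq R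
  proof (rule F.test_ideal_eqI[OF f P.R.a_closed[OF f hc] assms(15,16)])
    fix e a assume e: "Suc l \<le> e" and a: "a < p ^ e"
    show "F.root e (f [^]\<^bsub>P.R\<^esub> a) = F.root e ((f \<oplus>\<^bsub>P.R\<^esub> h) [^]\<^bsub>P.R\<^esub> a)"
    proof (rule F.root_perturb[OF f G _ _ h e a])
      fix N :: "nat \<Rightarrow> (nat multiset \<Rightarrow> 'a) set" and k :: nat
      assume "\<And>i. i \<le> k \<Longrightarrow> ideal (N i) P.R \<and> G \<subseteq> N i" and "\<And>i. i < k \<Longrightarrow> N i \<subset> N (Suc i)"
      then show "k \<le> l" by (rule bound[of k N])
    qed (rule jac)
  qed
qed

end
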